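(* Let $N_1,\ldots,N_n$ be LF objects and let $\Gamma$, $\Gamma_0$ and $\Theta$ be LF contexts with $\Gamma_0 = x_1:B_1,\ldots,x_n:B_n$. Further, let $\Pi x_1{:}B_1.\cdots\Pi x_n{:}B_n.A$ be an LF type with $A$ a base type. Finally, suppose that for some $i$ there are derivations of 1. $x_1:B_1,\ldots,x_n:B_n,\Theta;\ x_i \sqsubset_t A$, 2. $\Gamma,\Gamma_0,\Theta \vdash A:\mathrm{Type}$, and 3. $\Gamma,\Theta[N_1/x_1,\ldots,N_n/x_n] \vdash A[N_1/x_1,\ldots,N_n/x_n] : \mathrm{Type}$. Then there is a derivation of $\Gamma \vdash N_i : B_i[N_1/x_1,\ldots,N_{i-1}/x_{i-1}]$.
   Context: **LF.** The Edinburgh Logical Framework has kinds $K ::= \mathrm{Type}\mid \Pi x{:}A.K$, types $A,B ::= a\mid \Pi x{:}A.B\mid A\,M$ and objects $M,N ::= c\mid x\mid \lambda x{:}A.M\mid M\,N$, with $a$ type constants, $c$ object constants, $x$ object variables. Expressions differing only in bound variable names are identified. A signature $\Sigma$ is a list of declarations $a:K$ and $c:A$ (distinct constants, each $K$, $A$ well-formed in the empty context over the earlier declarations); a fixed valid signature is left implicit throughout. A context $\Gamma$ is a list of declarations $x:A$. $U^\beta$ is the $\beta$-normal form of $U$. The judgments are derived by these rules: - $\vdash\cdot\ ctx$; and $\vdash\Gamma,x{:}A\ ctx$ if $\vdash\Gamma\ ctx$, $\Gamma\vdash A:\mathrm{Type}$, $x\notin\mathrm{dom}(\Gamma)$. -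 $\Gamma\vdash\mathrm{Type}\ kind$ if $\vdash\Gamma\ ctx$; $\Gamma\vdash\Pi x{:}A.K\ kind$ if $\Gamma\vdash A:\mathrm{Type}$ and $\Gamma,x{:}A\vdash K\ kind$. - $\Gamma\vdash a:K^\beta$ if $\vdash\Gamma\ ctx$ and $a:K\in\Sigma$; $\Gamma\vdash\Pi x{:}A.B:\mathrm{Type}$ if $\Gamma\vdash A:\mathrm{Type}$ and $\Gamma,x{:}A\vdash B:\mathrm{Type}$; $\Gamma\vdash A\,M:(K[M/x])^\beta$ if $\Gamma\vdash A:\Pi x{:}B.K$ and $\Gamma\vdash M:B$. - $\Gamma\vdash u:A^\beta$ if $\vdash\Gamma\ ctx$ and $u:A$ is in $\Gamma$ or $\Sigma$; $\Gamma\vdash\lambda x{:}A.M:\Pi x{:}A^\beta.B$ if $\Gamma\vdash A:\mathrm{Type}$ and $\Gamma,x{:}A\vdash M:B$; $\Gamma\vdash M\,N:(B[N/x])^\beta$ if $\Gamma\vdash M:\Pi x{:}A.B$ and $\Gamma\vdash N:A$. A base type is a type $a\,M_1\cdots M_k$ where $a$ is a type constant whose kind has exactly $k$ leading $\Pi$s. $U[N_1/x_1,\ldots,N_n/x_n]$ is simultaneous capture-avoiding substitution for free occurrences; on contexts it acts on each declared type. Since only $\beta$-normal classifiers are derivable, a judgment $\Gamma\vdash M:A$ with $A$ not $\beta$-normal is read as $\Gamma\vdash M:A^\beta$ (the object $M$ itself is not normalized). **Strictness.** The relation $X;\delta;x\sqsubset_o M$ ($X$ and $\delta$ sets of variables,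 $x$ a variable, $M$ an object) is inductively defined by: - (INIT$_o$) $X;\delta;x\sqsubset_o x\,y_1\cdots y_k$ if $y_1,\ldots,y_k$ are distinct variables, all in $\delta$. - (APP$_o$) $X;\delta;x\sqsubset_o y\,M_1\cdots M_k$ if $y$ is a variable or constant with $y\notin X$ and $X;\delta;x\sqsubset_o M_j$ for some $j$. - (ABS$_o$) $X;\delta;x\sqsubset_o \lambda y{:}A.M$ if $X;\delta,y;x\sqsubset_o M$. The relation $\Gamma;x\sqsubset_t A$ ($\Gamma$ a context, $x$ a variable, $A$ a type) is inductively defined by: - (APP$_t$) $\Gamma;x\sqsubset_t a\,M_1\cdots M_k$ if $\mathrm{dom}(\Gamma);\cdot;x\sqsubset_o M_j$ for some $j$ ($a$ a type constant). - (PI$_t$) $\Gamma;x\sqsubset_t \Pi y{:}A.B$ if $\Gamma,y{:}A;x\sqsubset_t B$. - (CTX$_t$) $\Gamma_1,y{:}B,\Gamma_2;x\sqsubset_t A$ if $\Gamma_1;x\sqsubset_t B$ and $\Gamma_1,y{:}B,\Gamma_2;y\sqsubset_t A$.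
   Formalization: The objects N_1,…,N_n are taken not to mention the variables declared in Θ (they live in the scope of Γ); without this the claim fails, e.g. for Γ empty, Γ_0 = x_1:o, Θ = y:o, A = a x_1, N_1 = y. *)

theory Defs
  imports Main
begin

text \<open>
  Expressions are represented with de Bruijn indices, so that expressions differing only in
  bound variable names are equal.  Contexts are lists whose head is the most recent
  declaration: the variable \<open>Var x\<close> refers to entry \<open>x\<close> of the context, and the type at that
  entry lives in the context \<open>drop (Suc x) \<Gamma>\<close>.  The context written \<open>\<Gamma>\<^sub>1, \<Gamma>\<^sub>2\<close> on paper is thus
  \<open>\<Gamma>\<^sub>2 @ \<Gamma>\<^sub>1\<close>, and \<open>x\<^sub>1:B\<^sub>1, \<dots>, x\<^sub>n:B\<^sub>n\<close> is \<open>rev [B\<^sub>1, \<dots>, B\<^sub>n]\<close>, where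
  \<open>x\<^sub>j\<close> has index \<open>n - j\<close>.  All declared names of a context are automatically distinct.
\<close>

type_synonym cname = string

datatype ty = TCon cname | Pi ty ty | TApp ty obj
  and obj = Con cname | Var nat | Lam ty obj | App obj obj

datatype kind = Type | KPi ty kind

type_synonym ctx = "ty list"

definition up_ren :: "(nat \<Rightarrow> nat) \<Rightarrow> nat \<Rightarrow> nat" where
  "up_ren \<rho> = case_nat 0 (\<lambda>x. Suc (\<rho> x))"

primrec ren_ty :: "(nat \<Rightarrow> nat) \<Rightarrow> ty \<Rightarrow> ty"
  and ren_obj :: "(nat \<Rightarrow> nat) \<Rightarrow> obj \<Rightarrow> obj" where
  "ren_ty \<rho> (TCon a) = TCon a"
| "ren_ty \<rho> (Pi A B) = Pi (ren_ty \<rho> A) (ren_ty (up_ren \<rho>) B)"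
| "ren_ty \<rho> (TApp A M) = TApp (ren_ty \<rho> A) (ren_obj \<rho> M)"
| "ren_obj \<rho> (Con c) = Con c"
| "ren_obj \<rho> (Var x) = Var (\<rho> x)"
| "ren_obj \<rho> (Lam A M) = Lam (ren_ty \<rho> A) (ren_obj (up_ren \<rho>) M)"
| "ren_obj \<rho> (App M N) = App (ren_obj \<rho> M) (ren_obj \<rho> N)"

definition up :: "(nat \<Rightarrow> obj) \<Rightarrow> nat \<Rightarrow> obj" where
  "up \<sigma> = case_nat (Var 0) (\<lambda>x. ren_obj Suc (\<sigma> x))"

primrec subst_ty :: "(nat \<Rightarrow> obj) \<Rightarrow> ty \<Rightarrow> ty"
  and subst_obj :: "(nat \<Rightarrow> obj) \<Rightarrow> obj \<Rightarrow> obj" where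
  "subst_ty \<sigma> (TCon a) = TCon a"
| "subst_ty \<sigma> (Pi A B) = Pi (subst_ty \<sigma> A) (subst_ty (up \<sigma>) B)"
| "subst_ty \<sigma> (TApp A M) = TApp (subst_ty \<sigma> A) (subst_obj \<sigma> M)"
| "subst_obj \<sigma> (Con c) = Con c"
| "subst_obj \<sigma> (Var x) = \<sigma> x"
| "subst_obj \<sigma> (Lam A M) = Lam (subst_ty \<sigma> A) (subst_obj (up \<sigma>) M)"
| "subst_obj \<sigma> (App M N) = App (subst_obj \<sigma> M) (subst_obj \<sigma> N)"

primrec subst_kind :: "(nat \<Rightarrow> obj) \<Rightarrow> kind \<Rightarrow> kind" where
  "subst_kind \<sigma> Type = Type"
| "subst_kind \<sigma> (KPi A K) = KPi (subst_ty \<sigma> A) (subst_kind (up \<sigma>) K)"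

text \<open>
  \<open>inst [N\<^sub>1, \<dots>, N\<^sub>n]\<close> is the substitution \<open>[N\<^sub>1/x\<^sub>1, \<dots>, N\<^sub>n/x\<^sub>n]\<close> for expressions in a context
  \<open>\<Gamma>, x\<^sub>1:B\<^sub>1, \<dots>, x\<^sub>n:B\<^sub>n\<close>, the \<open>N\<^sub>j\<close> being read in \<open>\<Gamma>\<close>; \<open>x\<^sub>n\<close> has index 0.
\<close>

definition inst :: "obj list \<Rightarrow> nat \<Rightarrow> obj" where
  "inst Ns x = (if x < length Ns then rev Ns ! x else Var (x - length Ns))"

text \<open>
  If \<open>\<Theta>\<close> extends the domain context of \<open>\<sigma>\<close>, then \<open>subst_ctx \<sigma> \<Theta>\<close> is the result of applying
  \<open>\<sigma>\<close> to each declared type, and \<open>ups (length \<Theta>) \<sigma>\<close> is \<open>\<sigma>\<close> as it acts on expressions that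
  may in addition mention the variables of \<open>\<Theta>\<close>, which are left fixed.
\<close>

abbreviation ups :: "nat \<Rightarrow> (nat \<Rightarrow> obj) \<Rightarrow> nat \<Rightarrow> obj" where
  "ups k \<sigma> \<equiv> (up ^^ k) \<sigma>"

primrec subst_ctx :: "(nat \<Rightarrow> obj) \<Rightarrow> ctx \<Rightarrow> ctx" where
  "subst_ctx \<sigma> [] = []"
| "subst_ctx \<sigma> (A # \<Theta>) = subst_ty (ups (length \<Theta>) \<sigma>) A # subst_ctx \<sigma> \<Theta>"

definition lookup :: "ctx \<Rightarrow> nat \<Rightarrow> ty" where
  "lookup \<Gamma> x = ren_ty (\<lambda>y. y + Suc x) (\<Gamma> ! x)"

inductive beta_ty :: "ty \<Rightarrow> ty \<Rightarrow> bool"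
  and beta_obj :: "obj \<Rightarrow> obj \<Rightarrow> bool" where
  "beta_ty A A' \<Longrightarrow> beta_ty (Pi A B) (Pi A' B)"
| "beta_ty B B' \<Longrightarrow> beta_ty (Pi A B) (Pi A B')"
| "beta_ty A A' \<Longrightarrow> beta_ty (TApp A M) (TApp A' M)"
| "beta_obj M M' \<Longrightarrow> beta_ty (TApp A M) (TApp A M')"
| "beta_obj (App (Lam A M) N) (subst_obj (inst [N]) M)"
| "beta_ty A A' \<Longrightarrow> beta_obj (Lam A M) (Lam A' M)"
| "beta_obj M M' \<Longrightarrow> beta_obj (Lam A M) (Lam A M')"
| "beta_obj M M' \<Longrightarrow> beta_obj (App M N) (App M' N)"
| "beta_obj N N' \<Longrightarrow> beta_obj (App M N) (App M N')"

inductive beta_kind :: "kind \<Rightarrow> kind \<Rightarrow> bool" where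
  "beta_ty A A' \<Longrightarrow> beta_kind (KPi A K) (KPi A' K)"
| "beta_kind K K' \<Longrightarrow> beta_kind (KPi A K) (KPi A K')"

text \<open>
  \<open>nf_ty A A'\<close> says that \<open>A\<^sup>\<beta>\<close> exists and is \<open>A'\<close>.  Raw expressions need not have normal forms,
  so normalization is a relation; a rule mentioning \<open>A\<^sup>\<beta>\<close> applies only if it exists.
\<close>

definition nf_ty :: "ty \<Rightarrow> ty \<Rightarrow> bool" where
  "nf_ty A A' \<longleftrightarrow> beta_ty\<^sup>*\<^sup>* A A' \<and> (\<nexists>C. beta_ty A' C)"

definition nf_kind :: "kind \<Rightarrow> kind \<Rightarrow> bool" where
  "nf_kind K K' \<longleftrightarrow> beta_kind\<^sup>*\<^sup>* K K' \<and> (\<nexists>L. beta_kind K' L)"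

datatype decl = TDecl cname kind | ODecl cname ty

type_synonym sig = "decl list"

inductive wf_ctx :: "sig \<Rightarrow> ctx \<Rightarrow> bool"
  and wf_kind :: "sig \<Rightarrow> ctx \<Rightarrow> kind \<Rightarrow> bool"
  and has_kind :: "sig \<Rightarrow> ctx \<Rightarrow> ty \<Rightarrow> kind \<Rightarrow> bool"
  and has_type :: "sig \<Rightarrow> ctx \<Rightarrow> obj \<Rightarrow> ty \<Rightarrow> bool"
  for \<Sigma> :: sig where
  ctx_nil: "wf_ctx \<Sigma> []"
| ctx_cons: "wf_ctx \<Sigma> \<Gamma> \<Longrightarrow> has_kind \<Sigma> \<Gamma> A Type \<Longrightarrow> wf_ctx \<Sigma> (A # \<Gamma>)"

| kind_type: "wf_ctx \<Sigma> \<Gamma> \<Longrightarrow> wf_kind \<Sigma> \<Gamma> Type"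
| kind_pi: "has_kind \<Sigma> \<Gamma> A Type \<Longrightarrow> wf_kind \<Sigma> (A # \<Gamma>) K \<Longrightarrow> wf_kind \<Sigma> \<Gamma> (KPi A K)"

| ty_con: "wf_ctx \<Sigma> \<Gamma> \<Longrightarrow> TDecl a K \<in> set \<Sigma> \<Longrightarrow> nf_kind K K' \<Longrightarrow>
    has_kind \<Sigma> \<Gamma> (TCon a) K'"
| ty_pi: "has_kind \<Sigma> \<Gamma> A Type \<Longrightarrow> has_kind \<Sigma> (A # \<Gamma>) B Type \<Longrightarrow>
    has_kind \<Sigma> \<Gamma> (Pi A B) Type"
| ty_app: "has_kind \<Sigma> \<Gamma> A (KPi B K) \<Longrightarrow> has_type \<Sigma> \<Gamma> M B \<Longrightarrow>
    nf_kind (subst_kind (inst [M]) K) K' \<Longrightarrow> has_kind \<Sigma> \<Gamma> (TApp A M) K'"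

| obj_con: "wf_ctx \<Sigma> \<Gamma> \<Longrightarrow> ODecl c A \<in> set \<Sigma> \<Longrightarrow> nf_ty A A' \<Longrightarrow>
    has_type \<Sigma> \<Gamma> (Con c) A'"
| obj_var: "wf_ctx \<Sigma> \<Gamma> \<Longrightarrow> x < length \<Gamma> \<Longrightarrow> nf_ty (lookup \<Gamma> x) A' \<Longrightarrow>
    has_type \<Sigma> \<Gamma> (Var x) A'"
| obj_lam: "has_kind \<Sigma> \<Gamma> A Type \<Longrightarrow> has_type \<Sigma> (A # \<Gamma>) M B \<Longrightarrow> nf_ty A A' \<Longrightarrow>
    has_type \<Sigma> \<Gamma> (Lam A M) (Pi A' B)"
| obj_app: "has_type \<Sigma> \<Gamma> M (Pi A B) \<Longrightarrow> has_type \<Sigma> \<Gamma> N A \<Longrightarrow>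
    nf_ty (subst_ty (inst [N]) B) B' \<Longrightarrow> has_type \<Sigma> \<Gamma> (App M N) B'"

text \<open>The reading of \<open>\<Gamma> \<turnstile> M : A\<close> for a type \<open>A\<close> that need not be \<open>\<beta>\<close>-normal.\<close>

definition has_type_nf :: "sig \<Rightarrow> ctx \<Rightarrow> obj \<Rightarrow> ty \<Rightarrow> bool" where
  "has_type_nf \<Sigma> \<Gamma> M A \<longleftrightarrow> (\<exists>A'. nf_ty A A' \<and> has_type \<Sigma> \<Gamma> M A')"

text \<open>As for contexts, the head of a signature is its latest declaration.\<close>

inductive valid_sig :: "sig \<Rightarrow> bool" where
  "valid_sig []"
| "valid_sig \<Sigma> \<Longrightarrow> wf_kind \<Sigma> [] K \<Longrightarrow> (\<nexists>L. TDecl a L \<in> set \<Sigma>) \<Longrightarrow> valid_sig (TDecl a K # \<Sigma>)"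
| "valid_sig \<Sigma> \<Longrightarrow> has_kind \<Sigma> [] A Type \<Longrightarrow> (\<nexists>B. ODecl c B \<in> set \<Sigma>) \<Longrightarrow>
    valid_sig (ODecl c A # \<Sigma>)"

definition apps :: "obj \<Rightarrow> obj list \<Rightarrow> obj" where
  "apps M Ns = foldl App M Ns"

definition tapps :: "ty \<Rightarrow> obj list \<Rightarrow> ty" where
  "tapps A Ms = foldl TApp A Ms"

primrec kind_arity :: "kind \<Rightarrow> nat" where
  "kind_arity Type = 0"
| "kind_arity (KPi A K) = Suc (kind_arity K)"

definition base_type :: "sig \<Rightarrow> ty \<Rightarrow> bool" where
  "base_type \<Sigma> A \<longleftrightarrow>
     (\<exists>a K Ms. TDecl a K \<in> set \<Sigma> \<and> length Ms = kind_arity K \<and> A = tapps (TCon a) Ms)"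

text \<open>
  Under a binder, \<open>X\<close>, \<open>\<delta>\<close> and \<open>x\<close> are shifted and the bound variable is \<open>0\<close>; it is therefore
  distinct from \<open>x\<close> and from all elements of \<open>X\<close> and \<open>\<delta>\<close>.
\<close>

inductive strict_obj :: "nat set \<Rightarrow> nat set \<Rightarrow> nat \<Rightarrow> obj \<Rightarrow> bool" where
  init_o: "distinct ys \<Longrightarrow> set ys \<subseteq> \<delta> \<Longrightarrow> strict_obj X \<delta> x (apps (Var x) (map Var ys))"
| app_var_o: "y \<notin> X \<Longrightarrow> M \<in> set Ms \<Longrightarrow> strict_obj X \<delta> x M \<Longrightarrow>
    strict_obj X \<delta> x (apps (Var y) Ms)"
| app_con_o: "M \<in> set Ms \<Longrightarrow> strict_obj X \<delta> x M \<Longrightarrow> strict_obj X \<delta> x (apps (Con c) Ms)"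
| abs_o: "strict_obj (Suc ` X) (insert 0 (Suc ` \<delta>)) (Suc x) M \<Longrightarrow> strict_obj X \<delta> x (Lam A M)"

text \<open>
  The domain of \<open>\<Gamma>\<close> is the set of indices \<open>{..<length \<Gamma>}\<close>; larger indices denote variables not
  declared in \<open>\<Gamma>\<close>.  In \<open>ctx_t\<close>, the variable \<open>y\<close> of the entry \<open>B\<close> has index \<open>length \<Gamma>\<^sub>2\<close>, and a
  variable with index \<open>x\<close> relative to \<open>\<Gamma>\<^sub>1\<close> has index \<open>x + Suc (length \<Gamma>\<^sub>2)\<close> relative to the
  whole context.
\<close>

inductive strict_ty :: "ctx \<Rightarrow> nat \<Rightarrow> ty \<Rightarrow> bool" where
  app_t: "M \<in> set Ms \<Longrightarrow> strict_obj {..<length \<Gamma>} {} x M \<Longrightarrow>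
    strict_ty \<Gamma> x (tapps (TCon a) Ms)"
| pi_t: "strict_ty (A # \<Gamma>) (Suc x) B \<Longrightarrow> strict_ty \<Gamma> x (Pi A B)"
| ctx_t: "strict_ty \<Gamma>\<^sub>1 x B \<Longrightarrow> strict_ty (\<Gamma>\<^sub>2 @ B # \<Gamma>\<^sub>1) (length \<Gamma>\<^sub>2) A \<Longrightarrow>
    strict_ty (\<Gamma>\<^sub>2 @ B # \<Gamma>\<^sub>1) (x + Suc (length \<Gamma>\<^sub>2)) A"

end

theory Submission
  imports Defs "HOL-Library.Confluence"
begin

text \<open>
  Call a term \<open>M\<close> with a typing \<open>M : E\<close> before the instantiation \<open>\<sigma>\<close> \<^emph>\<open>good\<close> if \<open>M[\<sigma>]\<close> has type
  \<open>(E[\<sigma>])\<^sup>\<beta>\<close> and \<open>E[\<sigma>]\<close> is itself a type, although \<open>\<sigma>\<close> is not known to be well typed.  A base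
  type that is well formed before and after instantiation has good arguments, because the kind of
  its head is closed, and goodness passes to the arguments of a rigid head and below abstractions.
  So it reaches a strict occurrence \<open>x\<^sub>i y\<^sub>1 \<dots> y\<^sub>k\<close>.  There the type of \<open>N\<^sub>i y\<^sub>1 \<dots> y\<^sub>k\<close> is known,
  and since the \<open>y\<^sub>j\<close> are distinct bound variables they can be abstracted again, which determines the
  type of \<open>N\<^sub>i\<close> as \<open>(B\<^sub>i[\<sigma>])\<^sup>\<beta>\<close>.

  If \<open>x\<^sub>i\<close> is strict only in the type \<open>B\<^sub>j\<close> of a strict \<open>x\<^sub>j\<close>, the argument is repeated for \<open>B\<^sub>j\<close>.
  The second half of goodness provides what this needs: \<open>B\<^sub>j\<^sup>\<beta>[\<sigma>]\<close> is a type.  (That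
  \<open>(B\<^sub>j[\<sigma>])\<^sup>\<beta>\<close> is a type would be too little, as it only contains a normal form of \<open>N\<^sub>i\<close>.)

  As the typing rules demand that \<open>\<beta>\<close>-normal forms exist, substitution and subject reduction
  require normalization, which is obtained from an erasure to simple types.
\<close>

section \<open>Substitution\<close>

text \<open>What is known about the instance is read off the second derivation by inversion and
  compared with the first through uniqueness of classifiers. As classifiers are \<beta>-normal,
  confluence makes uniqueness a syntactic equation. On the instantiated side the substitution lemma
  serves only to substitute a single argument already typed there.

  Weak normalization is enough: the rules ask for the existence of a normal form, and confluence
  makes it unique. Erasing the objects from a type removes dependency, because the erased type is
  unchanged by substitution and reduction. So an LF derivation erases to a simple one, and Tait's
  method applies. Annotations and the arguments inside types stay in the terms, as they have to be
  normalized as well.\<close>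

lemma up_Var: "up Var = Var"
  by (auto simp: up_def split: nat.split)

lemma up_ren_comp: "up_ren \<rho> \<circ> up_ren \<rho>' = up_ren (\<rho> \<circ> \<rho>')"
  by (auto simp: up_ren_def fun_eq_iff split: nat.split)

lemma up_comp_up_ren: "up \<sigma> \<circ> up_ren \<rho> = up (\<sigma> \<circ> \<rho>)"
  by (auto simp: up_ren_def up_def fun_eq_iff split: nat.split)

lemma up_Var_comp: "up (Var \<circ> \<rho>) = Var \<circ> up_ren \<rho>"
  by (auto simp: up_ren_def up_def fun_eq_iff split: nat.split)

lemma up_simps [simp]: "up \<sigma> 0 = Var 0" "up \<sigma> (Suc x) = ren_obj Suc (\<sigma> x)"
  by (simp_all add: up_def)

lemma up_ren_simps [simp]: "up_ren \<rho> 0 = 0" "up_ren \<rho> (Suc x) = Suc (\<rho> x)"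
  by (simp_all add: up_ren_def)

lemma up_ren_Suc: "up_ren \<rho> \<circ> Suc = Suc \<circ> \<rho>"
  by auto

lemma ren_ty_eq_subst: "ren_ty \<rho> A = subst_ty (Var \<circ> \<rho>) A"
  and ren_obj_eq_subst: "ren_obj \<rho> M = subst_obj (Var \<circ> \<rho>) M"
  by (induct A and M arbitrary: \<rho> and \<rho>) (simp_all add: up_Var_comp)

lemma subst_ty_Var [simp]: "subst_ty Var A = A"
  and subst_obj_Var [simp]: "subst_obj Var M = M"
  by (induct A and M) (simp_all add: up_Var)

lemma ren_ren_ty: "ren_ty \<rho> (ren_ty \<rho>' A) = ren_ty (\<rho> \<circ> \<rho>') A"
  and ren_ren_obj: "ren_obj \<rho> (ren_obj \<rho>' M) = ren_obj (\<rho> \<circ> \<rho>') M"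
  by (induct A and M arbitrary: \<rho> \<rho>' and \<rho> \<rho>') (simp_all add: up_ren_comp)

lemma subst_ren_ty: "subst_ty \<sigma> (ren_ty \<rho> A) = subst_ty (\<sigma> \<circ> \<rho>) A"
  and subst_ren_obj: "subst_obj \<sigma> (ren_obj \<rho> M) = subst_obj (\<sigma> \<circ> \<rho>) M"
  by (induct A and M arbitrary: \<rho> \<sigma> and \<rho> \<sigma>) (simp_all add: up_comp_up_ren)

lemma ren_up: "ren_obj (up_ren \<rho>) \<circ> up \<sigma> = up (ren_obj \<rho> \<circ> \<sigma>)"
  by (auto simp: up_def fun_eq_iff ren_ren_obj up_ren_Suc split: nat.split)

lemma ren_subst_ty: "ren_ty \<rho> (subst_ty \<sigma> A) = subst_ty (ren_obj \<rho> \<circ> \<sigma>) A"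
  and ren_subst_obj: "ren_obj \<rho> (subst_obj \<sigma> M) = subst_obj (ren_obj \<rho> \<circ> \<sigma>) M"
  by (induct A and M arbitrary: \<rho> \<sigma> and \<rho> \<sigma>) (simp_all add: ren_up)

lemma up_comp_Suc: "up \<sigma> \<circ> Suc = ren_obj Suc \<circ> \<sigma>"
  by auto

lemma subst_up: "subst_obj (up \<tau>) \<circ> up \<sigma> = up (subst_obj \<tau> \<circ> \<sigma>)"
  by (auto simp: up_def fun_eq_iff subst_ren_obj ren_subst_obj up_comp_Suc[unfolded up_def]
      split: nat.split)

lemma subst_subst_ty: "subst_ty \<tau> (subst_ty \<sigma> A) = subst_ty (subst_obj \<tau> \<circ> \<sigma>) A"
  and subst_subst_obj: "subst_obj \<tau> (subst_obj \<sigma> M) = subst_obj (subst_obj \<tau> \<circ> \<sigma>) M"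
  by (induct A and M arbitrary: \<tau> \<sigma> and \<tau> \<sigma>) (simp_all add: subst_up)

lemma subst_kind_Var [simp]: "subst_kind Var K = K"
  by (induct K) (simp_all add: up_Var)

lemma subst_subst_kind: "subst_kind \<tau> (subst_kind \<sigma> K) = subst_kind (subst_obj \<tau> \<circ> \<sigma>) K"
  by (induct K arbitrary: \<tau> \<sigma>) (simp_all add: subst_up subst_subst_ty)

text \<open>Kinds have no renaming function of their own: renaming them is substitution by
  variables, and \<open>ren_kind_KPi\<close> restores the structural equation with
  \<open>up_ren\<close>.\<close>

abbreviation ren_kind :: "(nat \<Rightarrow> nat) \<Rightarrow> kind \<Rightarrow> kind" where
  "ren_kind \<rho> \<equiv> subst_kind (Var \<circ> \<rho>)"

lemma ren_kind_KPi: "ren_kind \<rho> (KPi A K) = KPi (ren_ty \<rho> A) (ren_kind (up_ren \<rho>) K)"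
  by (simp add: up_Var_comp ren_ty_eq_subst)

lemma inst_single: "inst [N] = case_nat N Var"
  by (auto simp: inst_def fun_eq_iff split: nat.split)

lemma comp_inst: "subst_obj \<sigma> \<circ> inst [N] = case_nat (subst_obj \<sigma> N) \<sigma>"
  by (auto simp: inst_single fun_eq_iff split: nat.split)

text \<open>Filling the variable bound by \<open>up\<close> undoes the shift of \<sigma>, so what
  remains is \<sigma> extended by \<open>N\<close>. Together with \<open>comp_inst\<close> this
  brings both orders of contracting and substituting to one environment.\<close>

lemma inst_comp_up: "subst_obj (inst [N]) \<circ> up \<sigma> = case_nat N \<sigma>"
proof
  fix x
  have "case_nat N Var \<circ> Suc = Var" by auto
  then show "(subst_obj (inst [N]) \<circ> up \<sigma>) x = case_nat N \<sigma> x"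
    by (cases x) (simp_all add: inst_single subst_ren_obj)
qed

lemma subst_inst_ty:
  "subst_ty \<sigma> (subst_ty (inst [N]) B) = subst_ty (inst [subst_obj \<sigma> N]) (subst_ty (up \<sigma>) B)"
  and subst_inst_obj:
  "subst_obj \<sigma> (subst_obj (inst [N]) M) = subst_obj (inst [subst_obj \<sigma> N]) (subst_obj (up \<sigma>) M)"
  and subst_inst_kind:
  "subst_kind \<sigma> (subst_kind (inst [N]) K) = subst_kind (inst [subst_obj \<sigma> N]) (subst_kind (up \<sigma>) K)"
  by (simp_all add: subst_subst_ty subst_subst_obj subst_subst_kind comp_inst inst_comp_up)

lemma ren_inst_ty:
  "ren_ty \<rho> (subst_ty (inst [N]) B) = subst_ty (inst [ren_obj \<rho> N]) (ren_ty (up_ren \<rho>) B)"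
  unfolding ren_ty_eq_subst ren_obj_eq_subst subst_inst_ty up_Var_comp ..

lemma ren_inst_obj:
  "ren_obj \<rho> (subst_obj (inst [N]) M) = subst_obj (inst [ren_obj \<rho> N]) (ren_obj (up_ren \<rho>) M)"
  unfolding ren_obj_eq_subst subst_inst_obj up_Var_comp ..

lemma ren_inst_kind:
  "ren_kind \<rho> (subst_kind (inst [N]) K) = subst_kind (inst [ren_obj \<rho> N]) (ren_kind (up_ren \<rho>) K)"
  unfolding ren_obj_eq_subst subst_inst_kind up_Var_comp ..

lemma inj_case_nat: "inj \<rho> \<Longrightarrow> y \<notin> range \<rho> \<Longrightarrow> inj (case_nat y \<rho>)"
  by (rule injI) (auto dest: injD simp: image_iff split: nat.split_asm)

lemma inj_up_ren: "inj \<rho> \<Longrightarrow> inj (up_ren \<rho>)"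
  unfolding up_ren_def by (rule inj_case_nat) (auto simp: inj_def)

lemma ren_ty_inject: "inj \<rho> \<Longrightarrow> ren_ty \<rho> A = ren_ty \<rho> A' \<Longrightarrow> A = A'"
  and ren_obj_inject: "inj \<rho> \<Longrightarrow> ren_obj \<rho> M = ren_obj \<rho> M' \<Longrightarrow> M = M'"
proof (induct A and M arbitrary: \<rho> A' and \<rho> M')
  case (TCon a) then show ?case by (cases A') auto
next
  case (Pi A B)
  then show ?case using Pi(2)[OF inj_up_ren] by (cases A') auto
next
  case (TApp A M) then show ?case by (cases A') auto
next
  case (Con c) then show ?case by (cases M') auto
next
  case (Var x) then show ?case by (cases M') (auto dest: injD)
next
  case (Lam A M)
  then show ?case using Lam(2)[OF inj_up_ren] by (cases M') auto
next
  case (App M N) then show ?case by (cases M') auto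
qed

section \<open>Reduction and confluence\<close>

inductive_cases beta_TCon: "beta_ty (TCon a) C"
inductive_cases beta_Pi: "beta_ty (Pi A B) C"
inductive_cases beta_TApp: "beta_ty (TApp A M) C"
inductive_cases beta_Con: "beta_obj (Con c) P"
inductive_cases beta_Var: "beta_obj (Var x) P"
inductive_cases beta_Lam: "beta_obj (Lam A M) P"
inductive_cases beta_App: "beta_obj (App M N) P"
inductive_cases beta_KType: "beta_kind Type L"
inductive_cases beta_KPi: "beta_kind (KPi A K) L"

lemma beta_subst_ty: "beta_ty A A' \<Longrightarrow> beta_ty (subst_ty \<sigma> A) (subst_ty \<sigma> A')"
  and beta_subst_obj: "beta_obj M M' \<Longrightarrow> beta_obj (subst_obj \<sigma> M) (subst_obj \<sigma> M')"
  by (induct arbitrary: \<sigma> and \<sigma> rule: beta_ty_beta_obj.inducts)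
    (simp_all add: subst_inst_obj beta_ty_beta_obj.intros)

text \<open>Renaming never creates a redex, because \<open>ren_obj\<close> yields an abstraction
  only from an abstraction. This holds for every \<rho>, and \<open>wn_obj_up\<close> applies it to
  one that is not injective.\<close>

lemma beta_ren_ty_D: "beta_ty (ren_ty \<rho> A) C \<Longrightarrow> \<exists>B. C = ren_ty \<rho> B \<and> beta_ty A B"
  and beta_ren_obj_D: "beta_obj (ren_obj \<rho> M) P \<Longrightarrow> \<exists>N. P = ren_obj \<rho> N \<and> beta_obj M N"
proof (induct A and M arbitrary: \<rho> C and \<rho> P)
  case (TCon a) then show ?case by (auto elim: beta_TCon)
next
  case (Pi A B)
  from Pi(3) show ?case
    by (auto elim!: beta_Pi dest!: Pi(1,2))
      (auto simp flip: ren_ty.simps(2) intro: beta_ty_beta_obj.intros(1,2))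
next
  case (TApp A M)
  from TApp(3) show ?case
    by (auto elim!: beta_TApp dest!: TApp(1,2))
      (auto simp flip: ren_ty.simps(3) intro: beta_ty_beta_obj.intros(3,4))
next
  case (Con c) then show ?case by (auto elim: beta_Con)
next
  case (Var x) then show ?case by (auto elim: beta_Var)
next
  case (Lam A M)
  from Lam(3) show ?case
    by (auto elim!: beta_Lam dest!: Lam(1,2))
      (auto simp flip: ren_obj.simps(3) intro: beta_ty_beta_obj.intros(6,7))
next
  case (App M N)
  from App(3) have "beta_obj (App (ren_obj \<rho> M) (ren_obj \<rho> N)) P" by simp
  then show ?case
  proof (cases rule: beta_App[consumes 1])
    case (1 A M1)
    then obtain A0 M0 where "M = Lam A0 M0" "M1 = ren_obj (up_ren \<rho>) M0"
      by (cases M) auto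
    with 1 show ?thesis
      by (metis ren_inst_obj beta_ty_beta_obj.intros(5))
  next
    case (2 M1)
    with App(1) show ?thesis by (metis ren_obj.simps(4) beta_ty_beta_obj.intros(8))
  next
    case (3 N1)
    with App(2) show ?thesis by (metis ren_obj.simps(4) beta_ty_beta_obj.intros(9))
  qed
qed

lemma rtranclp_map:
  assumes "\<And>x y. r x y \<Longrightarrow> s (f x) (f y)" and "r\<^sup>*\<^sup>* x y"
  shows "s\<^sup>*\<^sup>* (f x) (f y)"
  using assms(2) by induct (auto intro: assms(1) rtranclp.rtrancl_into_rtrancl)

lemma betas_subst_ty: "beta_ty\<^sup>*\<^sup>* A A' \<Longrightarrow> beta_ty\<^sup>*\<^sup>* (subst_ty \<sigma> A) (subst_ty \<sigma> A')"
  by (rule rtranclp_map[of beta_ty]) (auto intro: beta_subst_ty)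

lemma betas_ren_ty_D: "beta_ty\<^sup>*\<^sup>* (ren_ty \<rho> A) C \<Longrightarrow> \<exists>B. C = ren_ty \<rho> B \<and> beta_ty\<^sup>*\<^sup>* A B"
  by (induct rule: rtranclp_induct) (auto dest!: beta_ren_ty_D intro: rtranclp.rtrancl_into_rtrancl)

lemma betas_ren_obj_D: "beta_obj\<^sup>*\<^sup>* (ren_obj \<rho> M) P \<Longrightarrow> \<exists>N. P = ren_obj \<rho> N \<and> beta_obj\<^sup>*\<^sup>* M N"
  by (induct rule: rtranclp_induct) (auto dest!: beta_ren_obj_D intro: rtranclp.rtrancl_into_rtrancl)

lemma betas_Pi: "beta_ty\<^sup>*\<^sup>* A A' \<Longrightarrow> beta_ty\<^sup>*\<^sup>* B B' \<Longrightarrow> beta_ty\<^sup>*\<^sup>* (Pi A B) (Pi A' B')"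
  using rtranclp_map[of beta_ty beta_ty "\<lambda>A. Pi A B" A A'] rtranclp_map[of beta_ty beta_ty "Pi A'" B B']
  by (meson beta_ty_beta_obj.intros rtranclp_trans)

lemma betas_TApp: "beta_ty\<^sup>*\<^sup>* A A' \<Longrightarrow> beta_obj\<^sup>*\<^sup>* M M' \<Longrightarrow> beta_ty\<^sup>*\<^sup>* (TApp A M) (TApp A' M')"
  using rtranclp_map[of beta_ty beta_ty "\<lambda>A. TApp A M" A A'] rtranclp_map[of beta_obj beta_ty "TApp A'" M M']
  by (meson beta_ty_beta_obj.intros rtranclp_trans)

lemma betas_Lam: "beta_ty\<^sup>*\<^sup>* A A' \<Longrightarrow> beta_obj\<^sup>*\<^sup>* M M' \<Longrightarrow> beta_obj\<^sup>*\<^sup>* (Lam A M) (Lam A' M')"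
  using rtranclp_map[of beta_ty beta_obj "\<lambda>A. Lam A M" A A'] rtranclp_map[of beta_obj beta_obj "Lam A'" M M']
  by (meson beta_ty_beta_obj.intros rtranclp_trans)

lemma betas_App: "beta_obj\<^sup>*\<^sup>* M M' \<Longrightarrow> beta_obj\<^sup>*\<^sup>* N N' \<Longrightarrow> beta_obj\<^sup>*\<^sup>* (App M N) (App M' N')"
  using rtranclp_map[of beta_obj beta_obj "\<lambda>M. App M N" M M'] rtranclp_map[of beta_obj beta_obj "App M'" N N']
  by (meson beta_ty_beta_obj.intros rtranclp_trans)

section \<open>Parallel reduction and confluence\<close>

inductive par_ty :: "ty \<Rightarrow> ty \<Rightarrow> bool"
  and par_obj :: "obj \<Rightarrow> obj \<Rightarrow> bool" where
  par_TCon: "par_ty (TCon a) (TCon a)"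
| par_Pi: "par_ty A A' \<Longrightarrow> par_ty B B' \<Longrightarrow> par_ty (Pi A B) (Pi A' B')"
| par_TApp: "par_ty A A' \<Longrightarrow> par_obj M M' \<Longrightarrow> par_ty (TApp A M) (TApp A' M')"
| par_Con: "par_obj (Con c) (Con c)"
| par_Var: "par_obj (Var x) (Var x)"
| par_Lam: "par_ty A A' \<Longrightarrow> par_obj M M' \<Longrightarrow> par_obj (Lam A M) (Lam A' M')"
| par_App: "par_obj M M' \<Longrightarrow> par_obj N N' \<Longrightarrow> par_obj (App M N) (App M' N')"
| par_beta: "par_obj M M' \<Longrightarrow> par_obj N N' \<Longrightarrow>
    par_obj (App (Lam A M) N) (subst_obj (inst [N']) M')"

inductive_cases par_TConE: "par_ty (TCon a) C"
inductive_cases par_PiE: "par_ty (Pi A B) C"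
inductive_cases par_TAppE: "par_ty (TApp A M) C"
inductive_cases par_ConE: "par_obj (Con c) P"
inductive_cases par_VarE: "par_obj (Var x) P"
inductive_cases par_LamE: "par_obj (Lam A M) P"
inductive_cases par_AppE: "par_obj (App M N) P"

lemma par_refl_ty: "par_ty A A"
  and par_refl_obj: "par_obj M M"
  by (induct A and M) (auto intro: par_ty_par_obj.intros)

lemma beta_imp_par_ty: "beta_ty A A' \<Longrightarrow> par_ty A A'"
  and beta_imp_par_obj: "beta_obj M M' \<Longrightarrow> par_obj M M'"
  by (induct rule: beta_ty_beta_obj.inducts)
    (auto intro: par_ty_par_obj.intros par_refl_ty par_refl_obj)

lemma par_imp_betas_ty: "par_ty A A' \<Longrightarrow> beta_ty\<^sup>*\<^sup>* A A'"
  and par_imp_betas_obj: "par_obj M M' \<Longrightarrow> beta_obj\<^sup>*\<^sup>* M M'"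
proof (induct rule: par_ty_par_obj.inducts)
  case (par_beta M M' N N' A)
  then have "beta_obj\<^sup>*\<^sup>* (App (Lam A M) N) (App (Lam A M') N')"
    by (intro betas_App betas_Lam) auto
  then show ?case by (auto intro: rtranclp.rtrancl_into_rtrancl beta_ty_beta_obj.intros(5))
qed (auto intro: betas_Pi betas_TApp betas_Lam betas_App)

lemma par_ren_ty: "par_ty A A' \<Longrightarrow> par_ty (ren_ty \<rho> A) (ren_ty \<rho> A')"
  and par_ren_obj: "par_obj M M' \<Longrightarrow> par_obj (ren_obj \<rho> M) (ren_obj \<rho> M')"
  by (induct arbitrary: \<rho> and \<rho> rule: par_ty_par_obj.inducts)
    (auto simp: ren_inst_obj intro: par_ty_par_obj.intros)

lemma par_up: "\<forall>x. par_obj (\<sigma> x) (\<sigma>' x) \<Longrightarrow> \<forall>x. par_obj (up \<sigma> x) (up \<sigma>' x)"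
  by (auto simp: up_def intro: par_Var par_ren_obj split: nat.split)

lemma par_subst_ty:
  "par_ty A A' \<Longrightarrow> \<forall>x. par_obj (\<sigma> x) (\<sigma>' x) \<Longrightarrow> par_ty (subst_ty \<sigma> A) (subst_ty \<sigma>' A')"
  and par_subst_obj:
  "par_obj M M' \<Longrightarrow> \<forall>x. par_obj (\<sigma> x) (\<sigma>' x) \<Longrightarrow> par_obj (subst_obj \<sigma> M) (subst_obj \<sigma>' M')"
  by (induct arbitrary: \<sigma> \<sigma>' and \<sigma> \<sigma>' rule: par_ty_par_obj.inducts)
    (simp_all add: subst_inst_obj par_ty_par_obj.intros par_up)

lemma par_inst: "par_obj N N' \<Longrightarrow> \<forall>x. par_obj (inst [N] x) (inst [N'] x)"
  by (auto simp: inst_single par_refl_obj split: nat.split)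

text \<open>Parallel reduction contracts any selection of the visible redexes at once, so a
  divergence closes in one step on either side; single \<beta>-steps fail this because substitution
  duplicates redexes. It lies between one and many \<beta>-steps, so confluence carries
  over.\<close>

lemma par_diamond_ty: "par_ty A B \<Longrightarrow> par_ty A C \<Longrightarrow> \<exists>D. par_ty B D \<and> par_ty C D"
  and par_diamond_obj: "par_obj M N \<Longrightarrow> par_obj M P \<Longrightarrow> \<exists>Q. par_obj N Q \<and> par_obj P Q"
proof (induct arbitrary: C and P rule: par_ty_par_obj.inducts)
  case (par_TCon a) then show ?case by (auto elim: par_TConE intro: par_refl_ty)
next
  case (par_Pi A A' B B') then show ?case
    by (elim par_PiE) (blast intro: par_ty_par_obj.par_Pi)
next
  case (par_TApp A A' M M') then show ?case
    by (elim par_TAppE) (blast intro: par_ty_par_obj.par_TApp)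
next
  case (par_Con c) then show ?case by (auto elim: par_ConE intro: par_refl_obj)
next
  case (par_Var c) then show ?case by (auto elim: par_VarE intro: par_refl_obj)
next
  case (par_Lam A A' M M') then show ?case
    by (elim par_LamE) (blast intro: par_ty_par_obj.par_Lam)
next
  case (par_App M M' N N')
  from par_App(5) show ?case
  proof (cases rule: par_AppE[consumes 1])
    case (1 M2 N2)
    with par_App(2,4) show ?thesis by (blast intro: par_ty_par_obj.par_App)
  next
    case (2 M1 M2 N2 A)
    from 2(1) par_App(1) obtain A' M1' where M': "M' = Lam A' M1'"
      by (auto elim: par_LamE)
    \<comment> \<open>The induction hypothesis concerns the whole function, not its body. It is
      applied to the step to \<open>Lam A M2\<close> with unchanged annotation, and the common
      reduct of the bodies is read off.\<close>
    from par_App(2)[of "Lam A M2"] 2 obtain Q where "par_obj M' Q" "par_obj (Lam A M2) Q"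
      by (auto intro: par_Lam par_refl_ty)
    then obtain A3 M3 where "par_obj M1' M3" "par_obj M2 M3"
      unfolding M' by (auto elim!: par_LamE)
    moreover from par_App(4) 2 obtain N3 where "par_obj N' N3" "par_obj N2 N3" by blast
    ultimately show ?thesis
      unfolding M' 2(2) by (meson par_beta par_subst_obj par_inst)
  qed
next
  case (par_beta M M' N N' A)
  from par_beta(5) show ?case
  proof (cases rule: par_AppE[consumes 1])
    case (1 M2 N2)
    then obtain A3 M3 where "M2 = Lam A3 M3" "par_obj M M3" by (auto elim: par_LamE)
    moreover from par_beta(2)[OF this(2)] obtain M4 where "par_obj M' M4" "par_obj M3 M4" by blast
    moreover from par_beta(4) 1 obtain N4 where "par_obj N' N4" "par_obj N2 N4" by blast
    ultimately show ?thesis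
      unfolding 1(1) by (meson par_ty_par_obj.par_beta par_subst_obj par_inst)
  next
    case (2 M1 M2 N2 A)
    then obtain M4 where "par_obj M' M4" "par_obj M2 M4" using par_beta(2) by blast
    moreover from par_beta(4) 2 obtain N4 where "par_obj N' N4" "par_obj N2 N4" by blast
    ultimately show ?thesis
      unfolding 2(2) by (meson par_subst_obj par_inst)
  qed
qed

lemma rtranclp_par_ty: "par_ty\<^sup>*\<^sup>* = beta_ty\<^sup>*\<^sup>*"
  by (rule rtranclp_subset) (auto intro: beta_imp_par_ty par_imp_betas_ty)

lemma confluent_beta_ty:
  assumes "beta_ty\<^sup>*\<^sup>* A B" "beta_ty\<^sup>*\<^sup>* A C"
  shows "\<exists>D. beta_ty\<^sup>*\<^sup>* B D \<and> beta_ty\<^sup>*\<^sup>* C D"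
proof -
  have "strong_confluentp par_ty"
    by (rule strong_confluentpI) (meson par_diamond_ty r_into_rtranclp sup2I1)
  then have "confluentp par_ty" by (rule strong_confluentp_imp_confluentp)
  then show ?thesis using assms unfolding rtranclp_par_ty[symmetric]
    by (meson confluentpD)
qed

section \<open>Normal forms of types and kinds\<close>

lemma betas_normal: "(\<nexists>y. r x y) \<Longrightarrow> r\<^sup>*\<^sup>* x z \<Longrightarrow> z = x"
  by (metis converse_rtranclpE)

lemma nf_ty_unique: "nf_ty A B \<Longrightarrow> nf_ty A C \<Longrightarrow> B = C"
  unfolding nf_ty_def using confluent_beta_ty[of A B C] betas_normal[of beta_ty] by metis

lemma nf_ty_expand: "beta_ty\<^sup>*\<^sup>* A B \<Longrightarrow> nf_ty B C \<Longrightarrow> nf_ty A C"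
  unfolding nf_ty_def by (meson rtranclp_trans)

lemma nf_ty_reduce: "beta_ty\<^sup>*\<^sup>* A B \<Longrightarrow> nf_ty A C \<Longrightarrow> nf_ty B C"
  unfolding nf_ty_def using confluent_beta_ty[of A B C] betas_normal[of beta_ty] by metis

lemma nf_ty_betas: "beta_ty\<^sup>*\<^sup>* A B \<Longrightarrow> nf_ty A C \<longleftrightarrow> nf_ty B C"
  using nf_ty_expand nf_ty_reduce by blast

lemma nf_ty_imp_betas: "nf_ty A B \<Longrightarrow> beta_ty\<^sup>*\<^sup>* A B"
  by (simp add: nf_ty_def)

lemma beta_subst_kind: "beta_kind K K' \<Longrightarrow> beta_kind (subst_kind \<sigma> K) (subst_kind \<sigma> K')"
  by (induct arbitrary: \<sigma> rule: beta_kind.induct) (auto intro: beta_kind.intros beta_subst_ty)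

lemma betas_subst_kind:
  "beta_kind\<^sup>*\<^sup>* K K' \<Longrightarrow> beta_kind\<^sup>*\<^sup>* (subst_kind \<sigma> K) (subst_kind \<sigma> K')"
  by (rule rtranclp_map[of beta_kind]) (auto intro: beta_subst_kind)

lemma nf_ty_idem: "nf_ty A B \<Longrightarrow> nf_ty B B"
  by (simp add: nf_ty_def)

text \<open>Normalizing before the substitution changes nothing, since one instance reduces to the
  other. This reconciles the classifiers normalized by each rule with instances of the original
  types.\<close>

lemma nf_ty_subst: "nf_ty A B \<Longrightarrow> nf_ty (subst_ty \<sigma> A) C \<longleftrightarrow> nf_ty (subst_ty \<sigma> B) C"
  by (intro nf_ty_betas betas_subst_ty nf_ty_imp_betas)

lemma betas_ren_ty: "beta_ty\<^sup>*\<^sup>* A A' \<Longrightarrow> beta_ty\<^sup>*\<^sup>* (ren_ty \<rho> A) (ren_ty \<rho> A')"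
  by (simp add: ren_ty_eq_subst betas_subst_ty)

lemma nf_ty_ren: "nf_ty A B \<Longrightarrow> nf_ty (ren_ty \<rho> A) (ren_ty \<rho> B)"
  unfolding nf_ty_def using beta_ren_ty_D betas_ren_ty by blast

lemma nf_ty_renD: "nf_ty (ren_ty \<rho> A) C \<Longrightarrow> \<exists>B. C = ren_ty \<rho> B \<and> nf_ty A B"
  unfolding nf_ty_def using betas_ren_ty_D[of \<rho> A C]
  by (metis beta_subst_ty ren_ty_eq_subst)

lemma beta_Pi_iff:
  "beta_ty (Pi A B) C \<longleftrightarrow> (\<exists>A'. C = Pi A' B \<and> beta_ty A A') \<or> (\<exists>B'. C = Pi A B' \<and> beta_ty B B')"
  by (auto elim: beta_Pi intro: beta_ty_beta_obj.intros)

lemma betas_PiD: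
  "beta_ty\<^sup>*\<^sup>* (Pi A B) C \<Longrightarrow> \<exists>A' B'. C = Pi A' B' \<and> beta_ty\<^sup>*\<^sup>* A A' \<and> beta_ty\<^sup>*\<^sup>* B B'"
  by (induct rule: rtranclp_induct)
    (auto simp: beta_Pi_iff intro: rtranclp.rtrancl_into_rtrancl)

lemma nf_ty_Pi: "nf_ty (Pi A B) C \<longleftrightarrow> (\<exists>A' B'. C = Pi A' B' \<and> nf_ty A A' \<and> nf_ty B B')"
proof
  assume "nf_ty (Pi A B) C"
  then show "\<exists>A' B'. C = Pi A' B' \<and> nf_ty A A' \<and> nf_ty B B'"
    unfolding nf_ty_def using betas_PiD[of A B C] by (auto simp: beta_Pi_iff)
qed (auto simp: nf_ty_def beta_Pi_iff intro: betas_Pi)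

lemma beta_KPi_iff:
  "beta_kind (KPi A K) L \<longleftrightarrow>
    (\<exists>A'. L = KPi A' K \<and> beta_ty A A') \<or> (\<exists>K'. L = KPi A K' \<and> beta_kind K K')"
  by (auto elim: beta_KPi intro: beta_kind.intros)

lemma betas_KPiD:
  "beta_kind\<^sup>*\<^sup>* (KPi A K) L \<Longrightarrow>
    \<exists>A' K'. L = KPi A' K' \<and> beta_ty\<^sup>*\<^sup>* A A' \<and> beta_kind\<^sup>*\<^sup>* K K'"
  by (induct rule: rtranclp_induct)
    (auto simp: beta_KPi_iff intro: rtranclp.rtrancl_into_rtrancl)

lemma betas_KPi:
  "beta_ty\<^sup>*\<^sup>* A A' \<Longrightarrow> beta_kind\<^sup>*\<^sup>* K K' \<Longrightarrow> beta_kind\<^sup>*\<^sup>* (KPi A K) (KPi A' K')"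
  using rtranclp_map[of beta_ty beta_kind "\<lambda>A. KPi A K" A A']
    rtranclp_map[of beta_kind beta_kind "KPi A'" K K']
  by (meson beta_kind.intros rtranclp_trans)

lemma nf_kind_KPi:
  "nf_kind (KPi A K) L \<longleftrightarrow> (\<exists>A' K'. L = KPi A' K' \<and> nf_ty A A' \<and> nf_kind K K')"
proof
  assume "nf_kind (KPi A K) L"
  then show "\<exists>A' K'. L = KPi A' K' \<and> nf_ty A A' \<and> nf_kind K K'"
    unfolding nf_kind_def nf_ty_def using betas_KPiD[of A K L] by (auto simp: beta_KPi_iff)
qed (auto simp: nf_ty_def nf_kind_def beta_KPi_iff intro: betas_KPi)

lemma nf_kind_Type: "nf_kind Type L \<longleftrightarrow> L = Type"
  unfolding nf_kind_def by (auto elim: beta_KType converse_rtranclpE)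

text \<open>Kinds reduce only inside the types they contain, so uniqueness is inherited
  componentwise from types.\<close>

lemma nf_kind_unique: "nf_kind K L \<Longrightarrow> nf_kind K L' \<Longrightarrow> L = L'"
  by (induct K arbitrary: L L') (auto simp: nf_kind_Type nf_kind_KPi dest: nf_ty_unique)

lemma nf_kind_idem: "nf_kind K L \<Longrightarrow> nf_kind L L"
  by (simp add: nf_kind_def)

lemma nf_kind_subst:
  "nf_kind K K' \<Longrightarrow> nf_kind (subst_kind \<sigma> K) L \<longleftrightarrow> nf_kind (subst_kind \<sigma> K') L"
proof (induct K arbitrary: K' \<sigma> L)
  case (KPi A K)
  then obtain A' K1 where *: "K' = KPi A' K1" "nf_ty A A'" "nf_kind K K1"
    by (auto simp: nf_kind_KPi)
  show ?case using KPi(1)[OF *(3)] nf_ty_subst[OF *(2)] by (simp add: *(1) nf_kind_KPi)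
qed (simp add: nf_kind_Type)

lemma nf_kind_ren: "nf_kind K L \<Longrightarrow> nf_kind (ren_kind \<rho> K) (ren_kind \<rho> L)"
proof (induct K arbitrary: L \<rho>)
  case (KPi A K)
  then obtain A' K1 where *: "L = KPi A' K1" "nf_ty A A'" "nf_kind K K1"
    by (auto simp: nf_kind_KPi)
  show ?case using KPi(1)[OF *(3)] nf_ty_ren[OF *(2)]
    by (auto simp only: *(1) ren_kind_KPi nf_kind_KPi)
qed (simp add: nf_kind_Type)

lemma nf_kind_renD: "nf_kind (ren_kind \<rho> K) L' \<Longrightarrow> \<exists>L. L' = ren_kind \<rho> L \<and> nf_kind K L"
proof (induct K arbitrary: L' \<rho>)
  case (KPi A K)
  then obtain A' K1 where *: "L' = KPi A' K1" "nf_ty (ren_ty \<rho> A) A'"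
    "nf_kind (ren_kind (up_ren \<rho>) K) K1"
    by (auto simp only: ren_kind_KPi nf_kind_KPi)
  obtain L where "K1 = ren_kind (up_ren \<rho>) L" "nf_kind K L" using KPi(1)[OF *(3)] by blast
  moreover obtain B where "A' = ren_ty \<rho> B" "nf_ty A B" using nf_ty_renD[OF *(2)] by blast
  ultimately show ?case by (metis *(1) ren_kind_KPi nf_kind_KPi)
qed (auto simp: nf_kind_Type)

lemma betas_par_subst:
  assumes "\<forall>x. par_obj (\<sigma> x) (\<tau> x)"
  shows "beta_ty\<^sup>*\<^sup>* (subst_ty \<sigma> A) (subst_ty \<tau> A)"
  using assms by (intro par_imp_betas_ty par_subst_ty par_refl_ty)

text \<open>A reduction in an argument changes the dependent classifier only by parallel steps at
  the occurrences of the variable, so its normal form stays the same. The statement ranges over all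
  pointwise parallel substitutions, because the one-variable form does not pass under
  binders.\<close>

lemma nf_kind_par_subst:
  "\<forall>x. par_obj (\<sigma> x) (\<tau> x) \<Longrightarrow> nf_kind (subst_kind \<sigma> K) L \<longleftrightarrow> nf_kind (subst_kind \<tau> K) L"
proof (induct K arbitrary: \<sigma> \<tau> L)
  case (KPi A K)
  show ?case
    using KPi(1)[OF par_up[OF KPi(2)]] nf_ty_betas[OF betas_par_subst[OF KPi(2)], of A]
    by (simp add: nf_kind_KPi)
qed (simp add: nf_kind_Type)

lemma nf_ty_inst_beta:
  "beta_obj M N \<Longrightarrow> nf_ty (subst_ty (inst [M]) B) C \<longleftrightarrow> nf_ty (subst_ty (inst [N]) B) C"
  by (intro nf_ty_betas betas_par_subst par_inst beta_imp_par_obj)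

lemma nf_kind_inst_beta:
  "beta_obj M N \<Longrightarrow> nf_kind (subst_kind (inst [M]) K) L \<longleftrightarrow> nf_kind (subst_kind (inst [N]) K) L"
  by (intro nf_kind_par_subst par_inst beta_imp_par_obj)

section \<open>Normalization\<close>

datatype sty = Base | Fun sty sty

primrec erase :: "ty \<Rightarrow> sty" where
  "erase (TCon a) = Base"
| "erase (Pi A B) = Fun (erase A) (erase B)"
| "erase (TApp A M) = erase A"

lemma erase_subst [simp]: "erase (subst_ty \<sigma> A) = erase A"
  by (induct A arbitrary: \<sigma> rule: ty.induct[of _ "\<lambda>_. True"]) auto

lemma erase_ren [simp]: "erase (ren_ty \<rho> A) = erase A"
  by (simp add: ren_ty_eq_subst)

lemma erase_beta: "beta_ty A B \<Longrightarrow> erase A = erase B"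
  and "beta_obj M N \<Longrightarrow> True"
  by (induct rule: beta_ty_beta_obj.inducts) auto

lemma erase_betas: "beta_ty\<^sup>*\<^sup>* A B \<Longrightarrow> erase A = erase B"
  by (induct rule: rtranclp_induct) (auto dest: erase_beta)

lemma erase_nf: "nf_ty A B \<Longrightarrow> erase B = erase A"
  by (auto simp: nf_ty_def dest: erase_betas)

text \<open>Simple typing also covers annotations and the arguments inside types, since these are
  normalized with the term. Kinds are not tracked: \<open>st_TApp\<close> accepts an argument of any
  simple type, as the head of a type application can never be an abstraction.\<close>

inductive st_ty :: "sig \<Rightarrow> sty list \<Rightarrow> ty \<Rightarrow> bool"
  and st_obj :: "sig \<Rightarrow> sty list \<Rightarrow> obj \<Rightarrow> sty \<Rightarrow> bool"
  for \<Sigma> :: sig where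
  st_TCon: "st_ty \<Sigma> \<Delta> (TCon a)"
| st_Pi: "st_ty \<Sigma> \<Delta> A \<Longrightarrow> st_ty \<Sigma> (erase A # \<Delta>) B \<Longrightarrow> st_ty \<Sigma> \<Delta> (Pi A B)"
| st_TApp: "st_ty \<Sigma> \<Delta> A \<Longrightarrow> st_obj \<Sigma> \<Delta> M \<tau> \<Longrightarrow> st_ty \<Sigma> \<Delta> (TApp A M)"
| st_Con: "ODecl c A \<in> set \<Sigma> \<Longrightarrow> st_obj \<Sigma> \<Delta> (Con c) (erase A)"
| st_Var: "x < length \<Delta> \<Longrightarrow> st_obj \<Sigma> \<Delta> (Var x) (\<Delta> ! x)"
| st_Lam: "st_ty \<Sigma> \<Delta> A \<Longrightarrow> st_obj \<Sigma> (erase A # \<Delta>) M \<tau> \<Longrightarrow>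
    st_obj \<Sigma> \<Delta> (Lam A M) (Fun (erase A) \<tau>)"
| st_App: "st_obj \<Sigma> \<Delta> M (Fun \<tau> \<tau>') \<Longrightarrow> st_obj \<Sigma> \<Delta> N \<tau> \<Longrightarrow> st_obj \<Sigma> \<Delta> (App M N) \<tau>'"

primrec st_kind :: "sig \<Rightarrow> sty list \<Rightarrow> kind \<Rightarrow> bool" where
  "st_kind \<Sigma> \<Delta> Type = True"
| "st_kind \<Sigma> \<Delta> (KPi A K) = (st_ty \<Sigma> \<Delta> A \<and> st_kind \<Sigma> (erase A # \<Delta>) K)"

inductive_cases st_PiE: "st_ty \<Sigma> \<Delta> (Pi A B)"
inductive_cases st_TAppE: "st_ty \<Sigma> \<Delta> (TApp A M)"
inductive_cases st_LamE: "st_obj \<Sigma> \<Delta> (Lam A M) \<tau>"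
inductive_cases st_AppE: "st_obj \<Sigma> \<Delta> (App M N) \<tau>"

section \<open>Reducibility and weak normalization\<close>

definition wn_ty :: "ty \<Rightarrow> bool" where
  "wn_ty A \<longleftrightarrow> (\<exists>B. nf_ty A B)"

definition wn_obj :: "obj \<Rightarrow> bool" where
  "wn_obj M \<longleftrightarrow> (\<exists>N. beta_obj\<^sup>*\<^sup>* M N \<and> (\<nexists>P. beta_obj N P))"

text \<open>Tait's reducibility predicate, on raw terms rather than typed ones, so that no contexts
  appear. Having \<open>wn_obj\<close> in the function case makes \<open>red_wn\<close> immediate;
  in return it must be supplied for abstractions.\<close>

primrec red :: "sty \<Rightarrow> obj \<Rightarrow> bool" where
  "red Base M = wn_obj M"
| "red (Fun \<tau> \<tau>') M = (wn_obj M \<and> (\<forall>N. red \<tau> N \<longrightarrow> red \<tau>' (App M N)))"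

lemma wn_expand: "beta_obj\<^sup>*\<^sup>* M N \<Longrightarrow> wn_obj N \<Longrightarrow> wn_obj M"
  unfolding wn_obj_def by (meson rtranclp_trans)

lemma red_wn: "red \<tau> M \<Longrightarrow> wn_obj M"
  by (cases \<tau>) auto

text \<open>For weak normalization, expansion along any reduction is harmless, even where a
  contraction discards its argument.\<close>

lemma red_expand: "beta_obj\<^sup>*\<^sup>* M N \<Longrightarrow> red \<tau> N \<Longrightarrow> red \<tau> M"
proof (induct \<tau> arbitrary: M N)
  case (Fun \<tau> \<tau>')
  have "red \<tau>' (App M P)" if "red \<tau> P" for P
    using Fun(2)[of "App M P" "App N P"] Fun(3,4) that by (auto intro: betas_App)
  then show ?case using Fun(3,4) by (auto intro: wn_expand)
qed (auto intro: wn_expand)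

inductive neutral :: "obj \<Rightarrow> bool" where
  neutral_Con: "neutral (Con c)"
| neutral_Var: "neutral (Var x)"
| neutral_App: "neutral M \<Longrightarrow> (\<nexists>P. beta_obj N P) \<Longrightarrow> neutral (App M N)"

lemma neutral_normal: "neutral M \<Longrightarrow> \<not> beta_obj M P"
proof (induct arbitrary: P rule: neutral.induct)
  case (neutral_App M N)
  then show ?case by (auto elim: beta_App neutral.cases)
qed (auto elim: beta_Con beta_Var)

text \<open>Letting \<open>M\<close> reduce to the neutral term, instead of being it, makes the
  function case work: a reducible argument is only known to reach a normal form, and the application
  becomes neutral after that reduction.\<close>

lemma neutral_red: "neutral N \<Longrightarrow> beta_obj\<^sup>*\<^sup>* M N \<Longrightarrow> red \<tau> M"
proof (induct \<tau> arbitrary: M N)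
  case Base
  then show ?case by (auto simp: wn_obj_def dest: neutral_normal)
next
  case (Fun \<tau> \<tau>')
  have "red \<tau>' (App M P)" if P: "red \<tau> P" for P
  proof -
    obtain Q where Q: "beta_obj\<^sup>*\<^sup>* P Q" "\<nexists>R. beta_obj Q R"
      using red_wn[OF P] by (auto simp: wn_obj_def)
    show ?thesis
      using Fun(2)[OF neutral_App[OF Fun(3) Q(2)] betas_App[OF Fun(4) Q(1)]] .
  qed
  then show ?case using Fun(3,4) by (auto simp: wn_obj_def dest: neutral_normal)
qed

lemma wn_obj_renD: "wn_obj (ren_obj \<rho> M) \<Longrightarrow> wn_obj M"
  unfolding wn_obj_def
  by (metis betas_ren_obj_D beta_subst_obj ren_obj_eq_subst)

lemma wn_ty_renD: "wn_ty (ren_ty \<rho> A) \<Longrightarrow> wn_ty A"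
  unfolding wn_ty_def using nf_ty_renD by blast

lemma wn_Pi: "wn_ty A \<Longrightarrow> wn_ty B \<Longrightarrow> wn_ty (Pi A B)"
  by (auto simp: wn_ty_def nf_ty_Pi)

lemma wn_Lam: "wn_ty A \<Longrightarrow> wn_obj M \<Longrightarrow> wn_obj (Lam A M)"
proof -
  assume "wn_ty A" "wn_obj M"
  then obtain A' M' where "beta_ty\<^sup>*\<^sup>* A A'" "\<nexists>B. beta_ty A' B"
    "beta_obj\<^sup>*\<^sup>* M M'" "\<nexists>N. beta_obj M' N"
    by (auto simp: wn_ty_def nf_ty_def wn_obj_def)
  then show ?thesis unfolding wn_obj_def
    by (intro exI[of _ "Lam A' M'"]) (auto intro: betas_Lam elim: beta_Lam)
qed

text \<open>Types are never abstractions, so an application of types is normal once its parts are.\<close>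

lemma wn_TApp: "wn_ty A \<Longrightarrow> wn_obj M \<Longrightarrow> wn_ty (TApp A M)"
proof -
  assume "wn_ty A" "wn_obj M"
  then obtain A' M' where "beta_ty\<^sup>*\<^sup>* A A'" "\<nexists>B. beta_ty A' B"
    "beta_obj\<^sup>*\<^sup>* M M'" "\<nexists>N. beta_obj M' N"
    by (auto simp: wn_ty_def nf_ty_def wn_obj_def)
  then show ?thesis unfolding wn_ty_def nf_ty_def
    by (intro exI[of _ "TApp A' M'"]) (auto intro: betas_TApp elim: beta_TApp)
qed

text \<open>
  Weak normalization of a body under \<open>up \<sigma>\<close> follows from that under \<open>case_nat (Var 0) \<sigma>\<close>,
  because the latter is a (non-injective) renaming of the former and renamings reflect reduction.
\<close>

lemma up_then_collapse: "ren_obj (case_nat 0 (\<lambda>x. x)) \<circ> up \<sigma> = case_nat (Var 0) \<sigma>"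
proof
  fix x
  have "case_nat 0 (\<lambda>x. x) \<circ> Suc = (\<lambda>x. x)" by auto
  then show "(ren_obj (case_nat 0 (\<lambda>x. x)) \<circ> up \<sigma>) x = case_nat (Var 0) \<sigma> x"
    by (cases x) (simp_all add: ren_ren_obj, simp add: ren_obj_eq_subst comp_def)
qed

lemma wn_obj_up: "wn_obj (subst_obj (case_nat (Var 0) \<sigma>) M) \<Longrightarrow> wn_obj (subst_obj (up \<sigma>) M)"
  by (rule wn_obj_renD[of "case_nat 0 (\<lambda>x. x)"]) (simp add: ren_subst_obj up_then_collapse)

lemma wn_ty_up: "wn_ty (subst_ty (case_nat (Var 0) \<sigma>) A) \<Longrightarrow> wn_ty (subst_ty (up \<sigma>) A)"
  by (rule wn_ty_renD[of "case_nat 0 (\<lambda>x. x)"]) (simp add: ren_subst_ty up_then_collapse)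

lemma red_case_nat:
  "\<forall>x<length \<Delta>. red (\<Delta> ! x) (\<sigma> x) \<Longrightarrow> red \<tau> N \<Longrightarrow>
    \<forall>x<length (\<tau> # \<Delta>). red ((\<tau> # \<Delta>) ! x) (case_nat N \<sigma> x)"
  by (auto simp: less_Suc_eq_0_disj)

lemma red_Var: "red \<tau> (Var x)"
  by (rule neutral_red[OF neutral_Var rtranclp.rtrancl_refl])

text \<open>The fundamental lemma of reducibility. Bodies are interpreted under
  \<open>case_nat (Var 0) \<sigma>\<close> and not under \<open>up \<sigma>\<close>: the latter
  shifts the values of \<sigma> and would call for closure of \<open>red\<close> under
  renaming.\<close>

lemma st_imp_wn_subst:
  "st_ty \<Sigma> \<Delta> A \<Longrightarrow> \<forall>x<length \<Delta>. red (\<Delta> ! x) (\<sigma> x) \<Longrightarrow> wn_ty (subst_ty \<sigma> A)"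
  and st_imp_red_subst:
  "st_obj \<Sigma> \<Delta> M \<tau> \<Longrightarrow> \<forall>x<length \<Delta>. red (\<Delta> ! x) (\<sigma> x) \<Longrightarrow> red \<tau> (subst_obj \<sigma> M)"
proof (induct arbitrary: \<sigma> and \<sigma> rule: st_ty_st_obj.inducts)
  case (st_TCon \<Delta> a)
  then show ?case by (auto simp: wn_ty_def nf_ty_def elim: beta_TCon)
next
  case (st_Pi \<Delta> A B)
  show ?case
    using st_Pi(2)[OF st_Pi(5)] st_Pi(4)[OF red_case_nat[OF st_Pi(5) red_Var]]
    by (auto intro: wn_Pi wn_ty_up)
next
  case (st_TApp \<Delta> A M \<tau>)
  then show ?case by (auto intro: wn_TApp red_wn)
next
  case (st_Con c A \<Delta>)
  then show ?case using neutral_red[OF neutral_Con rtranclp.rtrancl_refl] by simp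
next
  case (st_Var x \<Delta>)
  then show ?case by simp
next
  case (st_Lam \<Delta> A M \<tau>)
  have "wn_obj (subst_obj \<sigma> (Lam A M))"
    using st_Lam(2)[OF st_Lam(5)] st_Lam(4)[OF red_case_nat[OF st_Lam(5) red_Var]]
    by (auto intro: wn_Lam wn_obj_up red_wn)
  moreover have "red \<tau> (App (subst_obj \<sigma> (Lam A M)) N)" if N: "red (erase A) N" for N
  proof (rule red_expand)
    show "beta_obj\<^sup>*\<^sup>* (App (subst_obj \<sigma> (Lam A M)) N) (subst_obj (inst [N]) (subst_obj (up \<sigma>) M))"
      by (auto intro: beta_ty_beta_obj.intros(5))
    show "red \<tau> (subst_obj (inst [N]) (subst_obj (up \<sigma>) M))"
      using st_Lam(4)[OF red_case_nat[OF st_Lam(5) N]]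
      by (simp add: subst_subst_obj inst_comp_up)
  qed
  ultimately show ?case by simp
next
  case (st_App \<Delta> M \<tau> \<tau>' N)
  then show ?case by simp
qed

lemma st_nf_ty: "st_ty \<Sigma> \<Delta> A \<Longrightarrow> \<exists>B. nf_ty A B"
  using st_imp_wn_subst[of \<Sigma> \<Delta> A Var] by (simp add: red_Var wn_ty_def)

lemma st_nf_kind: "st_kind \<Sigma> \<Delta> K \<Longrightarrow> \<exists>L. nf_kind K L"
proof (induct K arbitrary: \<Delta>)
  case (KPi A K)
  then obtain L where "nf_kind K L" by auto
  moreover obtain B where "nf_ty A B" using KPi(2) st_nf_ty[of \<Sigma> \<Delta> A] by auto
  ultimately show ?case by (auto simp: nf_kind_KPi)
qed (use nf_kind_Type in blast)

section \<open>Structural properties of simple typing\<close>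

lemma st_ren_ty:
  "st_ty \<Sigma> \<Delta> A \<Longrightarrow> \<forall>x<length \<Delta>. \<rho> x < length \<Delta>' \<and> \<Delta>' ! \<rho> x = \<Delta> ! x \<Longrightarrow>
    st_ty \<Sigma> \<Delta>' (ren_ty \<rho> A)"
  and st_ren_obj:
  "st_obj \<Sigma> \<Delta> M \<tau> \<Longrightarrow> \<forall>x<length \<Delta>. \<rho> x < length \<Delta>' \<and> \<Delta>' ! \<rho> x = \<Delta> ! x \<Longrightarrow>
    st_obj \<Sigma> \<Delta>' (ren_obj \<rho> M) \<tau>"
proof (induct arbitrary: \<rho> \<Delta>' and \<rho> \<Delta>' rule: st_ty_st_obj.inducts)
  case (st_Pi \<Delta> A B)
  have "st_ty \<Sigma> (erase A # \<Delta>') (ren_ty (up_ren \<rho>) B)"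
    by (rule st_Pi(4)) (use st_Pi(5) in \<open>auto simp: less_Suc_eq_0_disj\<close>)
  with st_Pi show ?case by (auto intro: st_ty_st_obj.intros)
next
  case (st_Lam \<Delta> A M \<tau>)
  have "st_obj \<Sigma> (erase A # \<Delta>') (ren_obj (up_ren \<rho>) M) \<tau>"
    by (rule st_Lam(4)) (use st_Lam(5) in \<open>auto simp: less_Suc_eq_0_disj\<close>)
  then show ?case
    using st_ty_st_obj.st_Lam[OF st_Lam(2)[OF st_Lam(5)], of "ren_obj (up_ren \<rho>) M" \<tau>] by simp
next
  case (st_Var x \<Delta>)
  then show ?case using st_ty_st_obj.st_Var[of "\<rho> x" \<Delta>' \<Sigma>] by simp
next
  case (st_TApp \<Delta> A M \<tau>)
  show ?case using st_ty_st_obj.st_TApp[OF st_TApp(2,4)[OF st_TApp(5)]] by simp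
next
  case (st_App \<Delta> M \<tau> \<tau>' N)
  show ?case using st_ty_st_obj.st_App[OF st_App(2,4)[OF st_App(5)]] by simp
qed (auto intro: st_ty_st_obj.intros)

lemma st_up:
  assumes "\<forall>x<length \<Delta>. st_obj \<Sigma> \<Delta>' (\<sigma> x) (\<Delta> ! x)"
  shows "\<forall>x<length (\<tau> # \<Delta>). st_obj \<Sigma> (\<tau> # \<Delta>') (up \<sigma> x) ((\<tau> # \<Delta>) ! x)"
proof (intro allI impI)
  fix x assume x: "x < length (\<tau> # \<Delta>)"
  show "st_obj \<Sigma> (\<tau> # \<Delta>') (up \<sigma> x) ((\<tau> # \<Delta>) ! x)"
  proof (cases x)
    case 0
    then show ?thesis using st_Var[of 0 "\<tau> # \<Delta>'" \<Sigma>] by simp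
  next
    case (Suc y)
    then show ?thesis using x assms by (auto intro: st_ren_obj)
  qed
qed

lemma st_subst_ty:
  "st_ty \<Sigma> \<Delta> A \<Longrightarrow> \<forall>x<length \<Delta>. st_obj \<Sigma> \<Delta>' (\<sigma> x) (\<Delta> ! x) \<Longrightarrow> st_ty \<Sigma> \<Delta>' (subst_ty \<sigma> A)"
  and st_subst_obj:
  "st_obj \<Sigma> \<Delta> M \<tau> \<Longrightarrow> \<forall>x<length \<Delta>. st_obj \<Sigma> \<Delta>' (\<sigma> x) (\<Delta> ! x) \<Longrightarrow>
    st_obj \<Sigma> \<Delta>' (subst_obj \<sigma> M) \<tau>"
proof (induct arbitrary: \<sigma> \<Delta>' and \<sigma> \<Delta>' rule: st_ty_st_obj.inducts)
  case (st_Pi \<Delta> A B)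
  then show ?case using st_up[OF st_Pi(5)] by (auto intro: st_ty_st_obj.intros)
next
  case (st_Lam \<Delta> A M \<tau>)
  show ?case
    using st_ty_st_obj.st_Lam[OF st_Lam(2)[OF st_Lam(5)], of "subst_obj (up \<sigma>) M" \<tau>]
      st_Lam(4)[OF st_up[OF st_Lam(5)]] by simp
next
  case (st_TApp \<Delta> A M \<tau>)
  show ?case using st_ty_st_obj.st_TApp[OF st_TApp(2,4)[OF st_TApp(5)]] by simp
next
  case (st_App \<Delta> M \<tau> \<tau>' N)
  show ?case using st_ty_st_obj.st_App[OF st_App(2,4)[OF st_App(5)]] by simp
qed (auto intro: st_ty_st_obj.intros)

lemma st_subst_kind:
  "st_kind \<Sigma> \<Delta> K \<Longrightarrow> \<forall>x<length \<Delta>. st_obj \<Sigma> \<Delta>' (\<sigma> x) (\<Delta> ! x) \<Longrightarrow> st_kind \<Sigma> \<Delta>' (subst_kind \<sigma> K)"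
proof (induct K arbitrary: \<Delta> \<Delta>' \<sigma>)
  case (KPi A K)
  then show ?case using st_up[OF KPi(3)] st_subst_ty by auto
qed simp

lemma st_inst:
  assumes "st_obj \<Sigma> \<Delta> N \<tau>"
  shows "\<forall>x<length (\<tau> # \<Delta>). st_obj \<Sigma> \<Delta> (inst [N] x) ((\<tau> # \<Delta>) ! x)"
  using assms by (auto simp: inst_single less_Suc_eq_0_disj intro: st_Var)

text \<open>Normalized classifiers have to be simply typed again when a derivation is erased.
  Reducing an annotation does not change its erasure, so the context of the body stays literally the
  same.\<close>

lemma st_beta_ty: "beta_ty A B \<Longrightarrow> st_ty \<Sigma> \<Delta> A \<Longrightarrow> st_ty \<Sigma> \<Delta> B"
  and st_beta_obj: "beta_obj M N \<Longrightarrow> st_obj \<Sigma> \<Delta> M \<tau> \<Longrightarrow> st_obj \<Sigma> \<Delta> N \<tau>"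
proof (induct arbitrary: \<Delta> and \<Delta> \<tau> rule: beta_ty_beta_obj.inducts)
  case (1 A A' B)
  then show ?case
    by (elim st_PiE) (metis erase_beta st_ty_st_obj.st_Pi)
next
  case (5 A M N)
  then show ?case by (auto elim!: st_AppE st_LamE intro: st_subst_obj[OF _ st_inst])
next
  case (6 A A' M)
  then show ?case
    by (elim st_LamE) (metis erase_beta st_ty_st_obj.st_Lam)
qed (auto elim!: st_PiE st_TAppE st_LamE st_AppE dest: erase_beta intro: st_ty_st_obj.intros)

lemma st_nf: "st_ty \<Sigma> \<Delta> A \<Longrightarrow> nf_ty A B \<Longrightarrow> st_ty \<Sigma> \<Delta> B"
proof -
  have "beta_ty\<^sup>*\<^sup>* A B \<Longrightarrow> st_ty \<Sigma> \<Delta> A \<Longrightarrow> st_ty \<Sigma> \<Delta> B"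
    by (induct rule: rtranclp_induct) (auto intro: st_beta_ty)
  then show "st_ty \<Sigma> \<Delta> A \<Longrightarrow> nf_ty A B \<Longrightarrow> st_ty \<Sigma> \<Delta> B" by (simp add: nf_ty_def)
qed

lemma st_kind_nf: "st_kind \<Sigma> \<Delta> K \<Longrightarrow> nf_kind K L \<Longrightarrow> st_kind \<Sigma> \<Delta> L"
  by (induct K arbitrary: \<Delta> L) (auto simp: nf_kind_Type nf_kind_KPi erase_nf intro: st_nf)

lemma up_cong:
  "\<forall>x<length \<Delta>. \<sigma> x = \<sigma>' x \<Longrightarrow> \<forall>x<length (\<tau> # \<Delta>). up \<sigma> x = up \<sigma>' x"
  by (auto simp: less_Suc_eq_0_disj)

text \<open>Simple typing bounds the free variables by the length of \<Delta>. For the empty list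
  this shows that declared types and kinds are closed, so that every instantiation leaves them
  alone.\<close>

lemma st_subst_cong_ty:
  "st_ty \<Sigma> \<Delta> A \<Longrightarrow> \<forall>x<length \<Delta>. \<sigma> x = \<sigma>' x \<Longrightarrow> subst_ty \<sigma> A = subst_ty \<sigma>' A"
  and st_subst_cong_obj:
  "st_obj \<Sigma> \<Delta> M \<tau> \<Longrightarrow> \<forall>x<length \<Delta>. \<sigma> x = \<sigma>' x \<Longrightarrow> subst_obj \<sigma> M = subst_obj \<sigma>' M"
proof (induct arbitrary: \<sigma> \<sigma>' and \<sigma> \<sigma>' rule: st_ty_st_obj.inducts)
  case (st_Pi \<Delta> A B)
  then show ?case using up_cong[OF st_Pi(5)] by simp
next
  case (st_Lam \<Delta> A M \<tau>)
  then show ?case using up_cong[OF st_Lam(5)] by simp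
qed auto

lemma st_subst_cong_kind:
  "st_kind \<Sigma> \<Delta> K \<Longrightarrow> \<forall>x<length \<Delta>. \<sigma> x = \<sigma>' x \<Longrightarrow> subst_kind \<sigma> K = subst_kind \<sigma>' K"
proof (induct K arbitrary: \<Delta> \<sigma> \<sigma>')
  case (KPi A K)
  then show ?case using up_cong[OF KPi(3)] st_subst_cong_ty by auto
qed simp

lemma st_closed_ty: "st_ty \<Sigma> [] A \<Longrightarrow> subst_ty \<sigma> A = A"
  using st_subst_cong_ty[of \<Sigma> "[]" A \<sigma> Var] by simp

lemma st_closed_kind: "st_kind \<Sigma> [] K \<Longrightarrow> subst_kind \<sigma> K = K"
  using st_subst_cong_kind[of \<Sigma> "[]" K \<sigma> Var] by simp

lemma st_weaken_ty: "st_ty \<Sigma> [] A \<Longrightarrow> st_ty \<Sigma> \<Delta> A"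
  using st_subst_ty[of \<Sigma> "[]" A \<Delta> Var] by simp

lemma st_weaken_kind: "st_kind \<Sigma> [] K \<Longrightarrow> st_kind \<Sigma> \<Delta> K"
  using st_subst_kind[of \<Sigma> "[]" K \<Delta> Var] by simp

lemma st_mono_ty: "st_ty \<Sigma> \<Delta> A \<Longrightarrow> set \<Sigma> \<subseteq> set \<Sigma>' \<Longrightarrow> st_ty \<Sigma>' \<Delta> A"
  and st_mono_obj: "st_obj \<Sigma> \<Delta> M \<tau> \<Longrightarrow> set \<Sigma> \<subseteq> set \<Sigma>' \<Longrightarrow> st_obj \<Sigma>' \<Delta> M \<tau>"
  by (induct rule: st_ty_st_obj.inducts) (auto intro: st_ty_st_obj.intros)

lemma st_mono_kind: "st_kind \<Sigma> \<Delta> K \<Longrightarrow> set \<Sigma> \<subseteq> set \<Sigma>' \<Longrightarrow> st_kind \<Sigma>' \<Delta> K"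
  by (induct K arbitrary: \<Delta>) (auto intro: st_mono_ty)

section \<open>Typing\<close>

lemma lookup_Cons_0 [simp]: "lookup (A # \<Gamma>) 0 = ren_ty Suc A"
  by (simp add: lookup_def)

lemma lookup_Cons_Suc [simp]: "lookup (A # \<Gamma>) (Suc x) = ren_ty Suc (lookup \<Gamma> x)"
  by (simp add: lookup_def ren_ren_ty comp_def)

lemma erase_lookup: "erase (lookup \<Gamma> x) = erase (\<Gamma> ! x)"
  by (simp add: lookup_def)

lemma st_ren_Suc: "st_ty \<Sigma> \<Delta> A \<Longrightarrow> st_ty \<Sigma> (\<tau> # \<Delta>) (ren_ty Suc A)"
  by (rule st_ren_ty) auto

text \<open>The hypothesis \<open>ok\<close> stands in for validity of the signature, because
  \<open>valid_sig_decl\<close> establishes it by induction on the signature and needs the erasure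
  over each prefix already. In the rule for \<open>App\<close> the classifier changes by
  substitution and normalization, which the erasure does not see.\<close>

lemma wf_ctx_st:
  assumes ok: "\<And>c A. ODecl c A \<in> set \<Sigma> \<Longrightarrow> st_ty \<Sigma> [] A" "\<And>a K. TDecl a K \<in> set \<Sigma> \<Longrightarrow> st_kind \<Sigma> [] K"
  shows "wf_ctx \<Sigma> \<Gamma> \<Longrightarrow> \<forall>x<length \<Gamma>. st_ty \<Sigma> (map erase \<Gamma>) (lookup \<Gamma> x)"
  and wf_kind_st: "wf_kind \<Sigma> \<Gamma> K \<Longrightarrow> st_kind \<Sigma> (map erase \<Gamma>) K"
  and has_kind_st:
  "has_kind \<Sigma> \<Gamma> A K \<Longrightarrow> st_ty \<Sigma> (map erase \<Gamma>) A \<and> st_kind \<Sigma> (map erase \<Gamma>) K"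
  and has_type_st:
  "has_type \<Sigma> \<Gamma> M A \<Longrightarrow> st_obj \<Sigma> (map erase \<Gamma>) M (erase A) \<and> st_ty \<Sigma> (map erase \<Gamma>) A"
proof (induct rule: wf_ctx_wf_kind_has_kind_has_type.inducts)
  case ctx_nil
  then show ?case by simp
next
  case (ctx_cons \<Gamma> A)
  show ?case
  proof (intro allI impI)
    fix x assume "x < length (A # \<Gamma>)"
    with ctx_cons show "st_ty \<Sigma> (map erase (A # \<Gamma>)) (lookup (A # \<Gamma>) x)"
      by (cases x) (simp_all add: st_ren_Suc)
  qed
next
  case (kind_type \<Gamma>)
  then show ?case by simp
next
  case (kind_pi \<Gamma> A K)
  then show ?case by simp
next
  case (ty_con \<Gamma> a K K')
  then show ?case
    using st_kind_nf[OF st_weaken_kind[OF ok(2)]] by (auto intro: st_TCon)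
next
  case (ty_pi \<Gamma> A B)
  then show ?case by (auto intro: st_Pi)
next
  case (ty_app \<Gamma> A B K M K')
  then have "st_kind \<Sigma> (map erase \<Gamma>) (subst_kind (inst [M]) K)"
    by (auto intro: st_subst_kind[OF _ st_inst])
  with ty_app show ?case by (auto intro: st_TApp st_kind_nf)
next
  case (obj_con \<Gamma> c A A')
  then show ?case
    using st_nf[OF st_weaken_ty[OF ok(1)]] by (auto simp: erase_nf intro: st_Con)
next
  case (obj_var \<Gamma> x A')
  then show ?case using st_Var[of x "map erase \<Gamma>" \<Sigma>]
    by (auto simp: erase_nf erase_lookup intro: st_nf)
next
  case (obj_lam \<Gamma> A M B A')
  then show ?case by (auto simp: erase_nf intro!: st_Lam[of \<Sigma> _ A, simplified] st_Pi intro: st_nf)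
next
  case (obj_app \<Gamma> M A B N B')
  then have "st_ty \<Sigma> (map erase \<Gamma>) (subst_ty (inst [N]) B)"
    by (auto elim!: st_PiE intro: st_subst_ty[OF _ st_inst])
  with obj_app show ?case by (auto simp: erase_nf intro: st_App st_nf)
qed

lemma wf_ctx_mono: "wf_ctx \<Sigma> \<Gamma> \<Longrightarrow> set \<Sigma> \<subseteq> set \<Sigma>' \<Longrightarrow> wf_ctx \<Sigma>' \<Gamma>"
  and wf_kind_mono: "wf_kind \<Sigma> \<Gamma> K \<Longrightarrow> set \<Sigma> \<subseteq> set \<Sigma>' \<Longrightarrow> wf_kind \<Sigma>' \<Gamma> K"
  and has_kind_mono: "has_kind \<Sigma> \<Gamma> A K \<Longrightarrow> set \<Sigma> \<subseteq> set \<Sigma>' \<Longrightarrow> has_kind \<Sigma>' \<Gamma> A K"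
  and has_type_mono: "has_type \<Sigma> \<Gamma> M A \<Longrightarrow> set \<Sigma> \<subseteq> set \<Sigma>' \<Longrightarrow> has_type \<Sigma>' \<Gamma> M A"
  by (induct rule: wf_ctx_wf_kind_has_kind_has_type.inducts)
    (blast intro: wf_ctx_wf_kind_has_kind_has_type.intros)+

text \<open>A declaration is checked over the earlier ones only; both facts are obtained there and
  carried to the whole signature by monotonicity.\<close>

lemma valid_sig_decl:
  assumes "valid_sig \<Sigma>"
  shows "ODecl c A \<in> set \<Sigma> \<Longrightarrow> st_ty \<Sigma> [] A \<and> has_kind \<Sigma> [] A Type"
    and "TDecl a K \<in> set \<Sigma> \<Longrightarrow> st_kind \<Sigma> [] K \<and> wf_kind \<Sigma> [] K"
proof -
  have "(\<forall>c A. ODecl c A \<in> set \<Sigma> \<longrightarrow> st_ty \<Sigma> [] A \<and> has_kind \<Sigma> [] A Type) \<and>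
    (\<forall>a K. TDecl a K \<in> set \<Sigma> \<longrightarrow> st_kind \<Sigma> [] K \<and> wf_kind \<Sigma> [] K)"
    using assms
  proof induct
    case (2 \<Sigma> K a)
    then have "st_kind \<Sigma> [] K" using wf_kind_st[of \<Sigma> "[]" K] by auto
    moreover have "set \<Sigma> \<subseteq> set (TDecl a K # \<Sigma>)" by auto
    note st_mono_ty[OF _ this] st_mono_kind[OF _ this] has_kind_mono[OF _ this] wf_kind_mono[OF _ this]
    ultimately show ?case using 2 by auto
  next
    case (3 \<Sigma> A c)
    then have "st_ty \<Sigma> [] A" using has_kind_st[of \<Sigma> "[]" A Type] by auto
    moreover have "set \<Sigma> \<subseteq> set (ODecl c A # \<Sigma>)" by auto
    note st_mono_ty[OF _ this] st_mono_kind[OF _ this] has_kind_mono[OF _ this] wf_kind_mono[OF _ this]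
    ultimately show ?case using 3 by auto
  qed auto
  then show "ODecl c A \<in> set \<Sigma> \<Longrightarrow> st_ty \<Sigma> [] A \<and> has_kind \<Sigma> [] A Type"
    and "TDecl a K \<in> set \<Sigma> \<Longrightarrow> st_kind \<Sigma> [] K \<and> wf_kind \<Sigma> [] K" by auto
qed

section \<open>Inversion, normality and uniqueness of classifiers\<close>

inductive_cases has_kind_TCon: "has_kind \<Sigma> \<Gamma> (TCon a) K"
inductive_cases has_kind_Pi: "has_kind \<Sigma> \<Gamma> (Pi A B) K"
inductive_cases has_kind_TApp: "has_kind \<Sigma> \<Gamma> (TApp A M) K"
inductive_cases has_type_Con: "has_type \<Sigma> \<Gamma> (Con c) A"
inductive_cases has_type_Var: "has_type \<Sigma> \<Gamma> (Var x) A"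
inductive_cases has_type_Lam: "has_type \<Sigma> \<Gamma> (Lam A M) B"
inductive_cases has_type_App: "has_type \<Sigma> \<Gamma> (App M N) B"
inductive_cases wf_ctx_Cons: "wf_ctx \<Sigma> (A # \<Gamma>)"
inductive_cases wf_kind_KPi: "wf_kind \<Sigma> \<Gamma> (KPi A K)"

lemma "wf_ctx \<Sigma> \<Gamma> \<Longrightarrow> True"
  and wf_kind_imp_wf_ctx: "wf_kind \<Sigma> \<Gamma> K \<Longrightarrow> wf_ctx \<Sigma> \<Gamma>"
  and has_kind_imp_wf_ctx: "has_kind \<Sigma> \<Gamma> A L \<Longrightarrow> wf_ctx \<Sigma> \<Gamma>"
  and has_type_imp_wf_ctx: "has_type \<Sigma> \<Gamma> M B \<Longrightarrow> wf_ctx \<Sigma> \<Gamma>"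
  by (induct rule: wf_ctx_wf_kind_has_kind_has_type.inducts) auto

lemma wf_ctx_appendD: "wf_ctx \<Sigma> (\<Delta> @ \<Gamma>) \<Longrightarrow> wf_ctx \<Sigma> \<Gamma>"
  by (induct \<Delta>) (auto elim: wf_ctx_Cons)

lemma wf_ctx_entry: "wf_ctx \<Sigma> (\<Delta> @ A # \<Gamma>) \<Longrightarrow> has_kind \<Sigma> \<Gamma> A Type"
  by (auto dest: wf_ctx_appendD elim: wf_ctx_Cons)

lemma "wf_ctx \<Sigma> \<Gamma> \<Longrightarrow> True" "wf_kind \<Sigma> \<Gamma> K \<Longrightarrow> True"
  and has_kind_normal: "has_kind \<Sigma> \<Gamma> A L \<Longrightarrow> nf_kind L L"
  and has_type_normal: "has_type \<Sigma> \<Gamma> M B \<Longrightarrow> nf_ty B B"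
  by (induct rule: wf_ctx_wf_kind_has_kind_has_type.inducts)
    (auto simp: nf_kind_Type nf_ty_Pi intro: nf_kind_idem nf_ty_idem)

definition has_kind_nf :: "sig \<Rightarrow> ctx \<Rightarrow> ty \<Rightarrow> kind \<Rightarrow> bool" where
  "has_kind_nf \<Sigma> \<Gamma> A K \<longleftrightarrow> (\<exists>K'. nf_kind K K' \<and> has_kind \<Sigma> \<Gamma> A K')"

lemma has_kind_nf_Type: "has_kind_nf \<Sigma> \<Gamma> A Type \<longleftrightarrow> has_kind \<Sigma> \<Gamma> A Type"
  by (simp add: has_kind_nf_def nf_kind_Type)

locale valid_signature =
  fixes \<Sigma> :: sig
  assumes valid: "valid_sig \<Sigma>"
begin

lemma ODecl_st: "ODecl c A \<in> set \<Sigma> \<Longrightarrow> st_ty \<Sigma> [] A"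
  and ODecl_kind: "ODecl c A \<in> set \<Sigma> \<Longrightarrow> has_kind \<Sigma> [] A Type"
  and TDecl_st: "TDecl a K \<in> set \<Sigma> \<Longrightarrow> st_kind \<Sigma> [] K"
  and TDecl_kind: "TDecl a K \<in> set \<Sigma> \<Longrightarrow> wf_kind \<Sigma> [] K"
  using valid_sig_decl[OF valid] by auto

lemma valid_sig_TDecl_unique:
  "valid_sig S \<Longrightarrow> TDecl a K \<in> set S \<Longrightarrow> TDecl a L \<in> set S \<Longrightarrow> K = L"
  by (induct rule: valid_sig.induct) auto

lemma valid_sig_ODecl_unique:
  "valid_sig S \<Longrightarrow> ODecl c A \<in> set S \<Longrightarrow> ODecl c B \<in> set S \<Longrightarrow> A = B"
  by (induct rule: valid_sig.induct) auto

lemma TDecl_unique: "TDecl a K \<in> set \<Sigma> \<Longrightarrow> TDecl a L \<in> set \<Sigma> \<Longrightarrow> K = L"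
  using valid_sig_TDecl_unique[OF valid] .

lemma ODecl_unique: "ODecl c A \<in> set \<Sigma> \<Longrightarrow> ODecl c B \<in> set \<Sigma> \<Longrightarrow> A = B"
  using valid_sig_ODecl_unique[OF valid] .

lemma ODecl_nf_closed: "ODecl c A \<in> set \<Sigma> \<Longrightarrow> nf_ty A A' \<Longrightarrow> subst_ty \<sigma> A' = A'"
  by (meson ODecl_st st_closed_ty st_nf)

lemma TDecl_nf_closed: "TDecl a K \<in> set \<Sigma> \<Longrightarrow> nf_kind K K' \<Longrightarrow> subst_kind \<sigma> K' = K'"
  by (meson TDecl_st st_closed_kind st_kind_nf)

text \<open>Every rule fixes its classifier as a normal form determined by the premises. Confluence
  thus gives equality and not just convertibility, which lets two derivations be compared by
  rewriting.\<close>

lemma has_type_unique: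
  "has_type \<Sigma> \<Gamma> M A \<Longrightarrow> has_type \<Sigma> \<Gamma> M B \<Longrightarrow> A = B"
proof (induct M arbitrary: \<Gamma> A B rule: obj.induct[of "\<lambda>_. True"])
  case (Con c)
  then show ?case by (auto elim!: has_type_Con dest: nf_ty_unique ODecl_unique)
next
  case (Var x)
  then show ?case by (auto elim!: has_type_Var dest: nf_ty_unique)
next
  case (Lam C M)
  obtain C1 B1 where "A = Pi C1 B1" "nf_ty C C1" "has_type \<Sigma> (C # \<Gamma>) M B1"
    using Lam(3) by (elim has_type_Lam) blast
  moreover obtain C2 B2 where "B = Pi C2 B2" "nf_ty C C2" "has_type \<Sigma> (C # \<Gamma>) M B2"
    using Lam(4) by (elim has_type_Lam) blast
  ultimately show ?case using Lam(2) nf_ty_unique by blast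
next
  case (App M N)
  obtain C1 B1 where "has_type \<Sigma> \<Gamma> M (Pi C1 B1)" "nf_ty (subst_ty (inst [N]) B1) A"
    using App(3) by (elim has_type_App) blast
  moreover obtain C2 B2 where "has_type \<Sigma> \<Gamma> M (Pi C2 B2)" "nf_ty (subst_ty (inst [N]) B2) B"
    using App(4) by (elim has_type_App) blast
  ultimately show ?case using App(1) nf_ty_unique by blast
qed auto

lemma has_kind_unique:
  "has_kind \<Sigma> \<Gamma> A K \<Longrightarrow> has_kind \<Sigma> \<Gamma> A L \<Longrightarrow> K = L"
proof (induct A arbitrary: \<Gamma> K L rule: ty.induct[of _ "\<lambda>_. True"])
  case (TCon a)
  then show ?case by (auto elim!: has_kind_TCon dest: nf_kind_unique TDecl_unique)
next
  case (Pi A B)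
  from Pi(3,4) show ?case by (auto elim!: has_kind_Pi)
next
  case (TApp A M)
  obtain B1 K1 where "has_kind \<Sigma> \<Gamma> A (KPi B1 K1)" "nf_kind (subst_kind (inst [M]) K1) K"
    using TApp(3) by (elim has_kind_TApp) blast
  moreover obtain B2 K2 where "has_kind \<Sigma> \<Gamma> A (KPi B2 K2)" "nf_kind (subst_kind (inst [M]) K2) L"
    using TApp(4) by (elim has_kind_TApp) blast
  ultimately show ?case using TApp(1) nf_kind_unique by blast
qed auto

subsection \<open>Renaming\<close>

text \<open>Entries are compared through their normal forms, never literally. Exchanging an entry
  for a convertible one thereby becomes an instance, with the identity as renaming.\<close>

definition ren_ok :: "(nat \<Rightarrow> nat) \<Rightarrow> ctx \<Rightarrow> ctx \<Rightarrow> bool" where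
  "ren_ok \<rho> \<Gamma> \<Gamma>' \<longleftrightarrow> (\<forall>x<length \<Gamma>. \<rho> x < length \<Gamma>' \<and>
    (\<forall>A. nf_ty (lookup \<Gamma> x) A \<longrightarrow> nf_ty (lookup \<Gamma>' (\<rho> x)) (ren_ty \<rho> A)))"

lemma ren_ty_up_Suc: "ren_ty (up_ren \<rho>) (ren_ty Suc A) = ren_ty Suc (ren_ty \<rho> A)"
  by (simp add: ren_ren_ty up_ren_Suc)

lemma ren_ok_up: "ren_ok \<rho> \<Gamma> \<Gamma>' \<Longrightarrow> ren_ok (up_ren \<rho>) (A # \<Gamma>) (ren_ty \<rho> A # \<Gamma>')"
proof -
  assume ok: "ren_ok \<rho> \<Gamma> \<Gamma>'"
  have "nf_ty (lookup (ren_ty \<rho> A # \<Gamma>') (up_ren \<rho> x)) (ren_ty (up_ren \<rho>) B)"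
    if x: "x < length (A # \<Gamma>)" "nf_ty (lookup (A # \<Gamma>) x) B" for x B
  proof (cases x)
    case 0
    then obtain C where "B = ren_ty Suc C" "nf_ty A C" using x nf_ty_renD[of Suc A B] by auto
    then show ?thesis using 0 by (simp add: ren_ty_up_Suc nf_ty_ren)
  next
    case (Suc y)
    then obtain C where "B = ren_ty Suc C" "nf_ty (lookup \<Gamma> y) C"
      using x nf_ty_renD[of Suc "lookup \<Gamma> y" B] by auto
    then show ?thesis using Suc ok x by (simp add: ren_ok_def ren_ty_up_Suc nf_ty_ren)
  qed
  moreover have "up_ren \<rho> x < length (ren_ty \<rho> A # \<Gamma>')" if "x < length (A # \<Gamma>)" for x
    using ok that by (cases x) (auto simp: ren_ok_def)
  ultimately show ?thesis by (simp add: ren_ok_def)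
qed

text \<open>Renaming commutes with normalization: the normal forms demanded by the rules are the
  renamed ones. Constants are covered because their normalized declarations are closed.\<close>

lemma "wf_ctx \<Sigma> \<Gamma> \<Longrightarrow> wf_ctx \<Sigma> \<Gamma>' \<Longrightarrow> ren_ok \<rho> \<Gamma> \<Gamma>' \<Longrightarrow> True"
  and ren_wf_kind: "wf_kind \<Sigma> \<Gamma> K \<Longrightarrow> wf_ctx \<Sigma> \<Gamma>' \<Longrightarrow> ren_ok \<rho> \<Gamma> \<Gamma>' \<Longrightarrow>
    wf_kind \<Sigma> \<Gamma>' (ren_kind \<rho> K)"
  and ren_has_kind: "has_kind \<Sigma> \<Gamma> A L \<Longrightarrow> wf_ctx \<Sigma> \<Gamma>' \<Longrightarrow> ren_ok \<rho> \<Gamma> \<Gamma>' \<Longrightarrow>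
    has_kind \<Sigma> \<Gamma>' (ren_ty \<rho> A) (ren_kind \<rho> L)"
  and ren_has_type: "has_type \<Sigma> \<Gamma> M B \<Longrightarrow> wf_ctx \<Sigma> \<Gamma>' \<Longrightarrow> ren_ok \<rho> \<Gamma> \<Gamma>' \<Longrightarrow>
    has_type \<Sigma> \<Gamma>' (ren_obj \<rho> M) (ren_ty \<rho> B)"
proof (induct arbitrary: \<Gamma>' \<rho> and \<Gamma>' \<rho> and \<Gamma>' \<rho> and \<Gamma>' \<rho>
    rule: wf_ctx_wf_kind_has_kind_has_type.inducts)
  case (kind_type \<Gamma>)
  then show ?case by (simp add: wf_ctx_wf_kind_has_kind_has_type.kind_type)
next
  case (kind_pi \<Gamma> A K)
  have A: "has_kind \<Sigma> \<Gamma>' (ren_ty \<rho> A) Type" using kind_pi(2)[OF kind_pi(5,6)] by simp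
  have "wf_ctx \<Sigma> (ren_ty \<rho> A # \<Gamma>')" using kind_pi(5) A by (rule ctx_cons)
  from kind_pi(4)[OF this ren_ok_up[OF kind_pi(6)]] A show ?case
    unfolding ren_kind_KPi by (rule wf_ctx_wf_kind_has_kind_has_type.kind_pi[rotated])
next
  case (ty_con \<Gamma> a K K')
  then show ?case
    using TDecl_nf_closed wf_ctx_wf_kind_has_kind_has_type.ty_con by simp
next
  case (ty_pi \<Gamma> A B)
  have A: "has_kind \<Sigma> \<Gamma>' (ren_ty \<rho> A) Type" using ty_pi(2)[OF ty_pi(5,6)] by simp
  have "wf_ctx \<Sigma> (ren_ty \<rho> A # \<Gamma>')" using ty_pi(5) A by (rule ctx_cons)
  from ty_pi(4)[OF this ren_ok_up[OF ty_pi(6)]] A show ?case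
    by (simp add: wf_ctx_wf_kind_has_kind_has_type.ty_pi)
next
  case (ty_app \<Gamma> A B K M K')
  show ?case
    unfolding ren_ty.simps
    by (rule wf_ctx_wf_kind_has_kind_has_type.ty_app
        [OF ty_app(2)[OF ty_app(6,7), unfolded ren_kind_KPi] ty_app(4)[OF ty_app(6,7)]])
      (use nf_kind_ren[OF ty_app(5), of \<rho>] in \<open>simp only: ren_inst_kind\<close>)
next
  case (obj_con \<Gamma> c A A')
  then show ?case
    using ODecl_nf_closed wf_ctx_wf_kind_has_kind_has_type.obj_con by (simp add: ren_ty_eq_subst)
next
  case (obj_var \<Gamma> x A')
  then show ?case
    by (auto simp: ren_ok_def intro: wf_ctx_wf_kind_has_kind_has_type.obj_var)
next
  case (obj_lam \<Gamma> A M B A')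
  have A: "has_kind \<Sigma> \<Gamma>' (ren_ty \<rho> A) Type" using obj_lam(2)[OF obj_lam(6,7)] by simp
  have "wf_ctx \<Sigma> (ren_ty \<rho> A # \<Gamma>')" using obj_lam(6) A by (rule ctx_cons)
  from obj_lam(4)[OF this ren_ok_up[OF obj_lam(7)]] A nf_ty_ren[OF obj_lam(5)] show ?case
    by (simp add: wf_ctx_wf_kind_has_kind_has_type.obj_lam)
next
  case (obj_app \<Gamma> M A B N B')
  show ?case
    unfolding ren_obj.simps
    by (rule wf_ctx_wf_kind_has_kind_has_type.obj_app
        [OF obj_app(2)[OF obj_app(6,7), unfolded ren_ty.simps] obj_app(4)[OF obj_app(6,7)]])
      (use nf_ty_ren[OF obj_app(5), of \<rho>] in \<open>simp only: ren_inst_ty\<close>)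
qed auto

lemma ren_ok_Suc: "ren_ok Suc \<Gamma> (A # \<Gamma>)"
  by (auto simp: ren_ok_def intro: nf_ty_ren)

lemma lookup_append: "lookup (\<Delta> @ \<Gamma>) (x + length \<Delta>) = ren_ty (\<lambda>y. y + length \<Delta>) (lookup \<Gamma> x)"
  by (simp add: lookup_def ren_ren_ty comp_def nth_append algebra_simps)

lemma lookup_has_kind: "wf_ctx \<Sigma> \<Gamma> \<Longrightarrow> x < length \<Gamma> \<Longrightarrow> has_kind \<Sigma> \<Gamma> (lookup \<Gamma> x) Type"
proof (induct \<Gamma> arbitrary: x)
  case (Cons A \<Gamma>)
  then have "wf_ctx \<Sigma> \<Gamma>" "has_kind \<Sigma> \<Gamma> A Type" by (auto elim: wf_ctx_Cons)
  then have "has_kind \<Sigma> (A # \<Gamma>) (ren_ty Suc B) Type" if "has_kind \<Sigma> \<Gamma> B Type" for B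
    using ren_has_kind[OF that Cons(2) ren_ok_Suc] by simp
  with Cons \<open>has_kind \<Sigma> \<Gamma> A Type\<close> \<open>wf_ctx \<Sigma> \<Gamma>\<close> show ?case by (cases x) auto
qed simp

text \<open>
  The converse of renaming covers strengthening and exchange at once.  Injectivity is needed to
  compare the type of an argument with the domain of its function.
\<close>

definition unren_ok :: "(nat \<Rightarrow> nat) \<Rightarrow> ctx \<Rightarrow> ctx \<Rightarrow> bool" where
  "unren_ok \<rho> \<Psi> \<Gamma> \<longleftrightarrow> inj \<rho> \<and> (\<forall>x A. \<rho> x < length \<Gamma> \<longrightarrow> nf_ty (lookup \<Gamma> (\<rho> x)) A \<longrightarrow>
    x < length \<Psi> \<and> (\<exists>B. A = ren_ty \<rho> B \<and> nf_ty (lookup \<Psi> x) B))"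

lemma unren_ok_up: "unren_ok \<rho> \<Psi> \<Gamma> \<Longrightarrow> unren_ok (up_ren \<rho>) (A # \<Psi>) (ren_ty \<rho> A # \<Gamma>)"
proof -
  assume ok: "unren_ok \<rho> \<Psi> \<Gamma>"
  have "x < length (A # \<Psi>) \<and> (\<exists>D. C = ren_ty (up_ren \<rho>) D \<and> nf_ty (lookup (A # \<Psi>) x) D)"
    if x: "up_ren \<rho> x < length (ren_ty \<rho> A # \<Gamma>)" "nf_ty (lookup (ren_ty \<rho> A # \<Gamma>) (up_ren \<rho> x)) C" for x C
  proof (cases x)
    case 0
    then have "nf_ty (ren_ty (up_ren \<rho>) (ren_ty Suc A)) C" using x by (simp add: ren_ty_up_Suc)
    then show ?thesis using 0 nf_ty_renD by auto
  next
    case (Suc y)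
    then have "nf_ty (ren_ty Suc (lookup \<Gamma> (\<rho> y))) C" using x by simp
    then obtain E where E: "C = ren_ty Suc E" "nf_ty (lookup \<Gamma> (\<rho> y)) E" using nf_ty_renD by blast
    then obtain D where "E = ren_ty \<rho> D" "nf_ty (lookup \<Psi> y) D" "y < length \<Psi>"
      using ok x Suc by (auto simp: unren_ok_def)
    then show ?thesis using Suc E(1)
      by (auto simp: ren_ty_up_Suc intro!: exI[of _ "ren_ty Suc D"] nf_ty_ren)
  qed
  then show ?thesis using ok by (auto simp: unren_ok_def inj_up_ren)
qed

text \<open>That the classifier is a renamed one belongs to the conclusion, as the induction has to
  recover the domain of a function before it can treat the argument. Well-formedness of \<Psi> is a
  separate hypothesis, since \<Gamma> may order the entries differently and hold others in
  between.\<close>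

lemma "wf_ctx \<Sigma> \<Gamma> \<Longrightarrow> unren_ok \<rho> \<Psi> \<Gamma> \<Longrightarrow> True"
  "wf_kind \<Sigma> \<Gamma> K \<Longrightarrow> unren_ok \<rho> \<Psi> \<Gamma> \<Longrightarrow> True"
  and unren_has_kind: "has_kind \<Sigma> \<Gamma> A' K' \<Longrightarrow> unren_ok \<rho> \<Psi> \<Gamma> \<Longrightarrow> wf_ctx \<Sigma> \<Psi> \<Longrightarrow>
    A' = ren_ty \<rho> A \<Longrightarrow> \<exists>K. K' = ren_kind \<rho> K \<and> has_kind \<Sigma> \<Psi> A K"
  and unren_has_type: "has_type \<Sigma> \<Gamma> M' B' \<Longrightarrow> unren_ok \<rho> \<Psi> \<Gamma> \<Longrightarrow> wf_ctx \<Sigma> \<Psi> \<Longrightarrow>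
    M' = ren_obj \<rho> M \<Longrightarrow> \<exists>B. B' = ren_ty \<rho> B \<and> has_type \<Sigma> \<Psi> M B"
proof (induct arbitrary: \<Psi> \<rho> and \<Psi> \<rho> and \<Psi> \<rho> A and \<Psi> \<rho> M
    rule: wf_ctx_wf_kind_has_kind_has_type.inducts)
  case (ty_con \<Gamma> a K K')
  then have "A = TCon a" by (cases A) auto
  with ty_con show ?case
    using TDecl_nf_closed[of a K K'] wf_ctx_wf_kind_has_kind_has_type.ty_con by metis
next
  case (ty_pi \<Gamma> A1 B1)
  then obtain A2 B2 where eq: "A = Pi A2 B2" "A1 = ren_ty \<rho> A2" "B1 = ren_ty (up_ren \<rho>) B2"
    by (cases A) auto
  obtain L where "Type = ren_kind \<rho> L" "has_kind \<Sigma> \<Psi> A2 L" using ty_pi(2)[OF ty_pi(5,6) eq(2)] by blast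
  then have A2: "has_kind \<Sigma> \<Psi> A2 Type" by (cases L) auto
  then have "wf_ctx \<Sigma> (A2 # \<Psi>)" using ty_pi(6) by (simp add: ctx_cons)
  from ty_pi(4)[OF unren_ok_up[OF ty_pi(5), of A2, folded eq(2)] this eq(3)]
  obtain L where "Type = ren_kind (up_ren \<rho>) L" "has_kind \<Sigma> (A2 # \<Psi>) B2 L" by blast
  then have "has_kind \<Sigma> (A2 # \<Psi>) B2 Type" by (cases L) auto
  with A2 show ?case
    using wf_ctx_wf_kind_has_kind_has_type.ty_pi[of \<Sigma> \<Psi> A2 B2] by (intro exI[of _ Type]) (simp add: eq)
next
  case (ty_app \<Gamma> A1 B K M K')
  then obtain A2 M2 where eq: "A = TApp A2 M2" "A1 = ren_ty \<rho> A2" "M = ren_obj \<rho> M2"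
    by (cases A) auto
  obtain L where L: "KPi B K = ren_kind \<rho> L" "has_kind \<Sigma> \<Psi> A2 L"
    using ty_app(2)[OF ty_app(6,7) eq(2)] by blast
  then obtain B2 K2 where L': "L = KPi B2 K2" by (cases L) auto
  with L have BK: "B = ren_ty \<rho> B2" "K = ren_kind (up_ren \<rho>) K2" by (auto simp only: ren_kind_KPi kind.inject)
  obtain B3 where "B = ren_ty \<rho> B3" "has_type \<Sigma> \<Psi> M2 B3"
    using ty_app(4)[OF ty_app(6,7) eq(3)] by blast
  then have M2: "has_type \<Sigma> \<Psi> M2 B2"
    using BK(1) ren_ty_inject[of \<rho> B2 B3] ty_app(6) by (auto simp: unren_ok_def)
  have "nf_kind (ren_kind \<rho> (subst_kind (inst [M2]) K2)) K'"
    using ty_app(5) unfolding BK eq ren_inst_kind .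
  then obtain K3 where "K' = ren_kind \<rho> K3" "nf_kind (subst_kind (inst [M2]) K2) K3"
    using nf_kind_renD by blast
  then show ?case unfolding eq(1)
    using L(2)[unfolded L'] M2 wf_ctx_wf_kind_has_kind_has_type.ty_app by blast
next
  case (obj_con \<Gamma> c A A')
  then have "M = Con c" by (cases M) auto
  with obj_con show ?case
    using ODecl_nf_closed[of c A A'] wf_ctx_wf_kind_has_kind_has_type.obj_con ren_ty_eq_subst by metis
next
  case (obj_var \<Gamma> x A')
  then obtain y where "M = Var y" "x = \<rho> y" by (cases M) auto
  then obtain B where "A' = ren_ty \<rho> B" "nf_ty (lookup \<Psi> y) B" "y < length \<Psi>"
    using obj_var(3-5) unfolding unren_ok_def by blast
  then show ?case unfolding \<open>M = Var y\<close>
    using wf_ctx_wf_kind_has_kind_has_type.obj_var obj_var(6) by blast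
next
  case (obj_lam \<Gamma> A M1 B A')
  then obtain A2 M2 where eq: "M = Lam A2 M2" "A = ren_ty \<rho> A2" "M1 = ren_obj (up_ren \<rho>) M2"
    by (cases M) auto
  obtain L where "Type = ren_kind \<rho> L" "has_kind \<Sigma> \<Psi> A2 L"
    using obj_lam(2)[OF obj_lam(6,7) eq(2)] by blast
  then have A2: "has_kind \<Sigma> \<Psi> A2 Type" by (cases L) auto
  then have "wf_ctx \<Sigma> (A2 # \<Psi>)" using obj_lam(7) by (simp add: ctx_cons)
  from obj_lam(4)[OF unren_ok_up[OF obj_lam(6), of A2, folded eq(2)] this eq(3)]
  obtain B2 where B2: "B = ren_ty (up_ren \<rho>) B2" "has_type \<Sigma> (A2 # \<Psi>) M2 B2" by blast
  obtain A3 where A3: "A' = ren_ty \<rho> A3" "nf_ty A2 A3" 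
    using obj_lam(5) nf_ty_renD unfolding eq(2) by blast
  show ?case unfolding eq(1)
    using wf_ctx_wf_kind_has_kind_has_type.obj_lam[OF A2 B2(2) A3(2)]
    by (intro exI[of _ "Pi A3 B2"]) (simp add: A3 B2)
next
  case (obj_app \<Gamma> M1 A B N B')
  then obtain M2 N2 where eq: "M = App M2 N2" "M1 = ren_obj \<rho> M2" "N = ren_obj \<rho> N2"
    by (cases M) auto
  obtain L where L: "Pi A B = ren_ty \<rho> L" "has_type \<Sigma> \<Psi> M2 L"
    using obj_app(2)[OF obj_app(6,7) eq(2)] by blast
  then obtain A2 B2 where L': "L = Pi A2 B2" by (cases L) auto
  with L have BK: "A = ren_ty \<rho> A2" "B = ren_ty (up_ren \<rho>) B2" by auto
  obtain A3 where "A = ren_ty \<rho> A3" "has_type \<Sigma> \<Psi> N2 A3"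
    using obj_app(4)[OF obj_app(6,7) eq(3)] by blast
  then have N2: "has_type \<Sigma> \<Psi> N2 A2"
    using BK(1) ren_ty_inject[of \<rho> A2 A3] obj_app(6) by (auto simp: unren_ok_def)
  have "nf_ty (ren_ty \<rho> (subst_ty (inst [N2]) B2)) B'"
    using obj_app(5) unfolding BK eq ren_inst_ty .
  then obtain B3 where "B' = ren_ty \<rho> B3" "nf_ty (subst_ty (inst [N2]) B2) B3"
    using nf_ty_renD by blast
  then show ?case unfolding eq(1)
    using L(2)[unfolded L'] N2 wf_ctx_wf_kind_has_kind_has_type.obj_app by blast
qed auto

lemma unren_has_kind_Type:
  assumes "has_kind \<Sigma> \<Gamma> (ren_ty \<rho> A) Type" "unren_ok \<rho> \<Psi> \<Gamma>" "wf_ctx \<Sigma> \<Psi>"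
  shows "has_kind \<Sigma> \<Psi> A Type"
proof -
  obtain K where "Type = ren_kind \<rho> K" "has_kind \<Sigma> \<Psi> A K"
    using unren_has_kind[OF assms refl] by blast
  then show ?thesis by (cases K) auto
qed

lemma unren_ok_append: "unren_ok (\<lambda>y. y + length \<Delta>) \<Gamma> (\<Delta> @ \<Gamma>)"
  by (auto simp: unren_ok_def lookup_append inj_def dest: nf_ty_renD)

subsection \<open>Substitution and subject reduction\<close>

definition sub_ok :: "(nat \<Rightarrow> obj) \<Rightarrow> ctx \<Rightarrow> ctx \<Rightarrow> bool" where
  "sub_ok \<sigma> \<Gamma> \<Gamma>' \<longleftrightarrow> (\<forall>x<length \<Gamma>. has_type_nf \<Sigma> \<Gamma>' (\<sigma> x) (subst_ty \<sigma> (lookup \<Gamma> x)))"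

lemma has_kind_simple:
  "has_kind \<Sigma> \<Gamma> A K \<Longrightarrow> st_ty \<Sigma> (map erase \<Gamma>) A \<and> st_kind \<Sigma> (map erase \<Gamma>) K"
  using has_kind_st[of \<Sigma> \<Gamma> A K] ODecl_st TDecl_st by blast

lemma has_type_simple:
  "has_type \<Sigma> \<Gamma> M A \<Longrightarrow> st_obj \<Sigma> (map erase \<Gamma>) M (erase A) \<and> st_ty \<Sigma> (map erase \<Gamma>) A"
  using has_type_st[of \<Sigma> \<Gamma> M A] ODecl_st TDecl_st by blast

lemma sub_ok_simple:
  assumes "sub_ok \<sigma> \<Gamma> \<Gamma>'"
  shows "\<forall>x<length (map erase \<Gamma>). st_obj \<Sigma> (map erase \<Gamma>') (\<sigma> x) (map erase \<Gamma> ! x)"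
proof (intro allI impI)
  fix x assume x: "x < length (map erase \<Gamma>)"
  then obtain A where "nf_ty (subst_ty \<sigma> (lookup \<Gamma> x)) A" "has_type \<Sigma> \<Gamma>' (\<sigma> x) A"
    using assms by (auto simp: sub_ok_def has_type_nf_def)
  then show "st_obj \<Sigma> (map erase \<Gamma>') (\<sigma> x) (map erase \<Gamma> ! x)"
    using has_type_simple[of \<Gamma>' "\<sigma> x" A] x by (simp add: erase_nf erase_lookup)
qed

lemma nf_subst_type:
  "sub_ok \<sigma> \<Gamma> \<Gamma>' \<Longrightarrow> has_type \<Sigma> \<Gamma> M A \<Longrightarrow> \<exists>B. nf_ty (subst_ty \<sigma> A) B"
  using st_nf_ty[OF st_subst_ty[OF _ sub_ok_simple]] has_type_simple[of \<Gamma> M A]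
  by blast

lemma nf_subst_kind:
  "sub_ok \<sigma> \<Gamma> \<Gamma>' \<Longrightarrow> has_kind \<Sigma> \<Gamma> A K \<Longrightarrow> \<exists>L. nf_kind (subst_kind \<sigma> K) L"
  using st_nf_kind[OF st_subst_kind[OF _ sub_ok_simple]] has_kind_simple[of \<Gamma> A K]
  by blast

lemma nf_has_kind: "has_kind \<Sigma> \<Gamma> A K \<Longrightarrow> \<exists>B. nf_ty A B"
  by (meson has_kind_simple st_nf_ty)

lemma subst_up_ren_Suc: "subst_ty (up \<sigma>) (ren_ty Suc A) = ren_ty Suc (subst_ty \<sigma> A)"
  by (simp add: subst_ren_ty ren_subst_ty up_comp_Suc)

lemma sub_ok_up:
  assumes "sub_ok \<sigma> \<Gamma> \<Gamma>'" "has_kind \<Sigma> \<Gamma>' (subst_ty \<sigma> A) Type" "wf_ctx \<Sigma> \<Gamma>'"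
  shows "sub_ok (up \<sigma>) (A # \<Gamma>) (subst_ty \<sigma> A # \<Gamma>')"
  unfolding sub_ok_def
proof (intro allI impI)
  fix x assume x: "x < length (A # \<Gamma>)"
  have wf: "wf_ctx \<Sigma> (subst_ty \<sigma> A # \<Gamma>')" using assms by (auto intro: ctx_cons)
  show "has_type_nf \<Sigma> (subst_ty \<sigma> A # \<Gamma>') (up \<sigma> x) (subst_ty (up \<sigma>) (lookup (A # \<Gamma>) x))"
  proof (cases x)
    case 0
    obtain B where "nf_ty (subst_ty \<sigma> A) B" using assms(2) nf_has_kind by blast
    then have *: "nf_ty (ren_ty Suc (subst_ty \<sigma> A)) (ren_ty Suc B)" by (rule nf_ty_ren)
    with obj_var[OF wf, of 0 "ren_ty Suc B"] show ?thesis
      unfolding has_type_nf_def 0 by (auto simp: subst_up_ren_Suc)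
  next
    case (Suc y)
    then obtain B where "nf_ty (subst_ty \<sigma> (lookup \<Gamma> y)) B" "has_type \<Sigma> \<Gamma>' (\<sigma> y) B"
      using assms(1) x by (auto simp: sub_ok_def has_type_nf_def)
    then show ?thesis using ren_has_type[OF _ wf ren_ok_Suc] Suc
      by (auto simp: has_type_nf_def subst_up_ren_Suc intro: nf_ty_ren)
  qed
qed

lemma "wf_ctx \<Sigma> \<Gamma> \<Longrightarrow> wf_ctx \<Sigma> \<Gamma>' \<Longrightarrow> sub_ok \<sigma> \<Gamma> \<Gamma>' \<Longrightarrow> True"
  and subst_wf_kind: "wf_kind \<Sigma> \<Gamma> K \<Longrightarrow> wf_ctx \<Sigma> \<Gamma>' \<Longrightarrow> sub_ok \<sigma> \<Gamma> \<Gamma>' \<Longrightarrow>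
    wf_kind \<Sigma> \<Gamma>' (subst_kind \<sigma> K)"
  and subst_has_kind: "has_kind \<Sigma> \<Gamma> A L \<Longrightarrow> wf_ctx \<Sigma> \<Gamma>' \<Longrightarrow> sub_ok \<sigma> \<Gamma> \<Gamma>' \<Longrightarrow>
    has_kind_nf \<Sigma> \<Gamma>' (subst_ty \<sigma> A) (subst_kind \<sigma> L)"
  and subst_has_type: "has_type \<Sigma> \<Gamma> M B \<Longrightarrow> wf_ctx \<Sigma> \<Gamma>' \<Longrightarrow> sub_ok \<sigma> \<Gamma> \<Gamma>' \<Longrightarrow>
    has_type_nf \<Sigma> \<Gamma>' (subst_obj \<sigma> M) (subst_ty \<sigma> B)"
proof (induct arbitrary: \<Gamma>' \<sigma> and \<Gamma>' \<sigma> and \<Gamma>' \<sigma> and \<Gamma>' \<sigma>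
    rule: wf_ctx_wf_kind_has_kind_has_type.inducts)
  case (kind_type \<Gamma>)
  then show ?case by (simp add: wf_ctx_wf_kind_has_kind_has_type.kind_type)
next
  case (kind_pi \<Gamma> A K)
  have A: "has_kind \<Sigma> \<Gamma>' (subst_ty \<sigma> A) Type"
    using kind_pi(2)[OF kind_pi(5,6)] by (simp add: has_kind_nf_Type)
  have "wf_ctx \<Sigma> (subst_ty \<sigma> A # \<Gamma>')" using kind_pi(5) A by (rule ctx_cons)
  from kind_pi(4)[OF this sub_ok_up[OF kind_pi(6) A kind_pi(5)]] A show ?case
    by (simp add: wf_ctx_wf_kind_has_kind_has_type.kind_pi)
next
  case (ty_con \<Gamma> a K K')
  have "subst_kind \<sigma> K' = K'" "nf_kind K' K'"
    using ty_con TDecl_nf_closed nf_kind_idem by blast+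
  with ty_con show ?case
    using wf_ctx_wf_kind_has_kind_has_type.ty_con[of \<Sigma> \<Gamma>' a K K'] by (auto simp: has_kind_nf_def)
next
  case (ty_pi \<Gamma> A B)
  have A: "has_kind \<Sigma> \<Gamma>' (subst_ty \<sigma> A) Type"
    using ty_pi(2)[OF ty_pi(5,6)] by (simp add: has_kind_nf_Type)
  have "wf_ctx \<Sigma> (subst_ty \<sigma> A # \<Gamma>')" using ty_pi(5) A by (rule ctx_cons)
  from ty_pi(4)[OF this sub_ok_up[OF ty_pi(6) A ty_pi(5)]] A show ?case
    by (simp add: has_kind_nf_Type wf_ctx_wf_kind_has_kind_has_type.ty_pi)
next
  case (ty_app \<Gamma> A B K M K')
  \<comment> \<open>The rule for the instantiated application demands that this normal form exists;
    it comes from the simple typing of \<sigma> and \<open>K'\<close>.\<close>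
  obtain L where L: "nf_kind (subst_kind \<sigma> K') L"
    using nf_subst_kind[OF ty_app(7) wf_ctx_wf_kind_has_kind_has_type.ty_app[OF ty_app(1,3,5)]]
    by blast
  obtain B1 K1 where A: "nf_ty (subst_ty \<sigma> B) B1" "nf_kind (subst_kind (up \<sigma>) K) K1"
    "has_kind \<Sigma> \<Gamma>' (subst_ty \<sigma> A) (KPi B1 K1)"
    using ty_app(2)[OF ty_app(6,7)] by (auto simp: has_kind_nf_def nf_kind_KPi)
  have M: "has_type \<Sigma> \<Gamma>' (subst_obj \<sigma> M) B1"
    using ty_app(4)[OF ty_app(6,7)] A(1) nf_ty_unique by (auto simp: has_type_nf_def)
  \<comment> \<open>\<open>L\<close> is reached from \<open>K'\<close>, hence from the instance of
    \<open>K\<close>. Commuting the two substitutions and normalizing the inner one first gives the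
    form that the rule expects.\<close>
  have "nf_kind (subst_kind (inst [subst_obj \<sigma> M]) K1) L"
    using L nf_kind_subst[OF ty_app(5), of \<sigma> L] nf_kind_subst[OF A(2), of "inst [subst_obj \<sigma> M]" L]
    by (simp add: subst_inst_kind)
  then show ?case
    using L wf_ctx_wf_kind_has_kind_has_type.ty_app[OF A(3) M] by (auto simp: has_kind_nf_def)
next
  case (obj_con \<Gamma> c A A')
  have "subst_ty \<sigma> A' = A'" "nf_ty A' A'"
    using obj_con ODecl_nf_closed nf_ty_idem by blast+
  with obj_con show ?case
    using wf_ctx_wf_kind_has_kind_has_type.obj_con[of \<Sigma> \<Gamma>' c A A'] by (auto simp: has_type_nf_def)
next
  case (obj_var \<Gamma> x A')
  then obtain C where "nf_ty (subst_ty \<sigma> (lookup \<Gamma> x)) C" "has_type \<Sigma> \<Gamma>' (\<sigma> x) C"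
    by (auto simp: sub_ok_def has_type_nf_def)
  then show ?case using nf_ty_subst[OF obj_var(4), of \<sigma> C] by (auto simp: has_type_nf_def)
next
  case (obj_lam \<Gamma> A M B A')
  have A: "has_kind \<Sigma> \<Gamma>' (subst_ty \<sigma> A) Type"
    using obj_lam(2)[OF obj_lam(6,7)] by (simp add: has_kind_nf_Type)
  have "wf_ctx \<Sigma> (subst_ty \<sigma> A # \<Gamma>')" using obj_lam(6) A by (rule ctx_cons)
  from obj_lam(4)[OF this sub_ok_up[OF obj_lam(7) A obj_lam(6)]]
  obtain B1 where B1: "nf_ty (subst_ty (up \<sigma>) B) B1"
    "has_type \<Sigma> (subst_ty \<sigma> A # \<Gamma>') (subst_obj (up \<sigma>) M) B1" by (auto simp: has_type_nf_def)
  obtain A1 where A1: "nf_ty (subst_ty \<sigma> A) A1" using A nf_has_kind by blast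
  with nf_ty_subst[OF obj_lam(5)] have "nf_ty (subst_ty \<sigma> A') A1" by simp
  with wf_ctx_wf_kind_has_kind_has_type.obj_lam[OF A B1(2) A1] B1(1) show ?case
    by (auto simp: has_type_nf_def nf_ty_Pi)
next
  case (obj_app \<Gamma> M A B N B')
  obtain L where L: "nf_ty (subst_ty \<sigma> B') L"
    using nf_subst_type[OF obj_app(7) wf_ctx_wf_kind_has_kind_has_type.obj_app[OF obj_app(1,3,5)]]
    by blast
  obtain A1 B1 where M: "nf_ty (subst_ty \<sigma> A) A1" "nf_ty (subst_ty (up \<sigma>) B) B1"
    "has_type \<Sigma> \<Gamma>' (subst_obj \<sigma> M) (Pi A1 B1)"
    using obj_app(2)[OF obj_app(6,7)] by (auto simp: has_type_nf_def nf_ty_Pi)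
  have N: "has_type \<Sigma> \<Gamma>' (subst_obj \<sigma> N) A1"
    using obj_app(4)[OF obj_app(6,7)] M(1) nf_ty_unique by (auto simp: has_type_nf_def)
  have "nf_ty (subst_ty (inst [subst_obj \<sigma> N]) B1) L"
    using L nf_ty_subst[OF obj_app(5), of \<sigma> L] nf_ty_subst[OF M(2), of "inst [subst_obj \<sigma> N]" L]
    by (simp add: subst_inst_ty)
  then show ?case
    using L wf_ctx_wf_kind_has_kind_has_type.obj_app[OF M(3) N] by (auto simp: has_type_nf_def)
qed auto

lemma inst_ren_Suc: "subst_ty (inst [N]) (ren_ty Suc A) = A"
proof -
  have "inst [N] \<circ> Suc = Var" by (auto simp: inst_single)
  then show ?thesis by (simp add: subst_ren_ty)
qed

lemma sub_ok_inst:
  assumes "has_type_nf \<Sigma> \<Gamma> N A" "wf_ctx \<Sigma> \<Gamma>"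
  shows "sub_ok (inst [N]) (A # \<Gamma>) \<Gamma>"
  unfolding sub_ok_def
proof (intro allI impI)
  fix x assume "x < length (A # \<Gamma>)"
  then show "has_type_nf \<Sigma> \<Gamma> (inst [N] x) (subst_ty (inst [N]) (lookup (A # \<Gamma>) x))"
  proof (cases x)
    case 0
    then show ?thesis using assms(1) by (simp add: inst_ren_Suc) (simp add: inst_single)
  next
    case (Suc y)
    then have y: "y < length \<Gamma>" using \<open>x < length (A # \<Gamma>)\<close> by simp
    then obtain B where "nf_ty (lookup \<Gamma> y) B"
      using lookup_has_kind[OF assms(2)] nf_has_kind by blast
    then show ?thesis using Suc obj_var[OF assms(2) y]
      by (auto simp: inst_ren_Suc has_type_nf_def) (auto simp: inst_single)
  qed
qed

section \<open>Conversion of context entries and subject reduction\<close>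

lemma ren_kind_id: "ren_kind (\<lambda>x. x) K = K"
  using subst_kind_Var[of K] by (simp add: comp_def)

lemma ren_ty_id: "ren_ty (\<lambda>x. x) A = A"
  using subst_ty_Var[of A] by (simp add: comp_def ren_ty_eq_subst)

lemma ren_obj_id: "ren_obj (\<lambda>x. x) M = M"
  using subst_obj_Var[of M] by (simp add: comp_def ren_obj_eq_subst)

lemma ren_ok_conv_ctx:
  assumes "nf_ty A C" "nf_ty A' C" "has_kind \<Sigma> \<Gamma> A' Type"
  shows "ren_ok (\<lambda>x. x) (A # \<Gamma>) (A' # \<Gamma>)" "wf_ctx \<Sigma> (A' # \<Gamma>)"
proof -
  show "ren_ok (\<lambda>x. x) (A # \<Gamma>) (A' # \<Gamma>)"
    unfolding ren_ok_def
  proof (intro allI impI conjI)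
    fix x B assume "x < length (A # \<Gamma>)" and B: "nf_ty (lookup (A # \<Gamma>) x) B"
    have "B = ren_ty Suc C" if "nf_ty (ren_ty Suc A) B"
      using nf_ty_unique[OF that nf_ty_ren[OF assms(1)]] .
    with B show "nf_ty (lookup (A' # \<Gamma>) x) (ren_ty (\<lambda>x. x) B)"
      by (cases x) (auto simp: ren_ty_id intro: nf_ty_ren[OF assms(2)])
  qed simp
  show "wf_ctx \<Sigma> (A' # \<Gamma>)" by (rule ctx_cons[OF has_kind_imp_wf_ctx[OF assms(3)] assms(3)])
qed

lemma conv_ctx:
  assumes "nf_ty A C" "nf_ty A' C" "has_kind \<Sigma> \<Gamma> A' Type"
  shows conv_ctx_has_kind: "has_kind \<Sigma> (A # \<Gamma>) B K \<Longrightarrow> has_kind \<Sigma> (A' # \<Gamma>) B K"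
    and conv_ctx_has_type: "has_type \<Sigma> (A # \<Gamma>) M D \<Longrightarrow> has_type \<Sigma> (A' # \<Gamma>) M D"
    and conv_ctx_wf_kind: "wf_kind \<Sigma> (A # \<Gamma>) K \<Longrightarrow> wf_kind \<Sigma> (A' # \<Gamma>) K"
proof -
  note ok = ren_ok_conv_ctx(2,1)[OF assms]
  show "has_kind \<Sigma> (A # \<Gamma>) B K \<Longrightarrow> has_kind \<Sigma> (A' # \<Gamma>) B K"
    using ren_has_kind[OF _ ok, of B K] unfolding ren_kind_id ren_ty_id .
  show "has_type \<Sigma> (A # \<Gamma>) M D \<Longrightarrow> has_type \<Sigma> (A' # \<Gamma>) M D"
    using ren_has_type[OF _ ok, of M D] unfolding ren_obj_id ren_ty_id .
  show "wf_kind \<Sigma> (A # \<Gamma>) K \<Longrightarrow> wf_kind \<Sigma> (A' # \<Gamma>) K"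
    using ren_wf_kind[OF _ ok, of K] unfolding ren_kind_id .
qed

lemma beta_nf: "beta_ty A A' \<Longrightarrow> has_kind \<Sigma> \<Gamma> A K \<Longrightarrow> \<exists>C. nf_ty A C \<and> nf_ty A' C"
  using nf_has_kind nf_ty_reduce by blast

text \<open>The classifier is preserved literally, being a normal form. A step in a domain is
  absorbed by converting the context entry, a step in an argument by \<open>nf_ty_inst_beta\<close>
  or its analogue for kinds, and a contraction by the substitution lemma for one variable.\<close>

lemma subject_reduction_ty: "beta_ty A A' \<Longrightarrow> has_kind \<Sigma> \<Gamma> A K \<Longrightarrow> has_kind \<Sigma> \<Gamma> A' K"
  and subject_reduction_obj: "beta_obj M M' \<Longrightarrow> has_type \<Sigma> \<Gamma> M B \<Longrightarrow> has_type \<Sigma> \<Gamma> M' B"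
proof (induct arbitrary: \<Gamma> K and \<Gamma> B rule: beta_ty_beta_obj.inducts)
  case (1 A A' B)
  from 1(3) have A: "K = Type" "has_kind \<Sigma> \<Gamma> A Type" "has_kind \<Sigma> (A # \<Gamma>) B Type"
    by (auto elim!: has_kind_Pi)
  have A': "has_kind \<Sigma> \<Gamma> A' Type" using 1(2) A(2) .
  obtain C where "nf_ty A C" "nf_ty A' C" using beta_nf[OF 1(1) A(2)] by blast
  from conv_ctx_has_kind[OF this A' A(3)] A' show ?case unfolding A(1) by (rule ty_pi[rotated])
next
  case (2 B B' A)
  then show ?case by (auto elim!: has_kind_Pi intro: ty_pi)
next
  case (3 A A' M)
  then show ?case by (auto elim!: has_kind_TApp intro: ty_app)
next
  case (4 M M' A)
  from 4(3) obtain C L where "has_kind \<Sigma> \<Gamma> A (KPi C L)" "has_type \<Sigma> \<Gamma> M C"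
    "nf_kind (subst_kind (inst [M]) L) K" by (elim has_kind_TApp) blast
  then show ?case using 4(2) nf_kind_inst_beta[OF 4(1)] ty_app by blast
next
  case (5 A M N)
  then obtain A' B' where M: "has_type \<Sigma> (A # \<Gamma>) M B'" "nf_ty A A'" "has_type \<Sigma> \<Gamma> N A'"
    "nf_ty (subst_ty (inst [N]) B') B"
    by (auto elim!: has_type_App has_type_Lam)
  have "has_type_nf \<Sigma> \<Gamma> (subst_obj (inst [N]) M) (subst_ty (inst [N]) B')"
  proof (rule subst_has_type[OF M(1)])
    show wf: "wf_ctx \<Sigma> \<Gamma>" using has_type_imp_wf_ctx[OF M(3)] .
    show "sub_ok (inst [N]) (A # \<Gamma>) \<Gamma>"
      using M(2,3) by (intro sub_ok_inst wf) (auto simp: has_type_nf_def)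
  qed
  then show ?case using M(4) nf_ty_unique by (auto simp: has_type_nf_def)
next
  case (6 A A' M)
  from 6(3) obtain A1 B1 where M: "B = Pi A1 B1" "has_kind \<Sigma> \<Gamma> A Type" "has_type \<Sigma> (A # \<Gamma>) M B1" "nf_ty A A1"
    by (auto elim!: has_type_Lam)
  have "nf_ty A' A1" using nf_ty_reduce[OF _ M(4)] 6(1) by blast
  moreover have A': "has_kind \<Sigma> \<Gamma> A' Type" using 6(2) M(2) .
  moreover have "has_type \<Sigma> (A' # \<Gamma>) M B1" using conv_ctx_has_type[OF M(4) \<open>nf_ty A' A1\<close> A' M(3)] .
  ultimately show ?case unfolding M(1) using obj_lam by blast
next
  case (7 M M' A)
  then show ?case by (auto elim!: has_type_Lam intro: obj_lam)
next
  case (8 M M' N)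
  then show ?case by (auto elim!: has_type_App intro: obj_app)
next
  case (9 N N' M)
  from 9(3) obtain C D where "has_type \<Sigma> \<Gamma> M (Pi C D)" "has_type \<Sigma> \<Gamma> N C"
    "nf_ty (subst_ty (inst [N]) D) B" by (elim has_type_App) blast
  then show ?case using 9(2) nf_ty_inst_beta[OF 9(1)] obj_app by blast
qed

lemma betas_has_kind: "beta_ty\<^sup>*\<^sup>* A A' \<Longrightarrow> has_kind \<Sigma> \<Gamma> A K \<Longrightarrow> has_kind \<Sigma> \<Gamma> A' K"
  by (induct rule: rtranclp_induct) (auto intro: subject_reduction_ty)

lemma nf_preserves_has_kind: "nf_ty A A' \<Longrightarrow> has_kind \<Sigma> \<Gamma> A K \<Longrightarrow> has_kind \<Sigma> \<Gamma> A' K"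
  using betas_has_kind nf_ty_imp_betas by blast

text \<open>The instantiated kind of a type head is first known to be well formed before
  normalization; walking along the spine requires this for the instance of its normal form.\<close>

lemma subject_reduction_kind: "beta_kind K K' \<Longrightarrow> wf_kind \<Sigma> \<Gamma> K \<Longrightarrow> wf_kind \<Sigma> \<Gamma> K'"
proof (induct arbitrary: \<Gamma> rule: beta_kind.induct)
  case (1 A A' K)
  from 1(2) have A: "has_kind \<Sigma> \<Gamma> A Type" "wf_kind \<Sigma> (A # \<Gamma>) K" by (auto elim: wf_kind_KPi)
  have A': "has_kind \<Sigma> \<Gamma> A' Type" using subject_reduction_ty[OF 1(1) A(1)] .
  obtain C where "nf_ty A C" "nf_ty A' C" using beta_nf[OF 1(1) A(1)] by blast
  from kind_pi[OF A' conv_ctx_wf_kind[OF this A' A(2)]] show ?case .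
next
  case (2 K K' A)
  then show ?case by (auto elim!: wf_kind_KPi intro: kind_pi)
qed

lemma betas_wf_kind: "beta_kind\<^sup>*\<^sup>* K K' \<Longrightarrow> wf_kind \<Sigma> \<Gamma> K \<Longrightarrow> wf_kind \<Sigma> \<Gamma> K'"
  by (induct rule: rtranclp_induct) (auto intro: subject_reduction_kind)

lemma nf_preserves_wf_kind: "nf_kind K K' \<Longrightarrow> wf_kind \<Sigma> \<Gamma> K \<Longrightarrow> wf_kind \<Sigma> \<Gamma> K'"
  using betas_wf_kind by (auto simp: nf_kind_def)

end

section \<open>Strict occurrences\<close>

lemma apps_simps [simp]:
  "apps H [] = H" "apps H (Ms @ [M]) = App (apps H Ms) M" "apps H (M # Ms) = apps (App H M) Ms"
  by (simp_all add: apps_def)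

lemma tapps_simps [simp]:
  "tapps A [] = A" "tapps A (Ms @ [M]) = TApp (tapps A Ms) M"
  by (simp_all add: tapps_def)

lemma subst_apps: "subst_obj \<sigma> (apps H Ms) = apps (subst_obj \<sigma> H) (map (subst_obj \<sigma>) Ms)"
  by (induct Ms rule: rev_induct) simp_all

lemma apps_eq_Lam: "apps H Ms = Lam A M \<Longrightarrow> H = Lam A M"
  by (cases Ms rule: rev_cases) auto

lemma beta_apps:
  assumes "beta_obj (apps H Ms) P" "\<And>A M. H \<noteq> Lam A M" "\<And>Q. \<not> beta_obj H Q"
  shows "\<exists>Ms1 M M' Ms2. Ms = Ms1 @ M # Ms2 \<and> P = apps H (Ms1 @ M' # Ms2) \<and> beta_obj M M'"
  using assms(1)
proof (induct Ms arbitrary: P rule: rev_induct)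
  case Nil
  then show ?case using assms(3) by simp
next
  case (snoc N Ms)
  from snoc(2) have "beta_obj (App (apps H Ms) N) P" by simp
  then show ?case
  proof (cases rule: beta_App[consumes 1])
    case (1 A M)
    then show ?thesis using apps_eq_Lam assms(2) by blast
  next
    case (2 M')
    then obtain Ms1 M N' Ms2 where
      "Ms = Ms1 @ M # Ms2" "M' = apps H (Ms1 @ N' # Ms2)" "beta_obj M N'"
      using snoc(1) by blast
    then have "Ms @ [N] = Ms1 @ M # (Ms2 @ [N]) \<and> P = apps H (Ms1 @ N' # (Ms2 @ [N])) \<and> beta_obj M N'"
      using 2 by (simp add: apps_def)
    then show ?thesis by blast
  next
    case (3 N')
    then have "Ms @ [N] = Ms @ N # [] \<and> P = apps H (Ms @ N' # []) \<and> beta_obj N N'" by simp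
    then show ?thesis by blast
  qed
qed

lemma beta_apps_Var:
  "beta_obj (apps (Var x) Ms) P \<Longrightarrow>
    \<exists>Ms1 M M' Ms2. Ms = Ms1 @ M # Ms2 \<and> P = apps (Var x) (Ms1 @ M' # Ms2) \<and> beta_obj M M'"
  by (rule beta_apps) (auto elim: beta_Var)

lemma beta_apps_Con:
  "beta_obj (apps (Con c) Ms) P \<Longrightarrow>
    \<exists>Ms1 M M' Ms2. Ms = Ms1 @ M # Ms2 \<and> P = apps (Con c) (Ms1 @ M' # Ms2) \<and> beta_obj M M'"
  by (rule beta_apps) (auto elim: beta_Con)

text \<open>The path to a strict occurrence crosses only abstractions and arguments of variables or
  constants, so no redex lies on it, and the pattern at its end is normal. Reduction beside the path
  cannot discard the occurrence.\<close>

lemma strict_obj_beta: "strict_obj X \<delta> x M \<Longrightarrow> beta_obj M M' \<Longrightarrow> strict_obj X \<delta> x M'"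
proof (induct arbitrary: M' rule: strict_obj.induct)
  case (init_o ys \<delta> X x)
  obtain Ms1 N N' Ms2 where "map Var ys = Ms1 @ N # Ms2" "beta_obj N N'"
    using beta_apps_Var[OF init_o(3)] by blast
  then show ?case by (auto simp: map_eq_append_conv elim: beta_Var)
next
  case (app_var_o y X M Ms \<delta> x)
  obtain Ms1 N N' Ms2 where
    *: "Ms = Ms1 @ N # Ms2" "M' = apps (Var y) (Ms1 @ N' # Ms2)" "beta_obj N N'"
    using beta_apps_Var[OF app_var_o(5)] by blast
  have "\<exists>P\<in>set (Ms1 @ N' # Ms2). strict_obj X \<delta> x P"
    using app_var_o(2,3,4) * by auto
  then show ?case using app_var_o(1) *(2) strict_obj.app_var_o by blast
next
  case (app_con_o M Ms X \<delta> x c)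
  obtain Ms1 N N' Ms2 where
    *: "Ms = Ms1 @ N # Ms2" "M' = apps (Con c) (Ms1 @ N' # Ms2)" "beta_obj N N'"
    using beta_apps_Con[OF app_con_o(4)] by blast
  have "\<exists>P\<in>set (Ms1 @ N' # Ms2). strict_obj X \<delta> x P"
    using app_con_o(1,2,3) * by auto
  then show ?case using *(2) strict_obj.app_con_o by blast
next
  case (abs_o X \<delta> x M A)
  from abs_o(3) show ?case by (auto elim!: beta_Lam intro: strict_obj.abs_o abs_o(1,2))
qed

lemma strict_obj_betas: "beta_obj\<^sup>*\<^sup>* M M' \<Longrightarrow> strict_obj X \<delta> x M \<Longrightarrow> strict_obj X \<delta> x M'"
  by (induct rule: rtranclp_induct) (auto intro: strict_obj_beta)

lemma beta_tapps:
  "beta_ty (tapps (TCon a) Ms) A \<Longrightarrow> \<exists>Ms'. A = tapps (TCon a) Ms' \<and> list_all2 beta_obj\<^sup>*\<^sup>* Ms Ms'"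
proof (induct Ms arbitrary: A rule: rev_induct)
  case Nil
  then show ?case by (auto elim: beta_TCon)
next
  case (snoc N Ms)
  have refl: "list_all2 beta_obj\<^sup>*\<^sup>* Ms Ms" by (simp add: list.rel_refl)
  from snoc(2) have "beta_ty (TApp (tapps (TCon a) Ms) N) A" by simp
  then show ?case
  proof (cases rule: beta_TApp[consumes 1])
    case (1 A')
    then obtain Ms' where "A' = tapps (TCon a) Ms'" "list_all2 beta_obj\<^sup>*\<^sup>* Ms Ms'"
      using snoc(1) by blast
    then have "A = tapps (TCon a) (Ms' @ [N])" "list_all2 beta_obj\<^sup>*\<^sup>* (Ms @ [N]) (Ms' @ [N])"
      using 1 by (auto intro: list_all2_appendI)
    then show ?thesis by blast
  next
    case (2 N')
    then have "list_all2 beta_obj\<^sup>*\<^sup>* (Ms @ [N]) (Ms @ [N'])"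
      by (intro list_all2_appendI refl) simp
    then show ?thesis using 2 by (intro exI[of _ "Ms @ [N']"]) simp
  qed
qed

lemma betas_tapps:
  "beta_ty\<^sup>*\<^sup>* (tapps (TCon a) Ms) A \<Longrightarrow>
    \<exists>Ms'. A = tapps (TCon a) Ms' \<and> list_all2 beta_obj\<^sup>*\<^sup>* Ms Ms'"
proof (induct rule: rtranclp_induct)
  case base
  have "list_all2 beta_obj\<^sup>*\<^sup>* Ms Ms" by (simp add: list.rel_refl)
  then show ?case by blast
next
  case (step A B)
  then obtain Ms' where Ms': "A = tapps (TCon a) Ms'" "list_all2 beta_obj\<^sup>*\<^sup>* Ms Ms'" by blast
  then obtain Ms'' where "B = tapps (TCon a) Ms''" "list_all2 beta_obj\<^sup>*\<^sup>* Ms' Ms''"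
    using beta_tapps step(2) by blast
  moreover have "list_all2 beta_obj\<^sup>*\<^sup>* Ms Ms''"
    using list_all2_trans[of "beta_obj\<^sup>*\<^sup>*" "beta_obj\<^sup>*\<^sup>*" "beta_obj\<^sup>*\<^sup>*"] Ms'(2) calculation(2)
      rtranclp_trans[of beta_obj] by blast
  ultimately show ?case by blast
qed

section \<open>Typings before and after instantiation\<close>

context valid_signature
begin

definition good :: "(nat \<Rightarrow> obj) \<Rightarrow> ctx \<Rightarrow> ctx \<Rightarrow> obj \<Rightarrow> bool" where
  "good \<sigma> \<Gamma> \<Gamma>' M \<longleftrightarrow> (\<exists>E E'. has_type \<Sigma> \<Gamma> M E \<and> has_type \<Sigma> \<Gamma>' (subst_obj \<sigma> M) E' \<and>
    nf_ty (subst_ty \<sigma> E) E' \<and> has_kind \<Sigma> \<Gamma>' (subst_ty \<sigma> E) Type)"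

text \<open>Goodness for a partially applied family, whose kind plays the part of the type.
  Well-formedness of the instantiated kind makes its domains types, which is how the arguments
  become good.\<close>

definition good_ty :: "(nat \<Rightarrow> obj) \<Rightarrow> ctx \<Rightarrow> ctx \<Rightarrow> ty \<Rightarrow> bool" where
  "good_ty \<sigma> \<Gamma> \<Gamma>' A \<longleftrightarrow> (\<exists>K K'. has_kind \<Sigma> \<Gamma> A K \<and> has_kind \<Sigma> \<Gamma>' (subst_ty \<sigma> A) K' \<and>
    nf_kind (subst_kind \<sigma> K) K' \<and> wf_kind \<Sigma> \<Gamma>' (subst_kind \<sigma> K))"

text \<open>Inverting both typings of the application gives two function types. By uniqueness they
  are those of the good head, so \<sigma> takes one domain to the other and the argument inherits
  goodness. The application is good too, which lets a spine be walked from its head.\<close>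

lemma good_AppD:
  assumes H: "good \<sigma> \<Gamma> \<Gamma>' H"
    and F: "has_type \<Sigma> \<Gamma> (App H M) F" and F': "has_type \<Sigma> \<Gamma>' (subst_obj \<sigma> (App H M)) F'"
  shows "good \<sigma> \<Gamma> \<Gamma>' M" "good \<sigma> \<Gamma> \<Gamma>' (App H M)"
proof -
  obtain A B where 1: "has_type \<Sigma> \<Gamma> H (Pi A B)" "has_type \<Sigma> \<Gamma> M A" "nf_ty (subst_ty (inst [M]) B) F"
    using F by (elim has_type_App) blast
  have "has_type \<Sigma> \<Gamma>' (App (subst_obj \<sigma> H) (subst_obj \<sigma> M)) F'" using F' by simp
  then obtain A' B' where 2: "has_type \<Sigma> \<Gamma>' (subst_obj \<sigma> H) (Pi A' B')"
    "has_type \<Sigma> \<Gamma>' (subst_obj \<sigma> M) A'" "nf_ty (subst_ty (inst [subst_obj \<sigma> M]) B') F'"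
    by (elim has_type_App) blast
  obtain E E' where "has_type \<Sigma> \<Gamma> H E" "has_type \<Sigma> \<Gamma>' (subst_obj \<sigma> H) E'"
    "nf_ty (subst_ty \<sigma> E) E'" "has_kind \<Sigma> \<Gamma>' (subst_ty \<sigma> E) Type"
    using H unfolding good_def by blast
  moreover have "E = Pi A B" "E' = Pi A' B'"
    using has_type_unique 1(1) 2(1) calculation by blast+
  ultimately have nf: "nf_ty (subst_ty \<sigma> A) A'" "nf_ty (subst_ty (up \<sigma>) B) B'"
    and k: "has_kind \<Sigma> \<Gamma>' (subst_ty \<sigma> A) Type" "has_kind \<Sigma> (subst_ty \<sigma> A # \<Gamma>') (subst_ty (up \<sigma>) B) Type"
    by (auto simp: nf_ty_Pi elim: has_kind_Pi)
  show "good \<sigma> \<Gamma> \<Gamma>' M" unfolding good_def using 1(2) 2(2) nf(1) k(1) by blast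
  have eq: "subst_ty \<sigma> (subst_ty (inst [M]) B) =
      subst_ty (inst [subst_obj \<sigma> M]) (subst_ty (up \<sigma>) B)"
    by (rule subst_inst_ty)
  have "nf_ty (subst_ty \<sigma> F) F'"
    using 2(3) nf_ty_subst[OF 1(3), of \<sigma> F'] nf_ty_subst[OF nf(2), of "inst [subst_obj \<sigma> M]" F'] eq
    by simp
  \<comment> \<open>The substitution lemma applies here although \<sigma> is not known to be well
    typed: only the single argument \<open>subst_obj \<sigma> M\<close> is substituted, and its type
    is known from the second derivation.\<close>
  moreover have "has_kind_nf \<Sigma> \<Gamma>' (subst_ty \<sigma> (subst_ty (inst [M]) B)) (subst_kind (inst [subst_obj \<sigma> M]) Type)"
    unfolding eq
  proof (rule subst_has_kind[OF k(2)])
    show "wf_ctx \<Sigma> \<Gamma>'" using has_type_imp_wf_ctx[OF F'] .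
    then show "sub_ok (inst [subst_obj \<sigma> M]) (subst_ty \<sigma> A # \<Gamma>') \<Gamma>'"
      using 2(2) nf(1) by (intro sub_ok_inst) (auto simp: has_type_nf_def)
  qed
  then have "has_kind \<Sigma> \<Gamma>' (subst_ty \<sigma> F) Type"
    using betas_has_kind[OF betas_subst_ty[OF nf_ty_imp_betas[OF 1(3)]]]
    by (simp add: has_kind_nf_Type)
  ultimately show "good \<sigma> \<Gamma> \<Gamma>' (App H M)" unfolding good_def using F F' by blast
qed

lemma good_LamD:
  assumes "good \<sigma> \<Gamma> \<Gamma>' (Lam A M)"
  shows "good (up \<sigma>) (A # \<Gamma>) (subst_ty \<sigma> A # \<Gamma>') M"
proof -
  obtain E E' where E: "has_type \<Sigma> \<Gamma> (Lam A M) E" "nf_ty (subst_ty \<sigma> E) E'"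
    "has_type \<Sigma> \<Gamma>' (Lam (subst_ty \<sigma> A) (subst_obj (up \<sigma>) M)) E'" "has_kind \<Sigma> \<Gamma>' (subst_ty \<sigma> E) Type"
    using assms unfolding good_def by auto
  obtain A1 B where 1: "E = Pi A1 B" "nf_ty A A1" "has_type \<Sigma> (A # \<Gamma>) M B"
    using E(1) by (elim has_type_Lam) blast
  obtain A2 B2 where 2: "E' = Pi A2 B2" "nf_ty (subst_ty \<sigma> A) A2" "has_kind \<Sigma> \<Gamma>' (subst_ty \<sigma> A) Type"
    "has_type \<Sigma> (subst_ty \<sigma> A # \<Gamma>') (subst_obj (up \<sigma>) M) B2"
    using E(3) by (elim has_type_Lam) blast
  have nf: "nf_ty (subst_ty \<sigma> A1) A2" "nf_ty (subst_ty (up \<sigma>) B) B2"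
    using E(2) by (auto simp: 1 2 nf_ty_Pi)
  \<comment> \<open>The function type contains the normal form \<open>A1\<close> of the annotation,
    while the body is typed over \<open>A\<close>. Their instances have the same normal form, so the
    entry may be converted.\<close>
  have "has_kind \<Sigma> (subst_ty \<sigma> A1 # \<Gamma>') (subst_ty (up \<sigma>) B) Type"
    using E(4) by (auto simp: 1 elim: has_kind_Pi)
  then have "has_kind \<Sigma> (subst_ty \<sigma> A # \<Gamma>') (subst_ty (up \<sigma>) B) Type"
    by (rule conv_ctx_has_kind[OF nf(1) 2(2,3)])
  then show ?thesis unfolding good_def using 1(3) 2(4) nf(2) by blast
qed

lemma closed_has_kind: "has_kind \<Sigma> [] A K \<Longrightarrow> wf_ctx \<Sigma> \<Gamma> \<Longrightarrow> has_kind \<Sigma> \<Gamma> A K"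
  using ren_has_kind[of "[]" A K \<Gamma> "\<lambda>x. x"] unfolding ren_ty_id ren_kind_id by (simp add: ren_ok_def)

lemma closed_wf_kind: "wf_kind \<Sigma> [] K \<Longrightarrow> wf_ctx \<Sigma> \<Gamma> \<Longrightarrow> wf_kind \<Sigma> \<Gamma> K"
  using ren_wf_kind[of "[]" K \<Gamma> "\<lambda>x. x"] unfolding ren_kind_id by (simp add: ren_ok_def)

text \<open>Declared types are closed, so the instantiation fixes the type, and it is well formed
  over any well-formed context.\<close>

lemma good_Con:
  assumes "has_type \<Sigma> \<Gamma> (Con c) E" "has_type \<Sigma> \<Gamma>' (Con c) E'"
  shows "good \<sigma> \<Gamma> \<Gamma>' (Con c)"
proof -
  obtain A where A: "ODecl c A \<in> set \<Sigma>" "nf_ty A E" using assms(1) by (elim has_type_Con)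
  obtain B where "ODecl c B \<in> set \<Sigma>" "nf_ty B E'" using assms(2) by (elim has_type_Con)
  with A have "E' = E" using ODecl_unique nf_ty_unique by blast
  moreover have "subst_ty \<sigma> E = E" using ODecl_nf_closed[OF A] .
  moreover have "has_kind \<Sigma> \<Gamma>' E Type"
    using nf_preserves_has_kind[OF A(2)] closed_has_kind[OF ODecl_kind[OF A(1)]]
      has_type_imp_wf_ctx[OF assms(2)] by blast
  ultimately show ?thesis unfolding good_def using assms nf_ty_idem[OF A(2)]
    by (intro exI[of _ E] exI[of _ E'] conjI) simp_all
qed

text \<open>For a variable that \<sigma> merely renames, the instance of its declared type is itself
  a declared type of \<open>\<Gamma>'\<close>, hence well formed there. This is what makes such a
  head rigid.\<close>

lemma good_Var:
  assumes "has_type \<Sigma> \<Gamma> (Var y) E" "has_type \<Sigma> \<Gamma>' (Var z) E'"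
    and "\<sigma> y = Var z" "lookup \<Gamma>' z = subst_ty \<sigma> (lookup \<Gamma> y)"
  shows "good \<sigma> \<Gamma> \<Gamma>' (Var y)"
proof -
  have E: "nf_ty (lookup \<Gamma> y) E" using assms(1) by (elim has_type_Var)
  have E': "z < length \<Gamma>'" "nf_ty (subst_ty \<sigma> (lookup \<Gamma> y)) E'"
    using assms(2,4) by (auto elim: has_type_Var)
  have "has_kind \<Sigma> \<Gamma>' (subst_ty \<sigma> (lookup \<Gamma> y)) Type"
    using lookup_has_kind[OF has_type_imp_wf_ctx[OF assms(2)] E'(1)] assms(4) by simp
  then have "has_kind \<Sigma> \<Gamma>' (subst_ty \<sigma> E) Type"
    by (rule betas_has_kind[OF betas_subst_ty[OF nf_ty_imp_betas[OF E]]])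
  moreover have "nf_ty (subst_ty \<sigma> E) E'" using nf_ty_subst[OF E] E'(2) by blast
  ultimately show ?thesis unfolding good_def using assms by auto
qed

lemma has_type_apps_head: "has_type \<Sigma> \<Gamma> (apps H Ms) E \<Longrightarrow> \<exists>F. has_type \<Sigma> \<Gamma> H F"
  by (induct Ms arbitrary: E rule: rev_induct) (auto elim: has_type_App)

lemma good_appsD:
  assumes "good \<sigma> \<Gamma> \<Gamma>' H"
  shows "has_type \<Sigma> \<Gamma> (apps H Ms) E \<Longrightarrow> has_type \<Sigma> \<Gamma>' (subst_obj \<sigma> (apps H Ms)) E' \<Longrightarrow>
    good \<sigma> \<Gamma> \<Gamma>' (apps H Ms) \<and> (\<forall>M\<in>set Ms. good \<sigma> \<Gamma> \<Gamma>' M)"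
proof (induct Ms arbitrary: E E' rule: rev_induct)
  case Nil
  then show ?case using assms by simp
next
  case (snoc M Ms)
  have t: "has_type \<Sigma> \<Gamma> (App (apps H Ms) M) E" using snoc(2) by simp
  have t': "has_type \<Sigma> \<Gamma>' (subst_obj \<sigma> (App (apps H Ms) M)) E'" using snoc(3) by simp
  obtain F where "has_type \<Sigma> \<Gamma> (apps H Ms) F" using t by (elim has_type_App)
  moreover obtain F' where "has_type \<Sigma> \<Gamma>' (subst_obj \<sigma> (apps H Ms)) F'"
    using t' by (auto elim: has_type_App)
  ultimately have IH: "good \<sigma> \<Gamma> \<Gamma>' (apps H Ms)" "\<forall>M\<in>set Ms. good \<sigma> \<Gamma> \<Gamma>' M"
    using snoc(1) by blast+
  show ?case using IH(2) good_AppD[OF IH(1) t t'] by simp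
qed

lemma good_ty_TCon:
  assumes "has_kind \<Sigma> \<Gamma> (TCon a) K" "has_kind \<Sigma> \<Gamma>' (TCon a) K'"
  shows "good_ty \<sigma> \<Gamma> \<Gamma>' (TCon a)"
proof -
  obtain L where L: "TDecl a L \<in> set \<Sigma>" "nf_kind L K" using assms(1) by (elim has_kind_TCon)
  obtain L' where "TDecl a L' \<in> set \<Sigma>" "nf_kind L' K'" using assms(2) by (elim has_kind_TCon)
  with L have "K' = K" using TDecl_unique nf_kind_unique by blast
  moreover have "subst_kind \<sigma> K = K" using TDecl_nf_closed[OF L] .
  moreover have "wf_kind \<Sigma> \<Gamma>' K"
    using nf_preserves_wf_kind[OF L(2)] closed_wf_kind[OF TDecl_kind[OF L(1)]]
      has_kind_imp_wf_ctx[OF assms(2)] by blast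
  ultimately show ?thesis unfolding good_ty_def using assms nf_kind_idem[OF L(2)]
    by (intro exI[of _ K] exI[of _ K'] conjI) simp_all
qed

lemma good_ty_TAppD:
  assumes A: "good_ty \<sigma> \<Gamma> \<Gamma>' A"
    and F: "has_kind \<Sigma> \<Gamma> (TApp A M) F" and F': "has_kind \<Sigma> \<Gamma>' (subst_ty \<sigma> (TApp A M)) F'"
  shows "good \<sigma> \<Gamma> \<Gamma>' M" "good_ty \<sigma> \<Gamma> \<Gamma>' (TApp A M)"
proof -
  obtain B L where 1: "has_kind \<Sigma> \<Gamma> A (KPi B L)" "has_type \<Sigma> \<Gamma> M B"
    "nf_kind (subst_kind (inst [M]) L) F"
    using F by (elim has_kind_TApp) blast
  have "has_kind \<Sigma> \<Gamma>' (TApp (subst_ty \<sigma> A) (subst_obj \<sigma> M)) F'" using F' by simp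
  then obtain B' L' where 2: "has_kind \<Sigma> \<Gamma>' (subst_ty \<sigma> A) (KPi B' L')"
    "has_type \<Sigma> \<Gamma>' (subst_obj \<sigma> M) B'" "nf_kind (subst_kind (inst [subst_obj \<sigma> M]) L') F'"
    by (elim has_kind_TApp) blast
  obtain K K' where "has_kind \<Sigma> \<Gamma> A K" "has_kind \<Sigma> \<Gamma>' (subst_ty \<sigma> A) K'"
    "nf_kind (subst_kind \<sigma> K) K'" "wf_kind \<Sigma> \<Gamma>' (subst_kind \<sigma> K)"
    using A unfolding good_ty_def by blast
  moreover have "K = KPi B L" "K' = KPi B' L'"
    using has_kind_unique 1(1) 2(1) calculation by blast+
  ultimately have nf: "nf_ty (subst_ty \<sigma> B) B'" "nf_kind (subst_kind (up \<sigma>) L) L'"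
    and k: "has_kind \<Sigma> \<Gamma>' (subst_ty \<sigma> B) Type" "wf_kind \<Sigma> (subst_ty \<sigma> B # \<Gamma>') (subst_kind (up \<sigma>) L)"
    by (auto simp: nf_kind_KPi elim: wf_kind_KPi)
  show "good \<sigma> \<Gamma> \<Gamma>' M" unfolding good_def using 1(2) 2(2) nf(1) k(1) by blast
  have eq: "subst_kind \<sigma> (subst_kind (inst [M]) L) =
      subst_kind (inst [subst_obj \<sigma> M]) (subst_kind (up \<sigma>) L)"
    by (rule subst_inst_kind)
  have "nf_kind (subst_kind \<sigma> F) F'"
    using 2(3) nf_kind_subst[OF 1(3), of \<sigma> F'] nf_kind_subst[OF nf(2), of "inst [subst_obj \<sigma> M]" F'] eq
    by simp
  moreover have "wf_kind \<Sigma> \<Gamma>' (subst_kind \<sigma> (subst_kind (inst [M]) L))"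
    unfolding eq
  proof (rule subst_wf_kind[OF k(2)])
    show "wf_ctx \<Sigma> \<Gamma>'" using has_kind_imp_wf_ctx[OF F'] .
    then show "sub_ok (inst [subst_obj \<sigma> M]) (subst_ty \<sigma> B # \<Gamma>') \<Gamma>'"
      using 2(2) nf(1) by (intro sub_ok_inst) (auto simp: has_type_nf_def)
  qed
  then have "wf_kind \<Sigma> \<Gamma>' (subst_kind \<sigma> F)"
    using betas_wf_kind[OF betas_subst_kind] 1(3) by (auto simp: nf_kind_def)
  ultimately show "good_ty \<sigma> \<Gamma> \<Gamma>' (TApp A M)" unfolding good_ty_def using F F' by blast
qed

lemma good_tappsD:
  assumes "has_kind \<Sigma> \<Gamma> (tapps (TCon a) Ms) K" "has_kind \<Sigma> \<Gamma>' (subst_ty \<sigma> (tapps (TCon a) Ms)) K'"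
  shows "good_ty \<sigma> \<Gamma> \<Gamma>' (tapps (TCon a) Ms) \<and> (\<forall>M\<in>set Ms. good \<sigma> \<Gamma> \<Gamma>' M)"
  using assms
proof (induct Ms arbitrary: K K' rule: rev_induct)
  case Nil
  then show ?case using good_ty_TCon by simp
next
  case (snoc M Ms)
  let ?A = "tapps (TCon a) Ms"
  have t: "has_kind \<Sigma> \<Gamma> (TApp ?A M) K" using snoc(2) by simp
  have t': "has_kind \<Sigma> \<Gamma>' (subst_ty \<sigma> (TApp ?A M)) K'" using snoc(3) by simp
  obtain F where "has_kind \<Sigma> \<Gamma> ?A F" using t by (elim has_kind_TApp)
  moreover obtain F' where "has_kind \<Sigma> \<Gamma>' (subst_ty \<sigma> ?A) F'"
    using t' by (auto elim: has_kind_TApp)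
  ultimately have IH: "good_ty \<sigma> \<Gamma> \<Gamma>' ?A" "\<forall>M\<in>set Ms. good \<sigma> \<Gamma> \<Gamma>' M"
    using snoc(1) by blast+
  show ?case using IH(2) good_ty_TAppD[OF IH(1) t t'] by simp
qed

text \<open>Instantiation by a variable is a renaming and so keeps normal forms normal. Along a
  pattern the result types are therefore exact instances of the codomains.\<close>

lemma inst_Var: "subst_ty (inst [Var y]) A = ren_ty (case_nat y (\<lambda>x. x)) A"
proof -
  have "inst [Var y] = Var \<circ> case_nat y (\<lambda>x. x)"
    by (auto simp: inst_single fun_eq_iff split: nat.split)
  then show ?thesis by (simp add: ren_ty_eq_subst)
qed

lemma inst_Var_up_ren: "subst_ty (inst [Var y]) (ren_ty (up_ren \<rho>) A) = ren_ty (case_nat y \<rho>) A"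
proof -
  have "case_nat y (\<lambda>x. x) \<circ> up_ren \<rho> = case_nat y \<rho>"
    by (auto simp: fun_eq_iff up_ren_def split: nat.split)
  then show ?thesis by (simp add: inst_Var ren_ren_ty)
qed

lemma ren_case_nat_Suc: "ren_ty (case_nat y \<rho>) (ren_ty Suc A) = ren_ty \<rho> A"
proof -
  have "case_nat y \<rho> \<circ> Suc = \<rho>" by auto
  then show ?thesis by (simp add: ren_ren_ty)
qed

text \<open>
  The pattern condition makes the type of the head recoverable from the type of the spine: the
  arguments \<open>ys\<close> are moved one by one into the context \<open>\<Psi>\<close> over which the head is typed, and
  \<open>\<rho>\<close>, which embeds \<open>\<Psi>\<close> into \<open>\<Gamma>'\<close>, stays injective because the \<open>ys\<close> are distinct and do not
  occur in the head.
\<close>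

lemma pattern_spine:
  assumes "unren_ok \<rho> \<Psi> \<Gamma>'" "wf_ctx \<Sigma> \<Psi>" "distinct ys"
    and "\<forall>y\<in>set ys. y \<notin> range \<rho> \<and> \<sigma> y = Var y \<and> lookup \<Gamma>' y = subst_ty \<sigma> (lookup \<Gamma> y)"
    and "has_type \<Sigma> \<Gamma> H T" "has_type \<Sigma> \<Gamma>' H' (ren_ty \<rho> D)" "subst_ty \<sigma> T = ren_ty \<rho> U"
    and "has_type \<Sigma> \<Gamma> (apps H (map Var ys)) E" "has_type \<Sigma> \<Gamma>' (apps H' (map Var ys)) E'"
    and "nf_ty (subst_ty \<sigma> E) E'" "has_kind \<Sigma> \<Gamma>' (subst_ty \<sigma> E) Type"
  shows "nf_ty U D \<and> has_kind \<Sigma> \<Psi> U Type"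
  using assms(1-9)
\<comment> \<open>\<open>T\<close> types the head before instantiation; \<open>D\<close> and
  \<open>U\<close> are its type afterwards and the instance of \<open>T\<close>, both pulled back
  along \<rho> to \<Psi>. All of these change with each argument. The heads \<open>H\<close> and
  \<open>H'\<close> are linked only through their types.\<close>
proof (induct ys arbitrary: \<rho> \<Psi> H H' T D U)
  case Nil
  have "E = T" "E' = ren_ty \<rho> D" using Nil(5,6,8,9) has_type_unique by auto
  then have "nf_ty (ren_ty \<rho> U) (ren_ty \<rho> D)" "has_kind \<Sigma> \<Gamma>' (ren_ty \<rho> U) Type"
    using assms(10,11) Nil(7) by auto
  moreover have "inj \<rho>" using Nil(1) by (simp add: unren_ok_def)
  ultimately show ?case using nf_ty_renD ren_ty_inject unren_has_kind_Type[OF _ Nil(1,2)] by blast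
next
  case (Cons y ys)
  have inj: "inj \<rho>" using Cons(2) by (simp add: unren_ok_def)
  have y: "y \<notin> range \<rho>" "\<sigma> y = Var y" "lookup \<Gamma>' y = subst_ty \<sigma> (lookup \<Gamma> y)"
    using Cons(5) by auto
  obtain T' where T': "has_type \<Sigma> \<Gamma> (App H (Var y)) T'"
    using has_type_apps_head Cons(9) by fastforce
  obtain S' where S': "has_type \<Sigma> \<Gamma>' (App H' (Var y)) S'"
    using has_type_apps_head Cons(10) by fastforce
  obtain T1 T2 where T: "has_type \<Sigma> \<Gamma> H (Pi T1 T2)" "has_type \<Sigma> \<Gamma> (Var y) T1"
    "nf_ty (subst_ty (inst [Var y]) T2) T'"
    using T' by (elim has_type_App) blast
  obtain S1 S2 where S: "has_type \<Sigma> \<Gamma>' H' (Pi S1 S2)" "has_type \<Sigma> \<Gamma>' (Var y) S1"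
    "nf_ty (subst_ty (inst [Var y]) S2) S'"
    using S' by (elim has_type_App) blast
  have Teq: "T = Pi T1 T2" using has_type_unique T(1) Cons(6) by blast
  have "ren_ty \<rho> D = Pi S1 S2" using has_type_unique S(1) Cons(7) by blast
  then obtain D1 D2 where D: "D = Pi D1 D2" "S1 = ren_ty \<rho> D1" "S2 = ren_ty (up_ren \<rho>) D2"
    by (cases D) auto
  obtain U1 U2 where U: "U = Pi U1 U2" "subst_ty \<sigma> T1 = ren_ty \<rho> U1"
    "subst_ty (up \<sigma>) T2 = ren_ty (up_ren \<rho>) U2"
    using Cons(8) unfolding Teq by (cases U) auto
  \<comment> \<open>A variable instance of a normal type is normal, so \<open>T'\<close> is the
    instance itself and not a proper reduct of it; the same holds for \<open>S'\<close>
    below.\<close>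
  have "nf_ty T2 T2" using has_type_normal[OF T(1)] by (auto simp: nf_ty_Pi)
  then have "T' = ren_ty (case_nat y (\<lambda>x. x)) T2"
    using T(3) nf_ty_unique[OF _ nf_ty_ren] unfolding inst_Var by blast
  then have T'eq: "subst_ty \<sigma> T' = ren_ty (case_nat y \<rho>) U2"
    by (simp add: inst_Var[symmetric] subst_inst_ty y U inst_Var_up_ren)
  have "nf_ty S2 S2" using has_type_normal[OF S(1)] by (auto simp: nf_ty_Pi)
  then have "S' = ren_ty (case_nat y (\<lambda>x. x)) S2"
    using S(3) nf_ty_unique[OF _ nf_ty_ren] unfolding inst_Var by blast
  then have S'eq: "S' = ren_ty (case_nat y \<rho>) D2"
    by (simp add: inst_Var[symmetric] D inst_Var_up_ren)
  have nfT: "nf_ty (lookup \<Gamma> y) T1" using T(2) by (elim has_type_Var)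
  have nfS: "y < length \<Gamma>'" "nf_ty (lookup \<Gamma>' y) (ren_ty \<rho> D1)"
    using S(2) unfolding D by (auto elim: has_type_Var)
  have "nf_ty (ren_ty \<rho> U1) (ren_ty \<rho> D1)"
    using nf_ty_subst[OF nfT, of \<sigma> "ren_ty \<rho> D1"] nfS(2) by (simp add: y U)
  then have nfU1: "nf_ty U1 D1" using nf_ty_renD ren_ty_inject[OF inj] by blast
  \<comment> \<open>The declared type of \<open>y\<close> in the second context is a type and
    reduces to the instance of \<open>T1\<close>. Pulling this back along \<rho> shows that
    \<open>U1\<close> may be declared over \<Psi>.\<close>
  have "has_kind \<Sigma> \<Gamma>' (subst_ty \<sigma> (lookup \<Gamma> y)) Type"
    using lookup_has_kind[OF has_type_imp_wf_ctx[OF S(2)] nfS(1)] y by simp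
  then have "has_kind \<Sigma> \<Gamma>' (ren_ty \<rho> U1) Type"
    using betas_has_kind[OF betas_subst_ty[OF nf_ty_imp_betas[OF nfT]], of \<Gamma>' \<sigma> Type] U(2) by simp
  then have U1: "has_kind \<Sigma> \<Psi> U1 Type" by (rule unren_has_kind_Type[OF _ Cons(2,3)])
  \<comment> \<open>The new entry of \<Psi> stands for \<open>y\<close>. Its type \<open>U1\<close>
    agrees with the declared type of \<open>y\<close> only up to normalization.\<close>
  have "unren_ok (case_nat y \<rho>) (U1 # \<Psi>) \<Gamma>'"
    unfolding unren_ok_def
  proof (intro conjI allI impI)
    show "inj (case_nat y \<rho>)" using inj y(1) by (rule inj_case_nat)
    fix x A assume x: "case_nat y \<rho> x < length \<Gamma>'" "nf_ty (lookup \<Gamma>' (case_nat y \<rho> x)) A"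
    have "x < length (U1 # \<Psi>) \<and> (\<exists>B. A = ren_ty (case_nat y \<rho>) B \<and> nf_ty (lookup (U1 # \<Psi>) x) B)"
    proof (cases x)
      case 0
      then have "A = ren_ty \<rho> D1" using x(2) nfS(2) nf_ty_unique by simp
      then show ?thesis using 0 nf_ty_ren[OF nfU1, of Suc]
        by (auto simp: ren_case_nat_Suc intro!: exI[of _ "ren_ty Suc D1"])
    next
      case (Suc z)
      then obtain B where "z < length \<Psi>" "A = ren_ty \<rho> B" "nf_ty (lookup \<Psi> z) B"
        using x Cons(2) by (auto simp: unren_ok_def)
      then show ?thesis using Suc
        by (auto simp: ren_case_nat_Suc intro!: exI[of _ "ren_ty Suc B"] nf_ty_ren)
    qed
    then show "x < length (U1 # \<Psi>)"
      "\<exists>B. A = ren_ty (case_nat y \<rho>) B \<and> nf_ty (lookup (U1 # \<Psi>) x) B" by auto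
  qed
  moreover have "wf_ctx \<Sigma> (U1 # \<Psi>)" using Cons(3) U1 by (rule ctx_cons)
  moreover have "distinct ys" using Cons(4) by simp
  moreover have "\<forall>z\<in>set ys. z \<notin> range (case_nat y \<rho>) \<and> \<sigma> z = Var z \<and>
      lookup \<Gamma>' z = subst_ty \<sigma> (lookup \<Gamma> z)"
    using Cons(4,5) by (auto split: nat.splits)
  moreover have "has_type \<Sigma> \<Gamma>' (App H' (Var y)) (ren_ty (case_nat y \<rho>) D2)" using S' S'eq by simp
  moreover have "has_type \<Sigma> \<Gamma> (apps (App H (Var y)) (map Var ys)) E"
    "has_type \<Sigma> \<Gamma>' (apps (App H' (Var y)) (map Var ys)) E'"
    using Cons(9,10) by simp_all
  ultimately have "nf_ty U2 D2 \<and> has_kind \<Sigma> (U1 # \<Psi>) U2 Type"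
    using Cons(1)[OF _ _ _ _ T' _ T'eq] by blast
  then show ?case using nfU1 U1 by (auto simp: U D nf_ty_Pi intro: ty_pi)
qed

section \<open>Instantiating a block of declarations\<close>

lemma length_subst_ctx [simp]: "length (subst_ctx \<tau> \<Theta>) = length \<Theta>"
  by (induct \<Theta>) auto

lemma ups_below: "y < k \<Longrightarrow> ups k \<tau> y = Var y"
  by (induct k arbitrary: y) (auto simp: less_Suc_eq_0_disj)

lemma ups_above: "ups k \<tau> (y + k) = ren_obj (\<lambda>z. z + k) (\<tau> y)"
  by (induct k) (auto simp: ren_obj_id ren_ren_obj comp_def)

text \<open>The condition on \<open>y\<close> excludes just the instantiated block: variables of
  \<Theta> keep their index, and those of \<Gamma> move down by the length of the block. This
  provides hypotheses of \<open>good_Var\<close> and \<open>pattern_spine\<close>.\<close>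

lemma lookup_instantiated:
  assumes len: "length Ns = length Bs" and "y < length \<Theta> \<or> length \<Theta> + length Bs \<le> y"
  shows "\<exists>z. ups (length \<Theta>) (inst Ns) y = Var z \<and>
    lookup (subst_ctx (inst Ns) \<Theta> @ \<Gamma>) z =
      subst_ty (ups (length \<Theta>) (inst Ns)) (lookup (\<Theta> @ rev Bs @ \<Gamma>) y)"
  using assms(2)
proof (induct \<Theta> arbitrary: y)
  case Nil
  then obtain z where y: "y = z + length (rev Bs)" by (auto simp: le_iff_add add.commute)
  have "inst Ns \<circ> (\<lambda>y. y + length (rev Bs)) = Var" by (auto simp: inst_def len)
  then have "subst_ty (inst Ns) (lookup (rev Bs @ \<Gamma>) y) = lookup \<Gamma> z"
    unfolding y lookup_append subst_ren_ty by simp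
  moreover have "inst Ns y = Var z" by (simp add: inst_def y len)
  ultimately show ?case by simp
next
  case (Cons A \<Theta>)
  show ?case
  proof (cases y)
    case 0
    then show ?thesis by (simp add: subst_up_ren_Suc)
  next
    case (Suc x)
    then obtain z where "ups (length \<Theta>) (inst Ns) x = Var z"
      "lookup (subst_ctx (inst Ns) \<Theta> @ \<Gamma>) z =
        subst_ty (ups (length \<Theta>) (inst Ns)) (lookup (\<Theta> @ rev Bs @ \<Gamma>) x)"
      using Cons by auto
    then show ?thesis using Suc by (simp add: subst_up_ren_Suc)
  qed
qed

text \<open>The first conjunct is the goal. The second is what a restart at the declared type of a
  strict variable consumes; it speaks of a normal form because the pattern argument sees only
  normalized types of variables.\<close>

definition instantiates :: "ctx \<Rightarrow> ty list \<Rightarrow> obj list \<Rightarrow> nat \<Rightarrow> bool" where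
  "instantiates \<Gamma> Bs Ns i \<longleftrightarrow>
    has_type_nf \<Sigma> \<Gamma> (Ns ! i) (subst_ty (inst (take i Ns)) (Bs ! i)) \<and>
    (\<exists>C. nf_ty (Bs ! i) C \<and> has_kind \<Sigma> \<Gamma> (subst_ty (inst (take i Ns)) C) Type)"

text \<open>\<open>Bs ! i\<close> is formed below the first \<open>i\<close> declarations only, so
  index 0 there is the variable just before it; in the full block of \<open>n\<close> that variable
  has index \<open>n - i\<close>.\<close>

lemma inst_take:
  assumes "length Ns = n" "i < n"
  shows "inst Ns (y + (n - i)) = inst (take i Ns) y"
proof (cases "y < i")
  case True
  then have "y + (n - i) < n" using assms by simp
  then have "inst Ns (y + (n - i)) = Ns ! (n - Suc (y + (n - i)))"
    using assms by (simp add: inst_def rev_nth)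
  also have "n - Suc (y + (n - i)) = i - Suc y" using assms True by simp
  finally show ?thesis using True assms by (simp add: inst_def rev_nth)
next
  case False
  then have "\<not> y + (n - i) < n" using assms by linarith
  moreover have "y + (n - i) - n = y - i" using False assms by linarith
  ultimately show ?thesis using False assms by (simp add: inst_def)
qed

lemma strict_pattern:
  assumes len: "length Ns = length Bs" and i: "i < length Bs"
    and x: "x = length \<Theta> + (length Bs - Suc i)"
    and ys: "distinct ys" "set ys \<subseteq> {..<length \<Theta>}"
    and good: "good (ups (length \<Theta>) (inst Ns)) (\<Theta> @ rev Bs @ \<Gamma>) (subst_ctx (inst Ns) \<Theta> @ \<Gamma>)
      (apps (Var x) (map Var ys))"
  shows "instantiates \<Gamma> Bs Ns i"
proof -
  define k where "k = length \<Theta>"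
  define \<sigma> where "\<sigma> = ups k (inst Ns)"
  define \<Gamma>1 where "\<Gamma>1 = \<Theta> @ rev Bs @ \<Gamma>"
  define \<Gamma>2 where "\<Gamma>2 = subst_ctx (inst Ns) \<Theta> @ \<Gamma>"
  let ?\<rho> = "\<lambda>z. z + k"
  have \<sigma>x: "\<sigma> x = ren_obj ?\<rho> (Ns ! i)"
  proof -
    \<comment> \<open>The block is counted backwards: its last variable has index 0, so the
      zero-based position \<open>i\<close> has index \<open>length Bs - Suc i\<close>.\<close>
    have "length Bs - Suc i < length Ns" "length Ns - Suc (length Bs - Suc i) = i"
      using i len by simp_all
    then have "inst Ns (length Bs - Suc i) = Ns ! i" by (simp add: inst_def rev_nth)
    moreover have "x = length Bs - Suc i + k" by (simp add: x k_def)
    ultimately show ?thesis using ups_above[of k "inst Ns" "length Bs - Suc i"] by (simp add: \<sigma>_def)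
  qed
  have \<sigma>ys: "map (subst_obj \<sigma>) (map Var ys) = map Var ys"
    using ys(2) by (auto simp: \<sigma>_def k_def ups_below)
  obtain E E' where E: "has_type \<Sigma> \<Gamma>1 (apps (Var x) (map Var ys)) E"
    "has_type \<Sigma> \<Gamma>2 (apps (ren_obj ?\<rho> (Ns ! i)) (map Var ys)) E'"
    "nf_ty (subst_ty \<sigma> E) E'" "has_kind \<Sigma> \<Gamma>2 (subst_ty \<sigma> E) Type"
    using good \<sigma>x \<sigma>ys unfolding good_def \<sigma>_def[symmetric] k_def[symmetric] \<Gamma>1_def[symmetric] \<Gamma>2_def[symmetric]
    by (auto simp: subst_apps simp del: map_map)
  have "wf_ctx \<Sigma> \<Gamma>2" using has_type_imp_wf_ctx[OF E(2)] .
  then have wf: "wf_ctx \<Sigma> \<Gamma>" unfolding \<Gamma>2_def by (rule wf_ctx_appendD)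
  have unren: "unren_ok ?\<rho> \<Gamma> \<Gamma>2"
    using unren_ok_append[of "subst_ctx (inst Ns) \<Theta>" \<Gamma>] by (simp add: \<Gamma>2_def k_def)
  obtain T where T: "has_type \<Sigma> \<Gamma>1 (Var x) T" using has_type_apps_head[OF E(1)] by blast
  obtain S where S: "has_type \<Sigma> \<Gamma>2 (ren_obj ?\<rho> (Ns ! i)) S" using has_type_apps_head[OF E(2)] by blast
  \<comment> \<open>The shifted \<open>Ns ! i\<close> is typed over the instantiated \<Theta>;
    strengthening types it over \<Gamma> alone, with a type still to be identified.\<close>
  obtain D where D: "S = ren_ty ?\<rho> D" "has_type \<Sigma> \<Gamma> (Ns ! i) D"
    using unren_has_type[OF S unren wf refl] by blast
  have "length Bs - Suc i < length Bs" "length Bs - Suc (length Bs - Suc i) = i" using i by simp_all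
  then have "(rev Bs @ \<Gamma>) ! (length Bs - Suc i) = Bs ! i" by (simp add: nth_append rev_nth)
  then have "\<Gamma>1 ! x = Bs ! i" by (simp add: \<Gamma>1_def x)
  then have "nf_ty (ren_ty (\<lambda>y. y + Suc x) (Bs ! i)) T"
    using T by (auto simp: lookup_def elim: has_type_Var)
  then obtain C where C: "T = ren_ty (\<lambda>y. y + Suc x) C" "nf_ty (Bs ! i) C" using nf_ty_renD by blast
  \<comment> \<open>The declared type of \<open>x\<close> is shifted past \<open>x\<close> itself,
    so \<sigma> meets only earlier block variables and those of \<Gamma>. On these it acts as
    \<open>inst (take i Ns)\<close> followed by the shift over \<Theta>.\<close>
  have "\<sigma> (y + Suc x) = ren_obj ?\<rho> (inst (take i Ns) y)" for y
  proof -
    have eq: "y + Suc x = (y + (length Bs - i)) + k" using i by (simp add: x k_def)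
    show ?thesis unfolding eq \<sigma>_def ups_above inst_take[OF len i] ..
  qed
  then have "\<sigma> \<circ> (\<lambda>y. y + Suc x) = ren_obj ?\<rho> \<circ> inst (take i Ns)" by (simp only: fun_eq_iff comp_apply simp_thms)
  then have U: "subst_ty \<sigma> T = ren_ty ?\<rho> (subst_ty (inst (take i Ns)) C)"
    unfolding C(1) subst_ren_ty ren_subst_ty by simp
  have "y \<notin> range ?\<rho> \<and> \<sigma> y = Var y \<and> lookup \<Gamma>2 y = subst_ty \<sigma> (lookup \<Gamma>1 y)" if "y \<in> set ys" for y
  proof -
    have y: "y < k" using that ys(2) by (auto simp: k_def)
    then show ?thesis
      using lookup_instantiated[OF len, of y \<Theta> \<Gamma>] ups_below[OF y]
      by (auto simp: k_def \<sigma>_def \<Gamma>1_def \<Gamma>2_def)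
  qed
  then have "nf_ty (subst_ty (inst (take i Ns)) C) D \<and> has_kind \<Sigma> \<Gamma> (subst_ty (inst (take i Ns)) C) Type"
    using pattern_spine[OF unren wf ys(1) _ T S[unfolded D(1)] U E] by blast
  then show ?thesis
    using C(2) D(2) nf_ty_subst[OF C(2)] unfolding instantiates_def has_type_nf_def by blast
qed

text \<open>Each abstraction crossed is moved into \<Theta>, where the instantiation leaves its
  variable fixed. Two bounds are maintained: the elements of \<delta> are indices of \<Theta>, and
  the block lies in \<open>X\<close>, so a head variable outside \<open>X\<close> is only
  renamed.\<close>

lemma strict_obj_instantiates:
  assumes len: "length Ns = length Bs" and i: "i < length Bs"
  shows "strict_obj X \<delta> x M \<Longrightarrow> x = length \<Theta> + (length Bs - Suc i) \<Longrightarrow> \<delta> \<subseteq> {..<length \<Theta>} \<Longrightarrow>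
    {length \<Theta>..<length \<Theta> + length Bs} \<subseteq> X \<Longrightarrow>
    good (ups (length \<Theta>) (inst Ns)) (\<Theta> @ rev Bs @ \<Gamma>) (subst_ctx (inst Ns) \<Theta> @ \<Gamma>) M \<Longrightarrow>
    instantiates \<Gamma> Bs Ns i"
proof (induct arbitrary: \<Theta> rule: strict_obj.induct)
  case (init_o ys \<delta> X x)
  then show ?case using strict_pattern[OF len i] by blast
next
  case (app_var_o y X M Ms \<delta> x)
  let ?\<sigma> = "ups (length \<Theta>) (inst Ns)" and ?\<Gamma>1 = "\<Theta> @ rev Bs @ \<Gamma>"
    and ?\<Gamma>2 = "subst_ctx (inst Ns) \<Theta> @ \<Gamma>"
  obtain E E' where E: "has_type \<Sigma> ?\<Gamma>1 (apps (Var y) Ms) E"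
    "has_type \<Sigma> ?\<Gamma>2 (subst_obj ?\<sigma> (apps (Var y) Ms)) E'"
    using app_var_o(8) unfolding good_def by blast
  have "y < length \<Theta> \<or> length \<Theta> + length Bs \<le> y" using app_var_o(1,7)
    by (meson atLeastLessThan_iff leI subsetD)
  then obtain z where z: "?\<sigma> y = Var z" "lookup ?\<Gamma>2 z = subst_ty ?\<sigma> (lookup ?\<Gamma>1 y)"
    using lookup_instantiated[OF len] by blast
  obtain F where "has_type \<Sigma> ?\<Gamma>1 (Var y) F" using has_type_apps_head[OF E(1)] by blast
  moreover obtain F' where "has_type \<Sigma> ?\<Gamma>2 (Var z) F'"
    using has_type_apps_head E(2) z(1) by (fastforce simp: subst_apps)
  ultimately have "good ?\<sigma> ?\<Gamma>1 ?\<Gamma>2 (Var y)" using good_Var z by blast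
  then have "good ?\<sigma> ?\<Gamma>1 ?\<Gamma>2 M" using good_appsD E app_var_o(2) by blast
  then show ?case using app_var_o(4)[OF app_var_o(5-7)] by blast
next
  case (app_con_o M Ms X \<delta> x c)
  let ?\<sigma> = "ups (length \<Theta>) (inst Ns)" and ?\<Gamma>1 = "\<Theta> @ rev Bs @ \<Gamma>"
    and ?\<Gamma>2 = "subst_ctx (inst Ns) \<Theta> @ \<Gamma>"
  obtain E E' where E: "has_type \<Sigma> ?\<Gamma>1 (apps (Con c) Ms) E"
    "has_type \<Sigma> ?\<Gamma>2 (subst_obj ?\<sigma> (apps (Con c) Ms)) E'"
    using app_con_o(7) unfolding good_def by blast
  obtain F where "has_type \<Sigma> ?\<Gamma>1 (Con c) F" using has_type_apps_head[OF E(1)] by blast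
  moreover obtain F' where "has_type \<Sigma> ?\<Gamma>2 (Con c) F'"
    using has_type_apps_head E(2) by (fastforce simp: subst_apps)
  ultimately have "good ?\<sigma> ?\<Gamma>1 ?\<Gamma>2 (Con c)" using good_Con by blast
  then have "good ?\<sigma> ?\<Gamma>1 ?\<Gamma>2 M" using good_appsD E app_con_o(1) by blast
  then show ?case using app_con_o(3)[OF app_con_o(4-6)] by blast
next
  case (abs_o X \<delta> x M A)
  have "{length (A # \<Theta>)..<length (A # \<Theta>) + length Bs} \<subseteq> Suc ` X"
    using image_mono[OF abs_o(5), of Suc] by (simp add: image_Suc_atLeastLessThan)
  moreover have "good (ups (length (A # \<Theta>)) (inst Ns)) ((A # \<Theta>) @ rev Bs @ \<Gamma>)
      (subst_ctx (inst Ns) (A # \<Theta>) @ \<Gamma>) M"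
    using good_LamD[OF abs_o(6)] by simp
  moreover have "insert 0 (Suc ` \<delta>) \<subseteq> {..<length (A # \<Theta>)}" using abs_o(4) by auto
  ultimately show ?case using abs_o(2)[of "A # \<Theta>"] abs_o(3) by simp
qed

lemma subst_ctx_append:
  "subst_ctx \<tau> (\<Delta> @ A # \<Theta>) = take (length \<Delta>) (subst_ctx \<tau> (\<Delta> @ A # \<Theta>)) @
    subst_ty (ups (length \<Theta>) \<tau>) A # subst_ctx \<tau> \<Theta>"
  by (induct \<Delta>) auto

text \<open>
  The induction is over strictness derivations up to reduction of the type and the context, since
  for a strict variable \<open>x\<^sub>j\<close> only the instance of the normal form of \<open>B\<^sub>j\<close> is known to be a type.
\<close>

lemma strict_ty_instantiates:
  "strict_ty \<Xi> x A \<Longrightarrow> list_all2 beta_ty\<^sup>*\<^sup>* \<Xi> (\<Theta> @ rev Bs) \<Longrightarrow> beta_ty\<^sup>*\<^sup>* A A' \<Longrightarrow>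
    length Ns = length Bs \<Longrightarrow> i < length Bs \<Longrightarrow> x = length \<Theta> + (length Bs - Suc i) \<Longrightarrow>
    has_kind \<Sigma> (\<Theta> @ rev Bs @ \<Gamma>) A' Type \<Longrightarrow>
    has_kind \<Sigma> (subst_ctx (inst Ns) \<Theta> @ \<Gamma>) (subst_ty (ups (length \<Theta>) (inst Ns)) A') Type \<Longrightarrow>
    instantiates \<Gamma> Bs Ns i"
proof (induct arbitrary: \<Theta> Bs Ns i A' rule: strict_ty.induct)
  case (app_t M Ms \<Xi> x a)
  obtain Ms' where Ms': "A' = tapps (TCon a) Ms'" "list_all2 beta_obj\<^sup>*\<^sup>* Ms Ms'"
    using betas_tapps[OF app_t(4)] by blast
  then obtain M' where M': "M' \<in> set Ms'" "beta_obj\<^sup>*\<^sup>* M M'"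
    using app_t(1) by (metis list_all2_conv_all_nth in_set_conv_nth)
  have "length \<Xi> = length \<Theta> + length Bs" using app_t(3) by (auto dest: list_all2_lengthD)
  then have "{length \<Theta>..<length \<Theta> + length Bs} \<subseteq> {..<length \<Xi>}" by auto
  moreover have "strict_obj {..<length \<Xi>} {} x M'" using strict_obj_betas[OF M'(2) app_t(2)] .
  moreover have "good (ups (length \<Theta>) (inst Ns)) (\<Theta> @ rev Bs @ \<Gamma>) (subst_ctx (inst Ns) \<Theta> @ \<Gamma>) M'"
    using good_tappsD app_t(8,9) M'(1) unfolding Ms'(1) by blast
  ultimately show ?case using strict_obj_instantiates[OF app_t(5,6) _ app_t(7)] by blast
next
  case (pi_t A \<Xi> x B)
  obtain A1 B1 where A': "A' = Pi A1 B1" "beta_ty\<^sup>*\<^sup>* A A1" "beta_ty\<^sup>*\<^sup>* B B1"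
    using betas_PiD[OF pi_t(4)] by blast
  show ?case
  proof (rule pi_t(2)[of "A1 # \<Theta>" Bs B1])
    show "list_all2 beta_ty\<^sup>*\<^sup>* (A # \<Xi>) ((A1 # \<Theta>) @ rev Bs)" using pi_t(3) A'(2) by simp
    show "has_kind \<Sigma> ((A1 # \<Theta>) @ rev Bs @ \<Gamma>) B1 Type"
      using pi_t(8) unfolding A' by (auto elim: has_kind_Pi)
    show "has_kind \<Sigma> (subst_ctx (inst Ns) (A1 # \<Theta>) @ \<Gamma>)
        (subst_ty (ups (length (A1 # \<Theta>)) (inst Ns)) B1) Type"
      using pi_t(9) unfolding A' by (auto elim: has_kind_Pi)
  qed (use pi_t A' in auto)
next
  case (ctx_t \<Gamma>\<^sub>1 x B \<Gamma>\<^sub>2 A)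
  obtain \<Gamma>2' B' \<Gamma>1' where split: "\<Theta> @ rev Bs = \<Gamma>2' @ B' # \<Gamma>1'" "length \<Gamma>2' = length \<Gamma>\<^sub>2"
    "beta_ty\<^sup>*\<^sup>* B B'" "list_all2 beta_ty\<^sup>*\<^sup>* \<Gamma>\<^sub>1 \<Gamma>1'"
    using ctx_t(5) by (auto simp: list_all2_append1 list_all2_Cons1 dest: list_all2_lengthD)
  have wf: "wf_ctx \<Sigma> (\<Theta> @ rev Bs @ \<Gamma>)" "wf_ctx \<Sigma> (subst_ctx (inst Ns) \<Theta> @ \<Gamma>)"
    using ctx_t(10,11) has_kind_imp_wf_ctx by blast+
  have all: "\<Theta> @ rev Bs @ \<Gamma> = \<Gamma>2' @ B' # \<Gamma>1' @ \<Gamma>" using arg_cong[OF split(1), of "\<lambda>l. l @ \<Gamma>"] by simp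
  have B': "has_kind \<Sigma> (\<Gamma>1' @ \<Gamma>) B' Type" using wf(1) unfolding all by (rule wf_ctx_entry)
  show ?case
  \<comment> \<open>The intermediate variable of the context rule is either declared in \<Theta> or
    one of those instantiated.\<close>
  proof (cases "length \<Gamma>\<^sub>2 < length \<Theta>")
    case True
    define \<Theta>1 where "\<Theta>1 = drop (Suc (length \<Gamma>\<^sub>2)) \<Theta>"
    have "take (Suc (length \<Gamma>\<^sub>2)) (\<Theta> @ rev Bs) = \<Gamma>2' @ [B']"
      "drop (Suc (length \<Gamma>\<^sub>2)) (\<Theta> @ rev Bs) = \<Gamma>1'"
      unfolding split(1) using split(2) by simp_all
    then have "take (Suc (length \<Gamma>\<^sub>2)) \<Theta> = \<Gamma>2' @ [B']" "\<Theta>1 @ rev Bs = \<Gamma>1'"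
      using True by (simp_all add: \<Theta>1_def)
    then have eq: "\<Theta> = \<Gamma>2' @ B' # \<Theta>1" "\<Gamma>1' = \<Theta>1 @ rev Bs"
      using append_take_drop_id[of "Suc (length \<Gamma>\<^sub>2)" \<Theta>] by (simp_all add: \<Theta>1_def)
    have x: "x = length \<Theta>1 + (length Bs - Suc i)" using ctx_t(9) eq(1) split(2) by simp
    \<comment> \<open>The instance of \<open>B'\<close> is an entry of the second context, so it is
      a type by well-formedness of that context.\<close>
    have "has_kind \<Sigma> (subst_ctx (inst Ns) \<Theta>1 @ \<Gamma>) (subst_ty (ups (length \<Theta>1) (inst Ns)) B') Type"
      using wf(2) unfolding eq(1)
      by (subst (asm) subst_ctx_append) (simp add: wf_ctx_entry)
    then show ?thesis
      using ctx_t(2)[of \<Theta>1 Bs B' Ns i] split(3,4) eq(2) ctx_t(7,8) x B' by simp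
  next
    case False
    \<comment> \<open>In the block, \<open>length \<Gamma>\<^sub>2 - length \<Theta>\<close>
      variables are declared after the intermediate one; \<open>j\<close> is its zero-based position
      from the other end.\<close>
    define j where "j = length Bs - Suc (length \<Gamma>\<^sub>2 - length \<Theta>)"
    have "length \<Theta> + length Bs = Suc (length \<Gamma>\<^sub>2 + length \<Gamma>1')"
      using arg_cong[OF split(1), of length] split(2) by simp
    then have j: "j < length Bs" "length \<Gamma>\<^sub>2 = length \<Theta> + (length Bs - Suc j)" "length \<Gamma>1' = j"
      using False by (auto simp: j_def)
    have "drop (length \<Gamma>\<^sub>2) (\<Theta> @ rev Bs) = rev (take (Suc j) Bs)"
      using j(1,2) by (simp add: drop_rev)
    then have "B' # \<Gamma>1' = rev (take (Suc j) Bs)" using split(1,2) by simp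
    then have eq: "B' = Bs ! j" "\<Gamma>1' = rev (take j Bs)"
      using j(1) by (auto simp: take_Suc_conv_app_nth)
    \<comment> \<open>Strictness of the intermediate variable in \<open>A\<close> gives the claim
      for \<open>j\<close>, and with it that the instance of the normal form \<open>C\<close> of its
      declared type is a type.\<close>
    have "instantiates \<Gamma> Bs Ns j" using ctx_t(4)[OF ctx_t(5-7) j(1,2) ctx_t(10,11)] .
    then obtain C where C: "nf_ty (Bs ! j) C" "has_kind \<Sigma> \<Gamma> (subst_ty (inst (take j Ns)) C) Type"
      unfolding instantiates_def by blast
    have x: "i < j" "x = j - Suc i" using ctx_t(8,9) j by linarith+
    \<comment> \<open>The argument restarts with \<open>C\<close> as the type, the first
      \<open>j\<close> declarations as the block and an empty \<Theta>. Afterwards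
      \<open>take i (take j Ns)\<close> collapses because \<open>i < j\<close>.\<close>
    have "instantiates \<Gamma> (take j Bs) (take j Ns) i"
    proof (rule ctx_t(2)[of "[]" "take j Bs" C "take j Ns" i])
      show "list_all2 beta_ty\<^sup>*\<^sup>* \<Gamma>\<^sub>1 ([] @ rev (take j Bs))" using split(4) eq by simp
      show "beta_ty\<^sup>*\<^sup>* B C" using split(3) nf_ty_imp_betas[OF C(1)] eq(1) by simp
      show "has_kind \<Sigma> ([] @ rev (take j Bs) @ \<Gamma>) C Type"
        using nf_preserves_has_kind[OF C(1)] B' eq by simp
    qed (use C(2) x j(1) ctx_t(7) in auto)
    then show ?thesis using x(1) j(1) ctx_t(7) by (simp add: instantiates_def min_def)
  qed
qed

end

theorem lemma3:
  fixes \<Sigma> :: sig and \<Gamma> \<Gamma>\<^sub>0 \<Theta> :: ctx and Ns :: "obj list" and Bs :: "ty list"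
    and A :: ty and i :: nat
  assumes "valid_sig \<Sigma>"
    and "length Ns = length Bs"
    and "\<Gamma>\<^sub>0 = rev Bs"
    and "base_type \<Sigma> A"
    and "i < length Bs"
    and "strict_ty (\<Theta> @ \<Gamma>\<^sub>0) (length \<Theta> + (length Bs - Suc i)) A"
    and "has_kind \<Sigma> (\<Theta> @ \<Gamma>\<^sub>0 @ \<Gamma>) A Type"
    and "has_kind \<Sigma> (subst_ctx (inst Ns) \<Theta> @ \<Gamma>) (subst_ty (ups (length \<Theta>) (inst Ns)) A) Type"
  shows "has_type_nf \<Sigma> \<Gamma> (Ns ! i) (subst_ty (inst (take i Ns)) (Bs ! i))"
proof -
  interpret valid_signature \<Sigma> using assms(1) by unfold_locales
  have "list_all2 beta_ty\<^sup>*\<^sup>* (\<Theta> @ \<Gamma>\<^sub>0) (\<Theta> @ rev Bs)"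
    unfolding assms(3) by (simp add: list.rel_refl)
  then have "instantiates \<Gamma> Bs Ns i"
    using strict_ty_instantiates[OF assms(6) _ rtranclp.rtrancl_refl assms(2,5) refl] assms(3,7,8) by blast
  then show ?thesis by (simp add: instantiates_def)
qed

end
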